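(* Let $R$ be a Cohen-Macaulay complete local ring with canonical module $\omega$, and $\mathrm{cl}$ a residual, functorial closure operation on $R$-modules. If $R$ is $\mathrm{cl}$-rational, then every ideal generated by a system of parameters is $\mathrm{cl}$-closed. If in addition $\mathrm{cl}$ satisfies the injective finiteness condition, then the converse holds (i.e. if every ideal generated by a system of parameters is $\mathrm{cl}$-closed, then $R$ is $\mathrm{cl}$-rational).
   Context: All rings are commutative Noetherian; $(R,\mathfrak{m},k)$ has Krull dimension $d$, and $E=E_R(k)$ is the injective hull of the residue field. A closure operation $\mathrm{cl}$ on $R$-modules assigns to each pair of $R$-modules $N\subseteq M$ a submodule $N_M^{\mathrm{cl}}\subseteq M$ such that $N\subseteq N_M^{\mathrm{cl}}$; $(N_M^{\mathrm{cl}})_M^{\mathrm{cl}}=N_M^{\mathrm{cl}}$; and $N\subseteq N'\subseteq M$ implies $N_M^{\mathrm{cl}}\subseteq (N')_M^{\mathrm{cl}}$. An ideal $I$ is $\mathrm{cl}$-closed if $I_R^{\mathrm{cl}}=I$. $\mathrm{cl}$ is functorial if for every $R$-linear $f:M\to N$ and $L\subseteq M$, $f(L_M^{\mathrm{cl}})\subseteq f(L)_N^{\mathrm{cl}}$. $\mathrm{cl}$ is residual if for all $L\subseteq N\subseteq M$, $N_M^{\mathrm{cl}}=\pi^{-1}\left((N/L)_{M/L}^{\mathrm{cl}}\right)$, where $\pi:M\to M/L$ is the natural surjection. Finitistic version of a residual $\mathrm{cl}$: $L_M^{\mathrm{cl}_{fg}}=\bigcup\{L_N^{\mathrm{cl}}\mid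 L\subseteq N\subseteq M,\ N/L\text{ finitely generated}\}$. The injective finiteness condition (for $R$ Cohen-Macaulay local with canonical module) is: $0^{\mathrm{cl}}_{H^d_{\mathfrak{m}}(R)}=0^{\mathrm{cl}_{fg}}_{H^d_{\mathfrak{m}}(R)}$. Identify $\omega\cong \operatorname{Hom}_R(H^d_{\mathfrak{m}}(R),E)$; for a submodule $N\subseteq H^d_{\mathfrak{m}}(R)$, $\operatorname{Ann}_\omega N=\{f\in\operatorname{Hom}_R(H^d_{\mathfrak{m}}(R),E)\mid f(N)=0\}$. Set $\tau_{\mathrm{cl}}(\omega)=\operatorname{Ann}_\omega 0^{\mathrm{cl}}_{H^d_{\mathfrak{m}}(R)}$. A Cohen-Macaulay complete local ring $R$ is $\mathrm{cl}$-rational if $\tau_{\mathrm{cl}}(\omega)=\omega$. *)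

theory Defs
  imports "HOL-Algebra.Ideal_Product" "HOL-Algebra.Ring_Divisibility" "HOL-Algebra.Module"
    "HOL-Library.Extended_Nat"
begin

text \<open>
  Universe. A ring \<open>R\<close> and the modules over it are subsets of one and the same type \<open>'a\<close>: a module is
  a record of type \<open>('a, 'a) module\<close> satisfying the locale predicate \<^locale>\<open>module\<close>. The type \<open>'a\<close>
  is arbitrary and nothing ties \<open>carrier R\<close> to \<open>UNIV\<close>, so \<open>'a\<close> plays the role of a universe
  containing \<open>R\<close>, of any prescribed size. Submodules of modules in \<open>'a\<close> are modules in \<open>'a\<close>, and
  so are quotients after choosing representatives of the cosets. If \<open>'a\<close> is infinite and \<open>R\<close> is
  Noetherian, then finite direct sums and injective hulls can be formed in \<open>'a\<close> as well.

  As constructions with sets of cosets leave the type \<open>'a\<close>, objects that are determined only up to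
  isomorphism (quotients, cohomology, injective hulls) are described by predicates.
\<close>

section \<open>Modules\<close>

definition self_module :: "('a, 'm) ring_scheme \<Rightarrow> ('a, 'a) module" where
  "self_module R = \<lparr>carrier = carrier R, monoid.mult = monoid.mult R, one = \<one>\<^bsub>R\<^esub>, ring.zero = \<zero>\<^bsub>R\<^esub>, ring.add = ring.add R,
     smult = monoid.mult R\<rparr>"

definition module_hom ::
    "('a, 'm) ring_scheme \<Rightarrow> ('a, 'b) module \<Rightarrow> ('a, 'c) module \<Rightarrow> ('b \<Rightarrow> 'c) set" where
  "module_hom R M N = {f \<in> hom (add_monoid M) (add_monoid N).
     \<forall>r\<in>carrier R. \<forall>x\<in>carrier M. f (r \<odot>\<^bsub>M\<^esub> x) = r \<odot>\<^bsub>N\<^esub> f x}"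

definition module_iso ::
    "('a, 'm) ring_scheme \<Rightarrow> ('a, 'b) module \<Rightarrow> ('a, 'c) module \<Rightarrow> ('b \<Rightarrow> 'c) set" where
  "module_iso R M N = {f \<in> module_hom R M N. bij_betw f (carrier M) (carrier N)}"

text \<open>The module of homomorphisms; its elements are extensional functions, so that equality in it is
  equality on \<open>carrier M\<close>. The fields \<open>mult\<close> and \<open>one\<close> of a module record carry no meaning.\<close>

definition hom_module ::
    "('a, 'm) ring_scheme \<Rightarrow> ('a, 'b) module \<Rightarrow> ('a, 'c) module \<Rightarrow> ('a, 'b \<Rightarrow> 'c) module" where
  "hom_module R M N = \<lparr>carrier = module_hom R M N \<inter> extensional (carrier M),
     monoid.mult = undefined, one = undefined,
     ring.zero = (\<lambda>x\<in>carrier M. \<zero>\<^bsub>N\<^esub>),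
     ring.add = (\<lambda>f g. \<lambda>x\<in>carrier M. f x \<oplus>\<^bsub>N\<^esub> g x),
     smult = (\<lambda>r f. \<lambda>x\<in>carrier M. r \<odot>\<^bsub>N\<^esub> f x)\<rparr>"

text \<open>\<open>\<pi> : M \<rightarrow> Q\<close> is a model of the natural surjection \<open>M \<rightarrow> M/L\<close>.\<close>

definition quotient_map :: "('a, 'm) ring_scheme \<Rightarrow> ('a, 'b) module \<Rightarrow> 'b set \<Rightarrow>
    ('a, 'c) module \<Rightarrow> ('b \<Rightarrow> 'c) \<Rightarrow> bool" where
  "quotient_map R M L Q \<pi> \<longleftrightarrow> module R Q \<and> \<pi> \<in> module_hom R M Q \<and> \<pi> ` carrier M = carrier Q \<and>
     {x \<in> carrier M. \<pi> x = \<zero>\<^bsub>Q\<^esub>} = L"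

definition module_span :: "('a, 'm) ring_scheme \<Rightarrow> ('a, 'b) module \<Rightarrow> 'b set \<Rightarrow> 'b set" where
  "module_span R M S = \<Inter>{N. submodule N R M \<and> S \<subseteq> N}"

definition fg_module :: "('a, 'm) ring_scheme \<Rightarrow> ('a, 'b) module \<Rightarrow> bool" where
  "fg_module R M \<longleftrightarrow> module R M \<and>
     (\<exists>S. finite S \<and> S \<subseteq> carrier M \<and> module_span R M S = carrier M)"

text \<open>The test modules range over the universe \<open>'a\<close>. Since \<open>R\<close> and its ideals are among them, Baer's
  criterion shows that enlarging the universe would not change the notion.\<close>

definition injective_module :: "('a, 'm) ring_scheme \<Rightarrow> ('a, 'a) module \<Rightarrow> bool" where
  "injective_module R Q \<longleftrightarrow> module R Q \<and>
     (\<forall>(A :: ('a, 'a) module) (B :: ('a, 'a) module) f g.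
        module R A \<and> module R B \<and> f \<in> module_hom R A B \<and> inj_on f (carrier A) \<and>
        g \<in> module_hom R A Q \<longrightarrow>
        (\<exists>h \<in> module_hom R B Q. \<forall>a\<in>carrier A. h (f a) = g a))"

definition injective_hull ::
    "('a, 'm) ring_scheme \<Rightarrow> ('a, 'a) module \<Rightarrow> ('a, 'a) module \<Rightarrow> bool" where
  "injective_hull R K E \<longleftrightarrow> module R K \<and> injective_module R E \<and>
     (\<exists>\<iota> \<in> module_hom R K E. inj_on \<iota> (carrier K) \<and>
        (\<forall>N. submodule N R E \<and> N \<noteq> {\<zero>\<^bsub>E\<^esub>} \<longrightarrow> N \<inter> \<iota> ` carrier K \<noteq> {\<zero>\<^bsub>E\<^esub>}))"

section \<open>Injective resolutions, Ext and local cohomology\<close>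

definition injective_resolution :: "('a, 'm) ring_scheme \<Rightarrow> ('a, 'a) module \<Rightarrow>
    (nat \<Rightarrow> ('a, 'a) module) \<Rightarrow> (nat \<Rightarrow> 'a \<Rightarrow> 'a) \<Rightarrow> ('a \<Rightarrow> 'a) \<Rightarrow> bool" where
  "injective_resolution R M I \<delta> \<epsilon> \<longleftrightarrow>
     (\<forall>n. injective_module R (I n)) \<and>
     (\<forall>n. \<delta> n \<in> module_hom R (I n) (I (Suc n))) \<and>
     \<epsilon> \<in> module_hom R M (I 0) \<and> inj_on \<epsilon> (carrier M) \<and>
     \<epsilon> ` carrier M = {x \<in> carrier (I 0). \<delta> 0 x = \<zero>\<^bsub>I (Suc 0)\<^esub>} \<and>
     (\<forall>n. \<delta> n ` carrier (I n) = {x \<in> carrier (I (Suc n)). \<delta> (Suc n) x = \<zero>\<^bsub>I (Suc (Suc n))\<^esub>})"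

text \<open>\<open>H\<close> is the \<open>n\<close>-th cohomology of the cochain complex \<open>C 0 \<rightarrow> C 1 \<rightarrow> \<dots>\<close> with differentials \<open>\<delta>\<close>.\<close>

definition is_cohomology :: "('a, 'm) ring_scheme \<Rightarrow> (nat \<Rightarrow> ('a, 'b) module) \<Rightarrow>
    (nat \<Rightarrow> 'b \<Rightarrow> 'b) \<Rightarrow> nat \<Rightarrow> ('a, 'c) module \<Rightarrow> bool" where
  "is_cohomology R C \<delta> n H \<longleftrightarrow>
     (\<exists>\<pi>. quotient_map R
            ((C n)\<lparr>carrier := {x \<in> carrier (C n). \<delta> n x = \<zero>\<^bsub>C (Suc n)\<^esub>}\<rparr>)
            (case n of 0 \<Rightarrow> {\<zero>\<^bsub>C 0\<^esub>} | Suc k \<Rightarrow> \<delta> k ` carrier (C k))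
            H \<pi>)"

text \<open>\<open>T\<close> is (a model of) \<open>Ext\<^sup>n(N, M)\<close>.\<close>

definition is_Ext :: "('a, 'm) ring_scheme \<Rightarrow> nat \<Rightarrow> ('a, 'a) module \<Rightarrow> ('a, 'a) module \<Rightarrow>
    ('a, 'a) module \<Rightarrow> bool" where
  "is_Ext R n N M T \<longleftrightarrow>
     (\<exists>I \<delta> \<epsilon>. injective_resolution R M I \<delta> \<epsilon> \<and>
        is_cohomology R (\<lambda>i. hom_module R N (I i)) (\<lambda>i f. compose (carrier N) (\<delta> i) f) n T)"

primrec ideal_pow :: "('a, 'm) ring_scheme \<Rightarrow> 'a set \<Rightarrow> nat \<Rightarrow> 'a set" where
  "ideal_pow R J 0 = carrier R"
| "ideal_pow R J (Suc n) = ideal_prod R J (ideal_pow R J n)"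

text \<open>The section functor \<open>\<Gamma>\<^sub>J\<close>; on homomorphisms it is restriction.\<close>

definition torsion_module ::
    "('a, 'm) ring_scheme \<Rightarrow> 'a set \<Rightarrow> ('a, 'b) module \<Rightarrow> ('a, 'b) module" where
  "torsion_module R J M =
     M\<lparr>carrier := {x \<in> carrier M. \<exists>n. \<forall>r\<in>ideal_pow R J n. r \<odot>\<^bsub>M\<^esub> x = \<zero>\<^bsub>M\<^esub>}\<rparr>"

text \<open>\<open>H\<close> is (a model of) the \<open>n\<close>-th right derived functor of \<open>\<Gamma>\<^sub>J\<close> at \<open>M\<close>.\<close>

definition is_local_cohomology :: "('a, 'm) ring_scheme \<Rightarrow> 'a set \<Rightarrow> nat \<Rightarrow> ('a, 'a) module \<Rightarrow>
    ('a, 'a) module \<Rightarrow> bool" where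
  "is_local_cohomology R J n M H \<longleftrightarrow>
     (\<exists>I \<delta> \<epsilon>. injective_resolution R M I \<delta> \<epsilon> \<and>
        is_cohomology R (\<lambda>i. torsion_module R J (I i)) \<delta> n H)"

section \<open>Complete local Cohen-Macaulay rings\<close>

definition krull_dim :: "('a, 'm) ring_scheme \<Rightarrow> enat" where
  "krull_dim R = (SUP n \<in> {n. \<exists>P :: nat \<Rightarrow> 'a set. (\<forall>i\<le>n. primeideal (P i) R) \<and>
     (\<forall>i<n. P i \<subset> P (Suc i))}. enat n)"

definition noetherian_local_ring :: "('a, 'm) ring_scheme \<Rightarrow> 'a set \<Rightarrow> bool" where
  "noetherian_local_ring R \<mm> \<longleftrightarrow>
     cring R \<and> noetherian_ring R \<and> {I. maximalideal I R} = {\<mm>}"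

text \<open>The canonical map from \<open>R\<close> to the inverse limit of the \<open>R/\<mm>\<^sup>n\<close> is injective and surjective.\<close>

definition adically_complete :: "('a, 'm) ring_scheme \<Rightarrow> 'a set \<Rightarrow> bool" where
  "adically_complete R \<mm> \<longleftrightarrow>
     (\<Inter>n. ideal_pow R \<mm> n) = {\<zero>\<^bsub>R\<^esub>} \<and>
     (\<forall>s :: nat \<Rightarrow> 'a. (\<forall>n. s n \<in> carrier R) \<and> (\<forall>n. s (Suc n) \<ominus>\<^bsub>R\<^esub> s n \<in> ideal_pow R \<mm> n) \<longrightarrow>
        (\<exists>l\<in>carrier R. \<forall>n. l \<ominus>\<^bsub>R\<^esub> s n \<in> ideal_pow R \<mm> n))"

definition span_mult :: "('a, 'm) ring_scheme \<Rightarrow> ('a, 'b) module \<Rightarrow> 'a set \<Rightarrow> 'b set" where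
  "span_mult R M S = module_span R M {r \<odot>\<^bsub>M\<^esub> y | r y. r \<in> S \<and> y \<in> carrier M}"

text \<open>Each \<open>x\<^sub>i\<close> is a nonzerodivisor on \<open>M/(x\<^sub>0, \<dots>, x\<^sub>i\<^sub>-\<^sub>1)M\<close>, and \<open>M \<noteq> (x\<^sub>0, \<dots>)M\<close>.\<close>

definition regular_sequence ::
    "('a, 'm) ring_scheme \<Rightarrow> ('a, 'b) module \<Rightarrow> 'a list \<Rightarrow> bool" where
  "regular_sequence R M xs \<longleftrightarrow> set xs \<subseteq> carrier R \<and>
     (\<forall>i<length xs. \<forall>y\<in>carrier M.
        (xs ! i) \<odot>\<^bsub>M\<^esub> y \<in> span_mult R M (set (take i xs)) \<longrightarrow>
        y \<in> span_mult R M (set (take i xs))) \<and>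
     span_mult R M (set xs) \<noteq> carrier M"

definition depth :: "('a, 'm) ring_scheme \<Rightarrow> 'a set \<Rightarrow> ('a, 'b) module \<Rightarrow> enat" where
  "depth R \<mm> M = (SUP xs \<in> {xs. set xs \<subseteq> \<mm> \<and> regular_sequence R M xs}. enat (length xs))"

definition cohen_macaulay :: "('a, 'm) ring_scheme \<Rightarrow> 'a set \<Rightarrow> bool" where
  "cohen_macaulay R \<mm> \<longleftrightarrow> depth R \<mm> (self_module R) = krull_dim R"

definition ring_radical :: "('a, 'm) ring_scheme \<Rightarrow> 'a set \<Rightarrow> 'a set" where
  "ring_radical R I = {x \<in> carrier R. \<exists>n::nat. x [^]\<^bsub>R\<^esub> n \<in> I}"

text \<open>A sequence of \<open>dim R\<close> elements of \<open>\<mm>\<close> that generates an \<open>\<mm>\<close>-primary ideal.\<close>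

definition system_of_parameters :: "('a, 'm) ring_scheme \<Rightarrow> 'a set \<Rightarrow> 'a list \<Rightarrow> bool" where
  "system_of_parameters R \<mm> xs \<longleftrightarrow> enat (length xs) = krull_dim R \<and> set xs \<subseteq> \<mm> \<and>
     ring_radical R (Idl\<^bsub>R\<^esub> (set xs)) = \<mm>"

text \<open>A maximal Cohen-Macaulay module of type 1 and of finite injective dimension. The type of a
  module \<open>\<omega>\<close> of depth \<open>d\<close> is the dimension of \<open>Ext\<^sup>d(k, \<omega>)\<close> over the residue field \<open>k\<close>, so type 1 says
  that this module is isomorphic to \<open>k\<close>.\<close>

definition canonical_module :: "('a, 'm) ring_scheme \<Rightarrow> 'a set \<Rightarrow> ('a, 'a) module \<Rightarrow> bool" where
  "canonical_module R \<mm> \<omega> \<longleftrightarrow>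
     fg_module R \<omega> \<and> carrier \<omega> \<noteq> {\<zero>\<^bsub>\<omega>\<^esub>} \<and> depth R \<mm> \<omega> = krull_dim R \<and>
     (\<exists>d K \<rho>. krull_dim R = enat d \<and> quotient_map R (self_module R) \<mm> K \<rho> \<and> is_Ext R d K \<omega> K) \<and>
     (\<exists>I \<delta> \<epsilon> b. injective_resolution R \<omega> I \<delta> \<epsilon> \<and> (\<forall>n>b. carrier (I n) = {\<zero>\<^bsub>I n\<^esub>}))"

section \<open>Closure operations\<close>

text \<open>\<open>cl M N\<close> is the closure of \<open>N\<close> in \<open>M\<close>; it is relevant only for submodules \<open>N\<close> of modules \<open>M\<close>.\<close>

type_synonym 'a closure_op = "('a, 'a) module \<Rightarrow> 'a set \<Rightarrow> 'a set"

definition closure_operation :: "('a, 'm) ring_scheme \<Rightarrow> 'a closure_op \<Rightarrow> bool" where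
  "closure_operation R cl \<longleftrightarrow>
     (\<forall>M N. module R M \<and> submodule N R M \<longrightarrow>
        submodule (cl M N) R M \<and> N \<subseteq> cl M N \<and> cl M (cl M N) = cl M N) \<and>
     (\<forall>M N N'. module R M \<and> submodule N R M \<and> submodule N' R M \<and> N \<subseteq> N' \<longrightarrow>
        cl M N \<subseteq> cl M N')"

definition functorial :: "('a, 'm) ring_scheme \<Rightarrow> 'a closure_op \<Rightarrow> bool" where
  "functorial R cl \<longleftrightarrow>
     (\<forall>M N f L. module R M \<and> module R N \<and> f \<in> module_hom R M N \<and> submodule L R M \<longrightarrow>
        f ` cl M L \<subseteq> cl N (f ` L))"

text \<open>Stated for every model \<open>Q\<close> of \<open>M/L\<close> in the universe; the submodule \<open>N/L\<close> is the image of \<open>N\<close>.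
  For functorial closure operations the condition does not depend on the model.\<close>

definition residual :: "('a, 'm) ring_scheme \<Rightarrow> 'a closure_op \<Rightarrow> bool" where
  "residual R cl \<longleftrightarrow>
     (\<forall>M L N Q \<pi>. module R M \<and> submodule L R M \<and> submodule N R M \<and> L \<subseteq> N \<and>
        quotient_map R M L Q \<pi> \<longrightarrow>
        cl M N = {x \<in> carrier M. \<pi> x \<in> cl Q (\<pi> ` N)})"

definition finitistic :: "('a, 'm) ring_scheme \<Rightarrow> 'a closure_op \<Rightarrow> 'a closure_op" where
  "finitistic R cl M L = \<Union>{cl (M\<lparr>carrier := N\<rparr>) L | N. submodule N R M \<and> L \<subseteq> N \<and>
     (\<exists>(Q :: ('a, 'a) module) \<pi>. quotient_map R (M\<lparr>carrier := N\<rparr>) L Q \<pi> \<and> fg_module R Q)}"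

definition cl_closed_ideal :: "('a, 'm) ring_scheme \<Rightarrow> 'a closure_op \<Rightarrow> 'a set \<Rightarrow> bool" where
  "cl_closed_ideal R cl I \<longleftrightarrow> ideal I R \<and> cl (self_module R) I = I"

text \<open>Here and below \<open>H\<close> stands for the top local cohomology module of \<open>R\<close>.\<close>

definition injective_finiteness ::
    "('a, 'm) ring_scheme \<Rightarrow> 'a closure_op \<Rightarrow> ('a, 'a) module \<Rightarrow> bool" where
  "injective_finiteness R cl H \<longleftrightarrow> cl H {\<zero>\<^bsub>H\<^esub>} = finitistic R cl H {\<zero>\<^bsub>H\<^esub>}"

definition hom_annihilator :: "('a, 'm) ring_scheme \<Rightarrow> ('a, 'b) module \<Rightarrow> ('a, 'c) module \<Rightarrow>
    'b set \<Rightarrow> ('b \<Rightarrow> 'c) set" where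
  "hom_annihilator R H E N = {f \<in> carrier (hom_module R H E). \<forall>x\<in>N. f x = \<zero>\<^bsub>E\<^esub>}"

text \<open>\<open>\<theta>\<close> is the identification of \<open>\<omega>\<close> with \<open>Hom(H, E)\<close>.\<close>

definition tau_omega :: "('a, 'm) ring_scheme \<Rightarrow> 'a closure_op \<Rightarrow> ('a, 'a) module \<Rightarrow>
    ('a, 'a) module \<Rightarrow> ('a, 'a) module \<Rightarrow> ('a \<Rightarrow> 'a \<Rightarrow> 'a) \<Rightarrow> 'a set" where
  "tau_omega R cl H E \<omega> \<theta> =
     {w \<in> carrier \<omega>. \<theta> w \<in> hom_annihilator R H E (cl H {\<zero>\<^bsub>H\<^esub>})}"

definition cl_rational :: "('a, 'm) ring_scheme \<Rightarrow> 'a closure_op \<Rightarrow> ('a, 'a) module \<Rightarrow>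
    ('a, 'a) module \<Rightarrow> ('a, 'a) module \<Rightarrow> ('a \<Rightarrow> 'a \<Rightarrow> 'a) \<Rightarrow> bool" where
  "cl_rational R cl H E \<omega> \<theta> \<longleftrightarrow> tau_omega R cl H E \<omega> \<theta> = carrier \<omega>"

end

theory Submission
  imports Defs
begin

text \<open>
  Let \<open>I\<close> be an injective resolution of \<open>R\<close>. If \<open>x\<close> is a nonzerodivisor modulo \<open>J\<close>, then multiplication
  by \<open>x\<close> is surjective on \<open>Hom(R/J, I)\<close> with kernel \<open>Hom(R/(J, x), I)\<close>. Hence \<open>Ext\<^sup>i(R/J, R)\<close> is \<open>R/J\<close>
  for \<open>i = n\<close> and \<open>0\<close> otherwise whenever \<open>J\<close> is generated by a regular sequence of length \<open>n\<close>. As \<open>R\<close> is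
  Cohen-Macaulay, every ideal \<open>J\<close> generated by a system of parameters is of this kind with \<open>n = d\<close>:
  the vanishing of \<open>Ext\<^sup>i(R/\<mm>, R)\<close> for \<open>i < d\<close> keeps \<open>\<mm>\<close> from annihilating a nonzero element modulo a
  shorter regular sequence in \<open>J\<close>, and prime avoidance extends that sequence inside \<open>J\<close>.

  Consequently the classes of cocycles killed by \<open>J\<close> form a copy of \<open>R/J\<close> in \<open>H = H\<^sup>d\<^sub>\<mm>(R)\<close>, and each
  finitely generated submodule of \<open>H\<close> lies in such a copy. Since \<open>cl\<close> is residual, \<open>J\<close> is \<open>cl\<close>-closed iff
  \<open>0\<close> is closed in the copy of \<open>R/J\<close>; since \<open>E\<close> is a cogenerator, \<open>R\<close> is \<open>cl\<close>-rational iff \<open>0\<close> is closed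
  in \<open>H\<close>. Functoriality of the inclusions compares the two conditions.
\<close>

section \<open>Commutative Noetherian rings\<close>

text \<open>Quotients exist in the universe only after a choice of representatives. A homomorphism
  from \<open>R/J\<close> to an injective \<open>I n\<close> is therefore recorded as the image of
  1, an element of \<open>I n\<close> killed by \<open>J\<close>, and every long exact sequence
  becomes an argument with elements. The sequences that occur come from 0 -> R/(K : a) -> R/K ->
  R/(K, a) -> 0, where an ideal grows by one element. The obstacle is the comparison of
  \<open>R/J\<close> with \<open>H\<close>. The torsion complex is the union of the complexes for
  the powers of the maximal ideal, so a cocycle killed by \<open>J\<close> might bound a cochain
  killed only by a high power. That it then bounds a cochain killed by \<open>J\<close> itself is
  not formal: it rests on an ideal \<open>K\<close>, inside both \<open>J\<close> and that power,
  whose cohomology vanishes below degree \<open>d\<close>. Powers of the elements of a system of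
  parameters generate such ideals, and the same ideals capture the finitely generated submodules of
  \<open>H\<close> in the converse.\<close>

definition colon :: "('a, 'm) ring_scheme \<Rightarrow> 'a set \<Rightarrow> 'a \<Rightarrow> 'a set" where
  "colon R J a = {r \<in> carrier R. r \<otimes>\<^bsub>R\<^esub> a \<in> J}"

locale noetherian_cring = cring R + noetherian_ring R for R (structure)

section \<open>Arithmetic of ideals and their powers\<close>

context cring
begin

lemma ideal_memberI:
  assumes "I \<subseteq> carrier R" and "\<zero> \<in> I"
    and "\<And>a b. a \<in> I \<Longrightarrow> b \<in> I \<Longrightarrow> a \<oplus> b \<in> I"
    and "\<And>r a. r \<in> carrier R \<Longrightarrow> a \<in> I \<Longrightarrow> r \<otimes> a \<in> I"
  shows "ideal I R"
proof (rule idealI)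
  show "ring R" by (rule ring_axioms)
  show "subgroup I (add_monoid R)"
  proof (rule add.subgroupI)
    fix a assume a: "a \<in> I"
    have "\<ominus> a = (\<ominus> \<one>) \<otimes> a"
      using a assms(1) by (auto simp: l_minus)
    then show "\<ominus> a \<in> I"
      using a assms(4) by simp
  qed (use assms in auto)
  show "x \<otimes> a \<in> I" "a \<otimes> x \<in> I" if "a \<in> I" "x \<in> carrier R" for a x
    using that assms(1,4) m_comm[of a x] by auto
qed

lemma ideal_add_closed: "ideal J R \<Longrightarrow> a \<in> J \<Longrightarrow> b \<in> J \<Longrightarrow> a \<oplus> b \<in> J"
  by (simp add: additive_subgroup.a_closed ideal.axioms(1))

lemma ideal_minus_closed: "ideal J R \<Longrightarrow> a \<in> J \<Longrightarrow> b \<in> J \<Longrightarrow> a \<ominus> b \<in> J"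
  by (simp add: a_minus_def additive_subgroup.a_closed additive_subgroup.a_inv_closed ideal.axioms(1))

lemma ideal_zero_mem: "ideal J R \<Longrightarrow> \<zero> \<in> J"
  by (simp add: additive_subgroup.zero_closed ideal.axioms(1))

lemma ideal_subset: "ideal J R \<Longrightarrow> J \<subseteq> carrier R"
  using ideal.Icarr by fast

lemma ideal_add_cancel:
  assumes "ideal J R" "a \<in> carrier R" "b \<in> J" "a \<oplus> b \<in> J"
  shows "a \<in> J"
proof -
  have b: "b \<in> carrier R" using assms ideal.Icarr by fast
  have "(a \<oplus> b) \<ominus> b \<in> J"
    using assms ideal_minus_closed by blast
  moreover have "(a \<oplus> b) \<ominus> b = a"
    using assms(2) b by (simp add: a_assoc minus_eq r_neg)
  ultimately show ?thesis by simp
qed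

lemma colon_ideal:
  assumes "ideal J R" and "a \<in> carrier R"
  shows "ideal (colon R J a) R"
proof (rule ideal_memberI)
  show "\<zero> \<in> colon R J a"
    using assms ideal_zero_mem by (simp add: colon_def)
  show "r \<oplus> s \<in> colon R J a" if "r \<in> colon R J a" "s \<in> colon R J a" for r s
    using that assms by (auto simp: colon_def l_distr ideal_add_closed)
  show "r \<otimes> s \<in> colon R J a" if "r \<in> carrier R" "s \<in> colon R J a" for r s
    using that assms by (auto simp: colon_def m_assoc ideal.I_l_closed)
qed (auto simp: colon_def)

lemma subset_colon: "ideal J R \<Longrightarrow> a \<in> carrier R \<Longrightarrow> J \<subseteq> colon R J a"
  using ideal.Icarr ideal.I_r_closed by (fastforce simp: colon_def)

lemma insert_subset_carrier: "ideal J R \<Longrightarrow> a \<in> carrier R \<Longrightarrow> insert a J \<subseteq> carrier R"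
  using ideal_subset by blast

lemma Idl_insert_ideal: "ideal J R \<Longrightarrow> a \<in> carrier R \<Longrightarrow> ideal (Idl (insert a J)) R"
  by (intro genideal_ideal insert_subset_carrier)

lemma Idl_insert_upper:
  assumes "ideal J R" and "a \<in> carrier R"
  shows "J \<subseteq> Idl (insert a J)" and "a \<in> Idl (insert a J)"
  using genideal_self[OF insert_subset_carrier[OF assms]] by auto

lemma mem_Idl_insertE:
  assumes J: "ideal J R" and a: "a \<in> carrier R" and x: "x \<in> Idl (insert a J)"
  obtains r j where "r \<in> carrier R" "j \<in> J" "x = r \<otimes> a \<oplus> j"
proof -
  let ?K = "{r \<otimes> a \<oplus> j | r j. r \<in> carrier R \<and> j \<in> J}"
  note Jc = ideal.Icarr[OF J]
  have "ideal ?K R"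
  proof (rule ideal_memberI)
    show "?K \<subseteq> carrier R"
      using a Jc by auto
    have "\<zero> = \<zero> \<otimes> a \<oplus> \<zero>" using a by simp
    then show "\<zero> \<in> ?K" using ideal_zero_mem[OF J] by blast
  next
    fix u v assume "u \<in> ?K" "v \<in> ?K"
    then obtain r i s j where "r \<in> carrier R" "i \<in> J" "u = r \<otimes> a \<oplus> i"
      "s \<in> carrier R" "j \<in> J" "v = s \<otimes> a \<oplus> j"
      by blast
    moreover from this have "u \<oplus> v = (r \<oplus> s) \<otimes> a \<oplus> (i \<oplus> j)"
      using a Jc by (simp add: l_distr a_ac)
    ultimately show "u \<oplus> v \<in> ?K"
      using ideal_add_closed[OF J] by blast
  next
    fix s u assume s: "s \<in> carrier R" and "u \<in> ?K"
    then obtain r i where "r \<in> carrier R" "i \<in> J" "u = r \<otimes> a \<oplus> i"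
      by blast
    moreover from this have "s \<otimes> u = (s \<otimes> r) \<otimes> a \<oplus> s \<otimes> i"
      using a s Jc by (simp add: r_distr m_assoc)
    ultimately show "s \<otimes> u \<in> ?K"
      using s ideal.I_l_closed[OF J] by blast
  qed
  moreover have "insert a J \<subseteq> ?K"
  proof -
    have "a = \<one> \<otimes> a \<oplus> \<zero>" using a by simp
    then have "a \<in> ?K" using ideal_zero_mem[OF J] by blast
    moreover have "j = \<zero> \<otimes> a \<oplus> j" if "j \<in> J" for j
      using a that Jc by simp
    then have "J \<subseteq> ?K" by blast
    ultimately show ?thesis by blast
  qed
  ultimately have "Idl (insert a J) \<subseteq> ?K"
    by (rule genideal_minimal)
  then show ?thesis using x that by blast
qed

text \<open>The computation shared by the two proofs below that an ideal maximal for a suitable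
  property is prime: there the factors come from enlarging \<open>M\<close> by \<open>a\<close> and
  by \<open>b\<close>.\<close>

lemma ideal_mult_mod_closed:
  assumes M: "ideal M R" and c: "r \<in> carrier R" "s \<in> carrier R" "a \<in> carrier R" "b \<in> carrier R"
    and mem: "a \<otimes> b \<in> M" "i \<in> M" "j \<in> M"
  shows "(r \<otimes> a \<oplus> i) \<otimes> (s \<otimes> b \<oplus> j) \<in> M"
proof -
  have ij: "i \<in> carrier R" "j \<in> carrier R"
    using mem ideal.Icarr[OF M] by auto
  have "(r \<otimes> a \<oplus> i) \<otimes> (s \<otimes> b \<oplus> j) =
      (r \<otimes> s) \<otimes> (a \<otimes> b) \<oplus> ((r \<otimes> a) \<otimes> j \<oplus> (s \<otimes> b \<oplus> j) \<otimes> i)"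
    using c ij by algebra
  moreover have "(r \<otimes> s) \<otimes> (a \<otimes> b) \<in> M" "(r \<otimes> a) \<otimes> j \<in> M" "(s \<otimes> b \<oplus> j) \<otimes> i \<in> M"
    using c ij mem by (simp_all add: ideal.I_l_closed[OF M])
  ultimately show ?thesis
    using ideal_add_closed[OF M] by simp
qed

lemma ideal_pow_ideal: "ideal J R \<Longrightarrow> ideal (ideal_pow R J n) R"
  by (induction n) (auto simp: oneideal ideal_prod_is_ideal)

lemma ideal_pow_add:
  "ideal J R \<Longrightarrow> ideal_pow R J (m + n) = ideal_prod R (ideal_pow R J m) (ideal_pow R J n)"
proof (induction m)
  case 0
  then show ?case
    using ideal_prod_one[of "ideal_pow R J n"] ideal_prod_commute[OF oneideal, of "ideal_pow R J n"]
    by (simp add: ideal_pow_ideal)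
next
  case (Suc m)
  then show ?case
    by (simp add: ideal_pow_ideal ideal_prod_assoc)
qed

lemma ideal_prod_subset:
  assumes "ideal K R" and "\<And>a b. a \<in> I \<Longrightarrow> b \<in> J \<Longrightarrow> a \<otimes> b \<in> K"
  shows "ideal_prod R I J \<subseteq> K"
proof
  fix x assume "x \<in> ideal_prod R I J"
  then show "x \<in> K"
    by induction (use assms ideal_add_closed in auto)
qed

lemma nat_pow_mem_ideal_pow: "x \<in> J \<Longrightarrow> x \<in> carrier R \<Longrightarrow> x [^] n \<in> ideal_pow R J n"
proof (induction n)
  case (Suc n)
  then have "x \<otimes> x [^] n \<in> ideal_prod R J (ideal_pow R J n)"
    by (intro ideal_prod.prod) auto
  then show ?case
    using Suc.prems by (simp add: m_comm)
qed auto

lemma ideal_pow_antimono: "ideal J R \<Longrightarrow> m \<le> n \<Longrightarrow> ideal_pow R J n \<subseteq> ideal_pow R J m"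
proof -
  assume J: "ideal J R" and mn: "m \<le> n"
  then obtain k where n: "n = m + k"
    using le_Suc_ex by blast
  have "ideal_prod R (ideal_pow R J m) (ideal_pow R J k) \<subseteq> ideal_pow R J m"
    using ideal.I_r_closed[OF ideal_pow_ideal[OF J]] ideal.Icarr[OF ideal_pow_ideal[OF J]]
    by (intro ideal_prod_subset[OF ideal_pow_ideal[OF J]]) blast
  then show ?thesis
    by (simp add: n ideal_pow_add J)
qed

lemma prime_pow_mem:
  assumes "primeideal P R" "x \<in> carrier R" "x [^] (n::nat) \<in> P"
  shows "x \<in> P"
  using assms(3)
proof (induction n)
  case 0
  then have "\<one> \<in> P" by simp
  then show ?case
    using assms(1) ideal.one_imp_carrier[of P R] primeideal.I_notcarr[OF assms(1)]
    by (simp add: primeideal_def)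
next
  case (Suc n)
  then show ?case
    using primeideal.I_prime[OF assms(1), of "x [^] n" x] assms(2) by auto
qed

text \<open>Pick an element outside \<open>P\<close> in \<open>K\<close> and in each member of
  \<open>F\<close>. The product of these lies in all of the ideals and avoids \<open>P\<close> by
  primeness.\<close>

lemma finite_primes_not_subset:
  assumes P: "primeideal P R" and K: "ideal K R" "\<not> K \<subseteq> P"
    and "finite F" "\<And>Q. Q \<in> F \<Longrightarrow> ideal Q R \<and> \<not> Q \<subseteq> P"
  shows "\<exists>b\<in>K. b \<notin> P \<and> (\<forall>Q\<in>F. b \<in> Q)"
  using assms(4,5)
proof (induction F)
  case empty
  then show ?case using K by blast
next
  case (insert Q F)
  then obtain b where b: "b \<in> K" "b \<notin> P" "\<forall>Q\<in>F. b \<in> Q" by auto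
  obtain q where q: "q \<in> Q" "q \<notin> P" using insert.prems by blast
  have c: "b \<in> carrier R" "q \<in> carrier R"
    using b q K(1) insert.prems ideal.Icarr by (metis insertI1)+
  have "b \<otimes> q \<notin> P"
    using primeideal.I_prime[OF P c] b q by blast
  moreover have "b \<otimes> q \<in> K" "b \<otimes> q \<in> Q"
    using b q c K(1) insert.prems ideal.I_r_closed ideal.I_l_closed by (metis insertI1)+
  moreover have "\<forall>Q\<in>F. b \<otimes> q \<in> Q"
    using b c insert.prems ideal.I_r_closed by (metis insertI2)
  ultimately show ?case by blast
qed

end

section \<open>Noetherian induction and the existence of primes\<close>

context noetherian_cring
begin

text \<open>Zorn's lemma applies to an arbitrary property of ideals, because over a Noetherian ring
  the union of a nonempty chain of ideals is one of its members.\<close>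

lemma exists_maximal_ideal_with:
  assumes "P I" and "\<And>I. P I \<Longrightarrow> ideal I R"
  shows "\<exists>M. P M \<and> (\<forall>K. P K \<longrightarrow> M \<subseteq> K \<longrightarrow> K = M)"
proof -
  have "\<exists>M\<in>Collect P. \<forall>K\<in>Collect P. M \<subseteq> K \<longrightarrow> K = M"
  proof (rule subset_Zorn)
    fix C assume C: "subset.chain (Collect P) C"
    show "\<exists>U\<in>Collect P. \<forall>X\<in>C. X \<subseteq> U"
    proof (cases "C = {}")
      case True
      then show ?thesis using assms(1) by auto
    next
      case False
      have "subset.chain {I. ideal I R} C"
        using C assms(2) by (auto simp: pred_on.chain_def)
      then have "\<Union>C \<in> C"
        using ideal_chain_is_trivial False by blast
      then show ?thesis
        using C by (auto simp: pred_on.chain_def)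
    qed
  qed
  then show ?thesis by simp
qed

text \<open>Takes the place of a choice of generators of \<open>L\<close> over \<open>J\<close>: an
  ideal maximal among those between \<open>J\<close> and \<open>L\<close> that satisfy
  \<open>Q\<close> absorbs every element of \<open>L\<close>.\<close>

lemma ideal_between_induct [consumes 3, case_names base step]:
  assumes J: "ideal J R" and L: "ideal L R" "J \<subseteq> L"
    and base: "Q J"
    and step: "\<And>K a. ideal K R \<Longrightarrow> J \<subseteq> K \<Longrightarrow> K \<subseteq> L \<Longrightarrow> Q K \<Longrightarrow> a \<in> L \<Longrightarrow> Q (Idl (insert a K))"
  shows "Q L"
proof -
  let ?P = "\<lambda>K. ideal K R \<and> J \<subseteq> K \<and> K \<subseteq> L \<and> Q K"
  have "?P J" using J L base by simp
  then obtain M where M: "?P M" and max: "\<forall>K. ?P K \<longrightarrow> M \<subseteq> K \<longrightarrow> K = M"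
    using exists_maximal_ideal_with[of ?P J] by iprover
  have "a \<in> M" if a: "a \<in> L" for a
  proof -
    have ac: "a \<in> carrier R" using a L ideal.Icarr by fast
    have "?P (Idl (insert a M))"
      using M(1) a step[of M a] Idl_insert_ideal[of M a] Idl_insert_upper[of M a] ac
        genideal_minimal[OF L(1), of "insert a M"] by auto
    then have "Idl (insert a M) = M"
      using max Idl_insert_upper[of M a] M ac by simp
    then show ?thesis
      using M Idl_insert_upper[of M a] ac by blast
  qed
  then have "M = L" using M(1) by blast
  then show ?thesis using M(1) by simp
qed

text \<open>An ideal maximal among those that contain \<open>I\<close> and miss \<open>S\<close> is
  prime: enlarging it by \<open>a\<close> and by \<open>b\<close> outside it meets \<open>S\<close>
  both times, and if \<open>a \<otimes> b\<close> were in the ideal, the product of the two common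
  elements would lie in the ideal and in \<open>S\<close>.\<close>

lemma exists_prime_disjoint:
  assumes I: "ideal I R" and S: "S \<subseteq> carrier R" "\<one> \<in> S" "\<And>s t. s \<in> S \<Longrightarrow> t \<in> S \<Longrightarrow> s \<otimes> t \<in> S"
    and disj: "I \<inter> S = {}"
  shows "\<exists>Q. primeideal Q R \<and> I \<subseteq> Q \<and> Q \<inter> S = {}"
proof -
  let ?P = "\<lambda>K. ideal K R \<and> I \<subseteq> K \<and> K \<inter> S = {}"
  have "?P I" using I disj by simp
  then obtain M where M: "?P M" and max: "\<forall>K. ?P K \<longrightarrow> M \<subseteq> K \<longrightarrow> K = M"
    using exists_maximal_ideal_with[of ?P I] by iprover
  have Mi: "ideal M R" using M by simp
  have meet: "\<exists>s\<in>S. \<exists>r\<in>carrier R. \<exists>j\<in>M. s = r \<otimes> a \<oplus> j" if a: "a \<in> carrier R" "a \<notin> M" for a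
  proof (rule ccontr)
    assume no: "\<not> ?thesis"
    have "Idl (insert a M) \<inter> S = {}"
    proof (rule ccontr)
      assume "Idl (insert a M) \<inter> S \<noteq> {}"
      then obtain s where "s \<in> S" "s \<in> Idl (insert a M)" by blast
      then show False
        using mem_Idl_insertE[OF Mi a(1), of s] no by metis
    qed
    then have "?P (Idl (insert a M))"
      using M(1) Idl_insert_ideal[OF Mi a(1)] Idl_insert_upper[OF Mi a(1)] by blast
    then show False
      using max Idl_insert_upper[OF Mi a(1)] a(2) by blast
  qed
  have "primeideal M R"
  proof (rule primeidealI)
    show "carrier R \<noteq> M" using M(1) S by blast
    fix a b assume ab: "a \<in> carrier R" "b \<in> carrier R" "a \<otimes> b \<in> M"
    show "a \<in> M \<or> b \<in> M"
    proof (rule ccontr)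
      assume "\<not> ?thesis"
      then obtain r i s j where rs: "r \<in> carrier R" "i \<in> M" "r \<otimes> a \<oplus> i \<in> S"
        "s \<in> carrier R" "j \<in> M" "s \<otimes> b \<oplus> j \<in> S"
        using meet[of a] meet[of b] ab by metis
      have "(r \<otimes> a \<oplus> i) \<otimes> (s \<otimes> b \<oplus> j) \<in> M"
        using Mi rs ab by (intro ideal_mult_mod_closed)
      then show False
        using S(3)[OF rs(3,6)] M(1) by blast
    qed
  qed (use Mi is_cring in auto)
  then show ?thesis using M(1) by blast
qed

lemma exists_maximal_ideal_above:
  assumes "ideal I R" "I \<noteq> carrier R"
  shows "\<exists>M. maximalideal M R \<and> I \<subseteq> M"
proof -
  let ?P = "\<lambda>K. ideal K R \<and> I \<subseteq> K \<and> K \<noteq> carrier R"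
  have "?P I" using assms by simp
  then obtain M where M: "?P M" and max: "\<forall>K. ?P K \<longrightarrow> M \<subseteq> K \<longrightarrow> K = M"
    using exists_maximal_ideal_with[of ?P I] by iprover
  have "maximalideal M R"
  proof (rule maximalidealI)
    fix J assume "ideal J R" "M \<subseteq> J"
    then show "J = M \<or> J = carrier R" using M max by blast
  qed (use M in auto)
  then show ?thesis using M by blast
qed

text \<open>Powers of \<open>x\<close> times elements outside \<open>P\<close> form a multiplicative
  set. It misses \<open>I\<close>, because powers of \<open>x\<close> cancel modulo \<open>I\<close>
  and \<open>I\<close> lies in \<open>P\<close>. A prime missing this set lies in \<open>P\<close>
  (take exponent 0) and omits \<open>x\<close> (take exponent 1 and cofactor 1).\<close>

lemma exists_smaller_prime:
  assumes P: "primeideal P R" and I: "ideal I R" "I \<subseteq> P"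
    and x: "x \<in> P" and nzd: "\<And>y. y \<in> carrier R \<Longrightarrow> x \<otimes> y \<in> I \<Longrightarrow> y \<in> I"
  shows "\<exists>Q. primeideal Q R \<and> I \<subseteq> Q \<and> Q \<subset> P"
proof -
  have Pi: "ideal P R" using P by (simp add: primeideal_def)
  have xc: "x \<in> carrier R" using x Pi ideal.Icarr by fast
  have oneP: "\<one> \<notin> P"
    using ideal.one_imp_carrier[OF Pi] primeideal.I_notcarr[OF P] by auto
  let ?S = "{x [^] n \<otimes> s | (n::nat) s. s \<in> carrier R \<and> s \<notin> P}"
  have cancel: "y \<in> I" if "y \<in> carrier R" "x [^] (n::nat) \<otimes> y \<in> I" for n y
    using that
  proof (induction n arbitrary: y)
    case (Suc n)
    have "x [^] Suc n \<otimes> y = x \<otimes> (x [^] n \<otimes> y)"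
      using Suc.prems(1) xc by (metis m_assoc nat_pow_Suc2 nat_pow_closed)
    then have "x [^] n \<otimes> y \<in> I"
      using Suc.prems nzd[of "x [^] n \<otimes> y"] xc by simp
    then show ?case using Suc by blast
  qed simp
  have "\<exists>Q. primeideal Q R \<and> I \<subseteq> Q \<and> Q \<inter> ?S = {}"
  proof (rule exists_prime_disjoint)
    show "?S \<subseteq> carrier R" using xc by auto
    have "\<one> = x [^] (0::nat) \<otimes> \<one>" by simp
    then show "\<one> \<in> ?S" using oneP by blast
    show "u \<otimes> v \<in> ?S" if uv: "u \<in> ?S" "v \<in> ?S" for u v
    proof -
      obtain n s where us: "u = x [^] (n::nat) \<otimes> s" "s \<in> carrier R" "s \<notin> P"
        using uv(1) by auto
      moreover obtain m t where vt: "v = x [^] (m::nat) \<otimes> t" "t \<in> carrier R" "t \<notin> P"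
        using uv(2) by auto
      ultimately have "u \<otimes> v = x [^] (n + m) \<otimes> (s \<otimes> t)"
        using xc by (simp add: nat_pow_mult[symmetric] m_ac)
      moreover have "s \<otimes> t \<notin> P"
        using us vt primeideal.I_prime[OF P] by blast
      moreover have "s \<otimes> t \<in> carrier R" using us vt by simp
      ultimately show ?thesis by (simp only: mem_Collect_eq) metis
    qed
    show "I \<inter> ?S = {}" using cancel I(2) by blast
  qed (fact I)
  then obtain Q where Q: "primeideal Q R" "I \<subseteq> Q" "Q \<inter> ?S = {}" by blast
  have "Q \<subseteq> P"
  proof
    fix q assume q: "q \<in> Q"
    then have qc: "q \<in> carrier R" using Q ideal.Icarr by (fastforce simp: primeideal_def)
    then have "q = x [^] (0::nat) \<otimes> q" by simp
    then show "q \<in> P" using Q(3) q qc by blast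
  qed
  moreover have "x \<notin> Q"
  proof
    assume "x \<in> Q"
    moreover have "x = x [^] (1::nat) \<otimes> \<one>" using xc by simp
    ultimately show False using Q(3) oneP by blast
  qed
  ultimately show ?thesis using Q x by blast
qed

text \<open>Let \<open>M\<close> be maximal among the ideals above \<open>J\<close> that contain no
  power of \<open>K\<close>. If powers \<open>m\<close> and \<open>n\<close> of \<open>K\<close>
  fall into the enlargements of \<open>M\<close> by \<open>a\<close> and by \<open>b\<close>, and
  \<open>a \<otimes> b\<close> is in \<open>M\<close>, then power \<open>m + n\<close> falls into
  \<open>M\<close>. So \<open>M\<close> is prime, hence contains the radical of \<open>J\<close>,
  hence \<open>K\<close> itself, which is its first power.\<close>

lemma ideal_pow_subset_of_radical:
  assumes K: "ideal K R" and J: "ideal J R" and rad: "K \<subseteq> ring_radical R J"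
  shows "\<exists>n. ideal_pow R K n \<subseteq> J"
proof (rule ccontr)
  assume no: "\<not> ?thesis"
  let ?P = "\<lambda>L. ideal L R \<and> J \<subseteq> L \<and> \<not> (\<exists>n. ideal_pow R K n \<subseteq> L)"
  have "?P J" using J no by simp
  then obtain M where M: "?P M" and max: "\<forall>K. ?P K \<longrightarrow> M \<subseteq> K \<longrightarrow> K = M"
    using exists_maximal_ideal_with[of ?P J] by iprover
  have Mi: "ideal M R" using M by simp
  have big: "\<exists>n. ideal_pow R K n \<subseteq> Idl (insert a M)" if "a \<in> carrier R" "a \<notin> M" for a
    using M max Idl_insert_ideal[OF Mi that(1)] Idl_insert_upper[OF Mi that(1)] that(2) by blast
  have "primeideal M R"
  proof (rule primeidealI)
    show "carrier R \<noteq> M"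
      using M by (metis ideal_pow.simps(1) order_refl)
    fix a b assume ab: "a \<in> carrier R" "b \<in> carrier R" "a \<otimes> b \<in> M"
    show "a \<in> M \<or> b \<in> M"
    proof (rule ccontr)
      assume "\<not> ?thesis"
      then obtain m n where mn: "ideal_pow R K m \<subseteq> Idl (insert a M)"
        "ideal_pow R K n \<subseteq> Idl (insert b M)"
        using big[OF ab(1)] big[OF ab(2)] by auto
      have "ideal_pow R K (m + n) \<subseteq> M"
        unfolding ideal_pow_add[OF K]
      proof (rule ideal_prod_subset[OF Mi])
        fix u v assume "u \<in> ideal_pow R K m" "v \<in> ideal_pow R K n"
        then have "u \<in> Idl (insert a M)" "v \<in> Idl (insert b M)" using mn by auto
        then obtain r i s j where rs: "r \<in> carrier R" "i \<in> M" "u = r \<otimes> a \<oplus> i"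
          "s \<in> carrier R" "j \<in> M" "v = s \<otimes> b \<oplus> j"
          using mem_Idl_insertE[OF Mi ab(1)] mem_Idl_insertE[OF Mi ab(2)] by metis
        then show "u \<otimes> v \<in> M"
          using ideal_mult_mod_closed[OF Mi] ab by blast
      qed
      then show False using M(1) by blast
    qed
  qed (use Mi is_cring in auto)
  have "K \<subseteq> M"
  proof
    fix t assume "t \<in> K"
    then have "t \<in> ring_radical R J"
      using rad by blast
    then obtain n :: nat where "t \<in> carrier R" "t [^] n \<in> M"
      using M by (auto simp: ring_radical_def)
    then show "t \<in> M" using prime_pow_mem[OF \<open>primeideal M R\<close>] by blast
  qed
  then have "ideal_pow R K 1 \<subseteq> M"
    using Mi K ideal_subset[OF K] ideal_prod_one[OF K] by simp
  then show False using M(1) by blast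
qed

text \<open>For an \<open>x\<close> in \<open>M\<close> outside the radical,
  \<open>exists_prime_disjoint\<close> applied to the powers of \<open>x\<close> would give a prime
  over \<open>J\<close> other than \<open>M\<close>.\<close>

lemma radical_eq_if_only_prime:
  assumes J: "ideal J R" and M: "primeideal M R" "J \<subseteq> M"
    and only: "\<And>P. primeideal P R \<Longrightarrow> J \<subseteq> P \<Longrightarrow> P = M"
  shows "ring_radical R J = M"
proof
  show "ring_radical R J \<subseteq> M"
    using M prime_pow_mem by (auto simp: ring_radical_def)
  show "M \<subseteq> ring_radical R J"
  proof
    fix x assume x: "x \<in> M"
    have xc: "x \<in> carrier R" using x M ideal.Icarr by (fastforce simp: primeideal_def)
    show "x \<in> ring_radical R J"
    proof (rule ccontr)
      assume "x \<notin> ring_radical R J"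
      then have "J \<inter> range (\<lambda>n::nat. x [^] n) = {}"
        using xc by (auto simp: ring_radical_def)
      moreover have "\<one> = x [^] (0::nat)" by simp
      then have "\<one> \<in> range (\<lambda>n::nat. x [^] n)" by (rule range_eqI)
      moreover have "s \<otimes> t \<in> range (\<lambda>n::nat. x [^] n)"
        if "s \<in> range (\<lambda>n::nat. x [^] n)" "t \<in> range (\<lambda>n::nat. x [^] n)" for s t
        using that xc by (auto simp: nat_pow_mult)
      ultimately obtain Q where "primeideal Q R" "J \<subseteq> Q" "Q \<inter> range (\<lambda>n::nat. x [^] n) = {}"
        using exists_prime_disjoint[OF J, of "range (\<lambda>n::nat. x [^] n)"] xc by auto
      moreover have "x = x [^] (1::nat)" using xc by simp
      then have "x \<in> range (\<lambda>n::nat. x [^] n)" by (rule range_eqI)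
      ultimately show False using only x by blast
    qed
  qed
qed


text \<open>The maximal associated primes of \<open>R/J\<close>, as annihilators of nonzero residue
  classes. Their union is the set of zerodivisors modulo \<open>J\<close>. They are pairwise
  incomparable, so each can be treated on its own in prime avoidance.\<close>

definition maximal_colons :: "'a set \<Rightarrow> 'a set set" where
  "maximal_colons J = {colon R J a | a. a \<in> carrier R - J \<and>
     (\<forall>b\<in>carrier R - J. colon R J a \<subseteq> colon R J b \<longrightarrow> colon R J b = colon R J a)}"

text \<open>Let \<open>P = (J : a)\<close> and let \<open>s\<close> lie outside \<open>P\<close>.
  Then \<open>(J : s a)\<close> contains \<open>P\<close> and belongs to an element outside
  \<open>J\<close>, so by maximality it equals \<open>P\<close>; any \<open>r\<close> with
  \<open>r \<otimes> s\<close> in \<open>P\<close> lies in it.\<close>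

lemma maximal_colons_prime:
  assumes J: "ideal J R" and P: "P \<in> maximal_colons J"
  shows "primeideal P R"
proof -
  obtain a where a: "a \<in> carrier R" "a \<notin> J" and Pa: "P = colon R J a"
    and max: "\<And>b. b \<in> carrier R - J \<Longrightarrow> P \<subseteq> colon R J b \<Longrightarrow> colon R J b = P"
    using P by (auto simp: maximal_colons_def)
  show ?thesis
  proof (rule primeidealI)
    show "ideal P R" using colon_ideal J a Pa by simp
    have "\<one> \<notin> P" using a Pa by (simp add: colon_def)
    then show "carrier R \<noteq> P" by auto
    fix r s assume rs: "r \<in> carrier R" "s \<in> carrier R" "r \<otimes> s \<in> P"
    show "r \<in> P \<or> s \<in> P"
    proof (cases "s \<in> P")
      case False
      then have "s \<otimes> a \<in> carrier R - J"
        using rs a Pa by (simp add: colon_def)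
      moreover have "P \<subseteq> colon R J (s \<otimes> a)"
        using rs a Pa ideal.I_l_closed[OF J, of _ s] m_lcomm[of _ s a] by (auto simp: colon_def)
      ultimately have "colon R J (s \<otimes> a) = P" by (rule max)
      moreover have "r \<in> colon R J (s \<otimes> a)"
        using rs a Pa by (simp add: colon_def m_assoc)
      ultimately show ?thesis by simp
    qed simp
  qed (rule is_cring)
qed

lemma subset_maximal_colon:
  assumes J: "ideal J R" and a: "a \<in> carrier R" "a \<notin> J"
  shows "\<exists>P\<in>maximal_colons J. colon R J a \<subseteq> P"
proof -
  let ?P = "\<lambda>K. \<exists>b\<in>carrier R - J. K = colon R J b \<and> colon R J a \<subseteq> K"
  have "?P (colon R J a)" using a by blast
  moreover have "ideal K R" if "?P K" for K
    using that colon_ideal[OF J] by blast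
  ultimately have "\<exists>M. ?P M \<and> (\<forall>K. ?P K \<longrightarrow> M \<subseteq> K \<longrightarrow> K = M)"
    by (rule exists_maximal_ideal_with)
  then obtain M where MM: "?P M \<and> (\<forall>K. ?P K \<longrightarrow> M \<subseteq> K \<longrightarrow> K = M)" ..
  then have M: "?P M" by (rule conjunct1)
  from MM have max: "\<forall>K. ?P K \<longrightarrow> M \<subseteq> K \<longrightarrow> K = M" by (rule conjunct2)
  obtain b where b: "b \<in> carrier R - J" "M = colon R J b" "colon R J a \<subseteq> M"
    using M by blast
  have "colon R J c = M" if "c \<in> carrier R - J" "M \<subseteq> colon R J c" for c
  proof -
    have "?P (colon R J c)" using that b(3) by blast
    then show ?thesis using max that(2) by blast
  qed
  then have "M \<in> maximal_colons J"
    using b(1,2) unfolding maximal_colons_def by auto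
  then show ?thesis using b(3) by blast
qed

lemma maximal_colons_incomparable:
  assumes "P \<in> maximal_colons J" "Q \<in> maximal_colons J" "P \<subseteq> Q"
  shows "P = Q"
  using assms unfolding maximal_colons_def by auto

text \<open>Choose \<open>a\<^sub>P\<close> with \<open>P = (J : a\<^sub>P)\<close>. Finitely many of the \<open>a\<^sub>P\<close> generate all of them modulo \<open>J\<close>, so
  the intersection of the corresponding primes is contained in every \<open>P\<close>.\<close>

lemma finite_maximal_colons:
  assumes J: "ideal J R"
  shows "finite (maximal_colons J)"
proof -
  let ?M = "maximal_colons J"
  have "\<forall>P\<in>?M. \<exists>a. a \<in> carrier R \<and> P = colon R J a"
    by (auto simp: maximal_colons_def)
  then obtain f where f: "\<And>P. P \<in> ?M \<Longrightarrow> f P \<in> carrier R \<and> P = colon R J (f P)"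
    by metis
  let ?P = "\<lambda>K. \<exists>F. finite F \<and> F \<subseteq> ?M \<and> K = Idl (J \<union> f ` F)"
  have sub: "J \<union> f ` F \<subseteq> carrier R" if "F \<subseteq> ?M" for F
    using that f ideal_subset[OF J] by auto
  have "?P (Idl (J \<union> f ` {}))" by blast
  moreover have "ideal K R" if "?P K" for K
    using that genideal_ideal sub by blast
  ultimately have "\<exists>M. ?P M \<and> (\<forall>K. ?P K \<longrightarrow> M \<subseteq> K \<longrightarrow> K = M)"
    by (rule exists_maximal_ideal_with)
  then obtain M where MM: "?P M \<and> (\<forall>K. ?P K \<longrightarrow> M \<subseteq> K \<longrightarrow> K = M)" ..
  then have M: "?P M" by (rule conjunct1)
  from MM have max: "\<forall>K. ?P K \<longrightarrow> M \<subseteq> K \<longrightarrow> K = M" by (rule conjunct2)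
  obtain F where F: "finite F" "F \<subseteq> ?M" "M = Idl (J \<union> f ` F)"
    using M by blast
  have "P \<in> F" if P: "P \<in> ?M" for P
  proof (rule ccontr)
    assume PF: "P \<notin> F"
    have "?P (Idl (J \<union> f ` insert P F))"
      using F P by (intro exI[of _ "insert P F"]) simp
    moreover have "M \<subseteq> Idl (J \<union> f ` insert P F)"
      unfolding F(3) by (intro subset_Idl_subset sub) (use F P in auto)
    ultimately have "Idl (J \<union> f ` insert P F) = M"
      using max by blast
    then have fP: "f P \<in> Idl (J \<union> f ` F)"
      using genideal_self[OF sub[of "insert P F"]] F P by auto
    have prP: "primeideal P R"
      using maximal_colons_prime[OF J P] .
    have "\<exists>b\<in>carrier R. b \<notin> P \<and> (\<forall>Q\<in>F. b \<in> Q)"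
    proof (rule finite_primes_not_subset[OF prP oneideal _ F(1)])
      show "\<not> carrier R \<subseteq> P"
        using primeideal.I_notcarr[OF prP] ideal_subset prP by (auto simp: primeideal_def)
      fix Q assume Q: "Q \<in> F"
      then show "ideal Q R \<and> \<not> Q \<subseteq> P"
        using maximal_colons_incomparable[of Q J P] PF F P maximal_colons_prime[OF J, of Q]
        by (auto simp: primeideal_def)
    qed
    then obtain b where b: "b \<in> carrier R" "b \<notin> P" "\<And>Q. Q \<in> F \<Longrightarrow> b \<in> Q" by blast
    \<comment> \<open>Since \<open>b\<close> lies in every \<open>(J : f Q)\<close>, it kills each
      generator \<open>f Q\<close> modulo \<open>J\<close>, hence also \<open>f P\<close>; this puts
      \<open>b\<close> into \<open>P\<close>.\<close>
    have "Idl (J \<union> f ` F) \<subseteq> colon R J b"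
    proof (rule genideal_minimal[OF colon_ideal[OF J b(1)]])
      have "f Q \<in> colon R J b" if "Q \<in> F" for Q
      proof -
        have "b \<in> colon R J (f Q)" using f[of Q] that F b(3)[of Q] by auto
        then show ?thesis
          using f[of Q] that F by (auto simp: colon_def m_comm)
      qed
      then show "J \<union> f ` F \<subseteq> colon R J b"
        using subset_colon[OF J b(1)] by blast
    qed
    then have "b \<in> colon R J (f P)"
      using fP b(1) by (auto simp: colon_def m_comm)
    then show False
      using f[OF P] b(2) by simp
  qed
  then have "?M \<subseteq> F" by blast
  then show ?thesis
    using F(1) by (rule finite_subset)
qed

text \<open>Prime avoidance in the coset of \<open>y\<close> modulo \<open>K\<close>; passing from
  \<open>y\<close> to \<open>y \<oplus> b\<close> leaves the ideal generated together with
  \<open>K\<close> unchanged. The zerodivisors modulo \<open>J\<close> are covered by finitely many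
  maximal colons. These are handled one at a time: a prime that is hit is repaired by adding an
  element of \<open>K\<close> that lies in all primes handled before and not in this one.\<close>

lemma exists_add_nonzerodivisor:
  assumes J: "ideal J R" and K: "ideal K R" and y: "y \<in> carrier R"
    and avoid: "\<And>a. a \<in> carrier R - J \<Longrightarrow> primeideal (colon R J a) R \<Longrightarrow> \<not> insert y K \<subseteq> colon R J a"
  shows "\<exists>b\<in>K. \<forall>r\<in>carrier R. (y \<oplus> b) \<otimes> r \<in> J \<longrightarrow> r \<in> J"
proof -
  let ?M = "maximal_colons J"
  have avoid_finite: "\<exists>b\<in>K. \<forall>P\<in>F. y \<oplus> b \<notin> P" if "finite F" "F \<subseteq> ?M" for F
    using that
  proof (induction F)
    case empty
    then show ?case using ideal_zero_mem[OF K] by blast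
  next
    case (insert P F)
    then obtain b where b: "b \<in> K" "\<And>Q. Q \<in> F \<Longrightarrow> y \<oplus> b \<notin> Q" by auto
    have bc: "b \<in> carrier R" using b K ideal.Icarr by fast
    have PM: "P \<in> ?M" using insert.prems by simp
    have prP: "primeideal P R" using maximal_colons_prime[OF J PM] .
    then have iP: "ideal P R" by (simp add: primeideal_def)
    show ?case
    proof (cases "y \<oplus> b \<in> P")
      case False
      then show ?thesis using b by blast
    next
      case True
      have "\<not> insert y K \<subseteq> P"
        using PM avoid prP by (auto simp: maximal_colons_def)
      \<comment> \<open>Otherwise \<open>b\<close> would lie in \<open>P\<close>, and with
        \<open>y \<oplus> b\<close> also \<open>y\<close>.\<close>
      then have "\<not> K \<subseteq> P"
        using ideal_add_cancel[OF iP y _ True] b(1) by blast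
      moreover have "ideal Q R \<and> \<not> Q \<subseteq> P" if "Q \<in> F" for Q
        using maximal_colons_incomparable[of Q J P] PM insert that maximal_colons_prime[OF J, of Q]
        by (auto simp: primeideal_def)
      ultimately obtain c where c: "c \<in> K" "c \<notin> P" "\<And>Q. Q \<in> F \<Longrightarrow> c \<in> Q"
        using finite_primes_not_subset[OF prP K _ insert.hyps(1)] by blast
      have cc: "c \<in> carrier R" using c K ideal.Icarr by fast
      have eq: "y \<oplus> (b \<oplus> c) = (y \<oplus> b) \<oplus> c" "y \<oplus> (b \<oplus> c) = c \<oplus> (y \<oplus> b)"
        using y bc cc by (simp_all add: a_ac)
      have "y \<oplus> (b \<oplus> c) \<notin> P"
        using ideal_add_cancel[OF iP cc True] c(2) eq(2) by auto
      moreover have "y \<oplus> (b \<oplus> c) \<notin> Q" if Q: "Q \<in> F" for Q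
      proof -
        have "ideal Q R"
          using insert.prems Q maximal_colons_prime[OF J, of Q] by (auto simp: primeideal_def)
        then show ?thesis
          using ideal_add_cancel[of Q "y \<oplus> b" c] b(2)[OF Q] c(3)[OF Q] y bc eq(1) by auto
      qed
      moreover have "b \<oplus> c \<in> K" using ideal_add_closed[OF K] b c by blast
      ultimately show ?thesis by blast
    qed
  qed
  obtain b where b: "b \<in> K" "\<And>P. P \<in> ?M \<Longrightarrow> y \<oplus> b \<notin> P"
    using avoid_finite[OF finite_maximal_colons[OF J] order_refl] by auto
  have bc: "b \<in> carrier R" using b K ideal.Icarr by fast
  have "r \<in> J" if r: "r \<in> carrier R" "(y \<oplus> b) \<otimes> r \<in> J" for r
  proof (rule ccontr)
    assume "r \<notin> J"
    then obtain P where "P \<in> ?M" "colon R J r \<subseteq> P"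
      using subset_maximal_colon[OF J] r by blast
    then show False
      using b r y bc by (auto simp: colon_def)
  qed
  then show ?thesis using b(1) by blast
qed

text \<open>Descent with \<open>exists_smaller_prime\<close>: below a prime containing the first
  \<open>n + 1\<close> elements there is a strictly smaller one containing the first
  \<open>n\<close>. The chain has \<open>n\<close> strict inclusions, hence \<open>n + 1\<close>
  members.\<close>

lemma exists_prime_chain:
  assumes xs: "set xs \<subseteq> carrier R"
    and reg: "\<And>i y. i < length xs \<Longrightarrow> y \<in> carrier R \<Longrightarrow> xs ! i \<otimes> y \<in> Idl (set (take i xs)) \<Longrightarrow>
      y \<in> Idl (set (take i xs))"
    and "n \<le> length xs" "primeideal P R" "set (take n xs) \<subseteq> P"
  shows "\<exists>Q :: nat \<Rightarrow> 'a set. (\<forall>i\<le>n. primeideal (Q i) R) \<and> (\<forall>i<n. Q i \<subset> Q (Suc i)) \<and> Q n = P"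
  using assms(3-)
proof (induction n arbitrary: P)
  case 0
  then show ?case by (intro exI[of _ "\<lambda>_. P"]) simp
next
  case (Suc n)
  let ?I = "Idl (set (take n xs))"
  have n: "n < length xs" using Suc.prems by simp
  have sub: "set (take n xs) \<subseteq> carrier R" using xs set_take_subset by fast
  have P: "ideal P R" using Suc.prems by (simp add: primeideal_def)
  have tk: "set (take (Suc n) xs) = insert (xs ! n) (set (take n xs))"
    using n by (simp add: take_Suc_conv_app_nth)
  obtain Q where Q: "primeideal Q R" "?I \<subseteq> Q" "Q \<subset> P"
    using exists_smaller_prime[of P ?I "xs ! n"] Suc.prems(2,3) genideal_ideal[OF sub]
      genideal_minimal[OF P, of "set (take n xs)"] reg[OF n] tk by auto
  then obtain C :: "nat \<Rightarrow> 'a set" where C: "\<forall>i\<le>n. primeideal (C i) R" "\<forall>i<n. C i \<subset> C (Suc i)" "C n = Q"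
    using Suc.IH[of Q] n genideal_self[OF sub] by auto
  let ?C = "C(Suc n := P)"
  have "\<forall>i\<le>Suc n. primeideal (?C i) R" using C Suc.prems by (simp add: le_Suc_eq)
  moreover have "\<forall>i<Suc n. ?C i \<subset> ?C (Suc i)" using C Q by (simp add: less_Suc_eq)
  ultimately show ?case by (intro exI[of _ ?C]) simp
qed

end


section \<open>Annihilators in a complex of injectives\<close>

lemma module_homD:
  assumes "f \<in> module_hom R M N"
  shows "\<And>x. x \<in> carrier M \<Longrightarrow> f x \<in> carrier N"
    and "\<And>x y. x \<in> carrier M \<Longrightarrow> y \<in> carrier M \<Longrightarrow> f (x \<oplus>\<^bsub>M\<^esub> y) = f x \<oplus>\<^bsub>N\<^esub> f y"
    and "\<And>r x. r \<in> carrier R \<Longrightarrow> x \<in> carrier M \<Longrightarrow> f (r \<odot>\<^bsub>M\<^esub> x) = r \<odot>\<^bsub>N\<^esub> f x"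
  using assms by (auto simp: module_hom_def hom_def)

lemma module_homI:
  assumes "\<And>x. x \<in> carrier M \<Longrightarrow> f x \<in> carrier N"
    and "\<And>x y. x \<in> carrier M \<Longrightarrow> y \<in> carrier M \<Longrightarrow> f (x \<oplus>\<^bsub>M\<^esub> y) = f x \<oplus>\<^bsub>N\<^esub> f y"
    and "\<And>r x. r \<in> carrier R \<Longrightarrow> x \<in> carrier M \<Longrightarrow> f (r \<odot>\<^bsub>M\<^esub> x) = r \<odot>\<^bsub>N\<^esub> f x"
  shows "f \<in> module_hom R M N"
  using assms by (auto simp: module_hom_def hom_def)

lemma module_hom_zero:
  assumes "module R M" "module R N" "f \<in> module_hom R M N"
  shows "f \<zero>\<^bsub>M\<^esub> = \<zero>\<^bsub>N\<^esub>"
proof -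
  interpret M: module R M by fact
  interpret N: module R N by fact
  have "f (\<zero>\<^bsub>R\<^esub> \<odot>\<^bsub>M\<^esub> \<zero>\<^bsub>M\<^esub>) = \<zero>\<^bsub>R\<^esub> \<odot>\<^bsub>N\<^esub> f \<zero>\<^bsub>M\<^esub>"
    using module_homD(3)[OF assms(3), of "\<zero>\<^bsub>R\<^esub>" "\<zero>\<^bsub>M\<^esub>"] by simp
  then show ?thesis
    using module_homD(1)[OF assms(3)] by simp
qed

lemma module_hom_minus:
  assumes "module R M" "module R N" "f \<in> module_hom R M N" "x \<in> carrier M" "y \<in> carrier M"
  shows "f (x \<ominus>\<^bsub>M\<^esub> y) = f x \<ominus>\<^bsub>N\<^esub> f y"
proof -
  interpret M: module R M by fact
  interpret N: module R N by fact
  note f = module_homD[OF assms(3)]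
  have "\<ominus>\<^bsub>M\<^esub> y = (\<ominus>\<^bsub>R\<^esub> \<one>\<^bsub>R\<^esub>) \<odot>\<^bsub>M\<^esub> y"
    using assms by (simp add: M.smult_l_minus)
  then have "f (\<ominus>\<^bsub>M\<^esub> y) = (\<ominus>\<^bsub>R\<^esub> \<one>\<^bsub>R\<^esub>) \<odot>\<^bsub>N\<^esub> f y"
    using assms f by simp
  also have "\<dots> = \<ominus>\<^bsub>N\<^esub> f y"
    using assms f by (simp add: N.smult_l_minus)
  finally show ?thesis
    using assms f by (simp add: a_minus_def)
qed

context module
begin

lemma minus_smult_distr:
  "a \<in> carrier R \<Longrightarrow> x \<in> carrier M \<Longrightarrow> y \<in> carrier M \<Longrightarrow>
    a \<odot>\<^bsub>M\<^esub> (x \<ominus>\<^bsub>M\<^esub> y) = a \<odot>\<^bsub>M\<^esub> x \<ominus>\<^bsub>M\<^esub> a \<odot>\<^bsub>M\<^esub> y"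
  by (simp add: a_minus_def smult_r_distr smult_r_minus)

lemma submodule_minus_closed:
  "submodule N R M \<Longrightarrow> x \<in> N \<Longrightarrow> y \<in> N \<Longrightarrow> x \<ominus>\<^bsub>M\<^esub> y \<in> N"
  by (simp add: a_minus_def submoduleE)

lemma submodule_zero_mem: "submodule N R M \<Longrightarrow> \<zero>\<^bsub>M\<^esub> \<in> N"
  using submoduleE(2,4)[of N] submoduleE(1)[of N] smult_l_null
  by (metis R.zero_closed ex_in_conv subsetD)

lemma eq_add_imp_minus_eq:
  "x \<in> carrier M \<Longrightarrow> y \<in> carrier M \<Longrightarrow> z = x \<oplus>\<^bsub>M\<^esub> y \<Longrightarrow> z \<ominus>\<^bsub>M\<^esub> x = y"
  by (metis M.minus_closed M.add.m_comm M.add.inv_solve_right' a_minus_def M.a_closed)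

lemma minus_add_cancel:
  "x \<in> carrier M \<Longrightarrow> y \<in> carrier M \<Longrightarrow> x = y \<oplus>\<^bsub>M\<^esub> (x \<ominus>\<^bsub>M\<^esub> y)"
  using M.a_ac M.r_neg by (simp add: a_minus_def M.r_neg1 M.r_neg2 M.add.m_lcomm)

lemma annihilator_ideal:
  assumes "x \<in> carrier M"
  shows "ideal {r \<in> carrier R. r \<odot>\<^bsub>M\<^esub> x = \<zero>\<^bsub>M\<^esub>} R"
  by (rule R.ideal_memberI) (use assms in \<open>auto simp: smult_l_distr smult_assoc1\<close>)

end

text \<open>The assumption \<open>divisible\<close> is the part of injectivity that is needed: it extends the map
  \<open>r a + l \<mapsto> r w\<close> from the ideal \<open>(a) + J\<close> to \<open>R\<close>.\<close>

locale injective_complex = noetherian_cring R for R (structure) +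
  fixes I :: "nat \<Rightarrow> ('a, 'c) module" and \<delta> :: "nat \<Rightarrow> 'c \<Rightarrow> 'c"
  assumes I_module: "module R (I n)"
    and \<delta>_hom: "\<delta> n \<in> module_hom R (I n) (I (Suc n))"
    and \<delta>_\<delta>: "x \<in> carrier (I n) \<Longrightarrow> \<delta> (Suc n) (\<delta> n x) = \<zero>\<^bsub>I (Suc (Suc n))\<^esub>"
    and divisible: "ideal J R \<Longrightarrow> a \<in> carrier R \<Longrightarrow> w \<in> carrier (I n) \<Longrightarrow>
      (\<And>r. r \<in> colon R J a \<Longrightarrow> r \<odot>\<^bsub>I n\<^esub> w = \<zero>\<^bsub>I n\<^esub>) \<Longrightarrow>
      \<exists>v\<in>carrier (I n). a \<odot>\<^bsub>I n\<^esub> v = w \<and> (\<forall>r\<in>J. r \<odot>\<^bsub>I n\<^esub> v = \<zero>\<^bsub>I n\<^esub>)"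
begin

sublocale M: module R "I n" for n
  by (rule I_module)

lemmas \<delta>_closed [simp] = module_homD(1)[OF \<delta>_hom]
lemmas \<delta>_add = module_homD(2)[OF \<delta>_hom]
lemmas \<delta>_smult = module_homD(3)[OF \<delta>_hom]
lemmas \<delta>_zero [simp] = module_hom_zero[OF I_module I_module \<delta>_hom]
lemmas \<delta>_minus = module_hom_minus[OF I_module I_module \<delta>_hom]

text \<open>\<open>ann n J\<close> is the submodule \<open>Hom(R/J, I n)\<close> of \<open>I n\<close>; so \<open>cyc n J\<close> modulo \<open>bnd n J\<close> is \<open>Ext\<^sup>n(R/J, -)\<close>.\<close>

definition ann :: "nat \<Rightarrow> 'a set \<Rightarrow> 'c set" where
  "ann n J = {z \<in> carrier (I n). \<forall>r\<in>J. r \<odot>\<^bsub>I n\<^esub> z = \<zero>\<^bsub>I n\<^esub>}"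

definition cyc :: "nat \<Rightarrow> 'a set \<Rightarrow> 'c set" where
  "cyc n J = {z \<in> ann n J. \<delta> n z = \<zero>\<^bsub>I (Suc n)\<^esub>}"

primrec bnd :: "nat \<Rightarrow> 'a set \<Rightarrow> 'c set" where
  "bnd 0 J = {\<zero>\<^bsub>I 0\<^esub>}"
| "bnd (Suc n) J = \<delta> n ` ann n J"

text \<open>Vanishing of the cohomology in degree \<open>n\<close>; the opposite inclusion is
  \<open>bnd_subset_cyc\<close>.\<close>

definition exact_at :: "nat \<Rightarrow> 'a set \<Rightarrow> bool" where
  "exact_at n J \<longleftrightarrow> cyc n J \<subseteq> bnd n J"

lemma ann_submodule:
  assumes "J \<subseteq> carrier R"
  shows "submodule (ann n J) R (I n)"
proof (rule M.submoduleI)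
  fix a x assume a: "a \<in> carrier R" and x: "x \<in> ann n J"
  have "r \<odot>\<^bsub>I n\<^esub> (a \<odot>\<^bsub>I n\<^esub> x) = \<zero>\<^bsub>I n\<^esub>" if "r \<in> J" for r
  proof -
    have r: "r \<in> carrier R" and xc: "x \<in> carrier (I n)" using that assms x by (auto simp: ann_def)
    have "r \<odot>\<^bsub>I n\<^esub> (a \<odot>\<^bsub>I n\<^esub> x) = a \<odot>\<^bsub>I n\<^esub> (r \<odot>\<^bsub>I n\<^esub> x)"
      using r a xc by (metis M.smult_assoc1 m_comm)
    then show ?thesis using a x that by (simp add: ann_def)
  qed
  then show "a \<odot>\<^bsub>I n\<^esub> x \<in> ann n J" using a x by (simp add: ann_def)
qed (use assms in \<open>auto simp: ann_def M.smult_r_minus M.smult_r_distr subset_iff\<close>)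

lemma ann_antimono: "J \<subseteq> K \<Longrightarrow> ann n K \<subseteq> ann n J"
  by (auto simp: ann_def)

lemma \<delta>_ann: "J \<subseteq> carrier R \<Longrightarrow> z \<in> ann n J \<Longrightarrow> \<delta> n z \<in> ann (Suc n) J"
proof -
  assume J: "J \<subseteq> carrier R" and z: "z \<in> ann n J"
  have "r \<odot>\<^bsub>I (Suc n)\<^esub> \<delta> n z = \<zero>\<^bsub>I (Suc n)\<^esub>" if "r \<in> J" for r
  proof -
    have "r \<odot>\<^bsub>I (Suc n)\<^esub> \<delta> n z = \<delta> n (r \<odot>\<^bsub>I n\<^esub> z)"
      using \<delta>_smult[of r z n] that J z by (auto simp: ann_def)
    then show ?thesis using that z by (simp add: ann_def)
  qed
  then show ?thesis using z by (simp add: ann_def)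
qed

lemma ann_carrier: "z \<in> ann n J \<Longrightarrow> z \<in> carrier (I n)"
  by (simp add: ann_def)

lemma cyc_carrier: "z \<in> cyc n J \<Longrightarrow> z \<in> carrier (I n)"
  by (auto simp: cyc_def ann_def)

lemma bnd_subset_cyc:
  assumes "J \<subseteq> carrier R" shows "bnd n J \<subseteq> cyc n J"
proof (cases n)
  case 0
  then show ?thesis
    using M.submodule_zero_mem[OF ann_submodule[OF assms, of 0]] by (simp add: cyc_def)
next
  case (Suc k)
  then show ?thesis
    using \<delta>_ann[OF assms, of _ k] \<delta>_\<delta> by (auto simp: cyc_def dest: ann_carrier)
qed

lemma bnd_submodule:
  assumes J: "J \<subseteq> carrier R"
  shows "submodule (bnd n J) R (I n)"
proof (cases n)
  case 0
  then show ?thesis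
    by (auto intro!: M.submoduleI)
next
  case (Suc k)
  note A = M.submoduleE[OF ann_submodule[OF J, of k]]
  have "submodule (\<delta> k ` ann k J) R (I (Suc k))"
  proof (rule M.submoduleI)
    show "\<delta> k ` ann k J \<subseteq> carrier (I (Suc k))" by (auto dest: ann_carrier)
    show "\<zero>\<^bsub>I (Suc k)\<^esub> \<in> \<delta> k ` ann k J"
      using M.submodule_zero_mem[OF ann_submodule[OF J, of k]] \<delta>_zero[of k] by (metis image_eqI)
  next
    fix a assume "a \<in> \<delta> k ` ann k J"
    then obtain x where x: "x \<in> ann k J" "a = \<delta> k x" by blast
    then have xc: "x \<in> carrier (I k)" by (simp add: ann_carrier)
    have "\<delta> k (\<zero>\<^bsub>I k\<^esub> \<ominus>\<^bsub>I k\<^esub> x) = \<zero>\<^bsub>I (Suc k)\<^esub> \<ominus>\<^bsub>I (Suc k)\<^esub> a"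
      using x xc by (simp add: \<delta>_minus)
    then have "\<delta> k (\<ominus>\<^bsub>I k\<^esub> x) = \<ominus>\<^bsub>I (Suc k)\<^esub> a"
      using x xc by (simp add: a_minus_def)
    then show "\<ominus>\<^bsub>I (Suc k)\<^esub> a \<in> \<delta> k ` ann k J"
      using A(3)[OF x(1)] by (metis image_eqI)
  next
    fix a b assume "a \<in> \<delta> k ` ann k J" "b \<in> \<delta> k ` ann k J"
    then obtain x y where xy: "x \<in> ann k J" "a = \<delta> k x" "y \<in> ann k J" "b = \<delta> k y" by blast
    then have "a \<oplus>\<^bsub>I (Suc k)\<^esub> b = \<delta> k (x \<oplus>\<^bsub>I k\<^esub> y)"
      by (simp add: \<delta>_add ann_carrier)
    then show "a \<oplus>\<^bsub>I (Suc k)\<^esub> b \<in> \<delta> k ` ann k J"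
      using A(5)[OF xy(1,3)] by (metis image_eqI)
  next
    fix r a assume r: "r \<in> carrier R" and "a \<in> \<delta> k ` ann k J"
    then obtain x where x: "x \<in> ann k J" "a = \<delta> k x" by blast
    then have "r \<odot>\<^bsub>I (Suc k)\<^esub> a = \<delta> k (r \<odot>\<^bsub>I k\<^esub> x)"
      using r by (simp add: \<delta>_smult ann_carrier)
    then show "r \<odot>\<^bsub>I (Suc k)\<^esub> a \<in> \<delta> k ` ann k J"
      using A(4)[OF r x(1)] by (metis image_eqI)
  qed
  then show ?thesis using Suc by simp
qed

lemma bnd_antimono: "J \<subseteq> K \<Longrightarrow> bnd n K \<subseteq> bnd n J"
  by (cases n) (auto dest: subsetD[OF ann_antimono])

lemma bnd_ann: "J \<subseteq> carrier R \<Longrightarrow> z \<in> bnd n J \<Longrightarrow> z \<in> ann n J"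
  using bnd_subset_cyc[of J n] by (auto simp: cyc_def)

lemma bnd_\<delta>: "J \<subseteq> carrier R \<Longrightarrow> z \<in> bnd n J \<Longrightarrow> \<delta> n z = \<zero>\<^bsub>I (Suc n)\<^esub>"
  using bnd_subset_cyc[of J n] by (auto simp: cyc_def)

lemma cyc_submodule:
  assumes J: "J \<subseteq> carrier R"
  shows "submodule (cyc n J) R (I n)"
proof -
  note A = M.submoduleE[OF ann_submodule[OF J, of n]]
  show ?thesis
  proof (rule M.submoduleI)
    show "\<zero>\<^bsub>I n\<^esub> \<in> cyc n J"
      using M.submodule_zero_mem[OF ann_submodule[OF J, of n]] by (simp add: cyc_def)
    fix a assume a: "a \<in> cyc n J"
    then have ac: "a \<in> carrier (I n)" by (rule cyc_carrier)
    have "\<delta> n (\<zero>\<^bsub>I n\<^esub> \<ominus>\<^bsub>I n\<^esub> a) = \<zero>\<^bsub>I (Suc n)\<^esub>"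
      using a ac by (simp add: \<delta>_minus cyc_def) (simp add: a_minus_def)
    then have "\<delta> n (\<ominus>\<^bsub>I n\<^esub> a) = \<zero>\<^bsub>I (Suc n)\<^esub>"
      using ac by (simp add: a_minus_def)
    then show "\<ominus>\<^bsub>I n\<^esub> a \<in> cyc n J"
      using A(3) a by (simp add: cyc_def)
  qed (use A in \<open>auto simp: cyc_def \<delta>_add \<delta>_smult ann_carrier\<close>)
qed

lemma ann_Idl_insert:
  assumes J: "ideal J R" and a: "a \<in> carrier R"
    and z: "z \<in> ann n J" "a \<odot>\<^bsub>I n\<^esub> z = \<zero>\<^bsub>I n\<^esub>"
  shows "z \<in> ann n (Idl (insert a J))"
proof -
  have "Idl (insert a J) \<subseteq> {r \<in> carrier R. r \<odot>\<^bsub>I n\<^esub> z = \<zero>\<^bsub>I n\<^esub>}"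
    by (rule genideal_minimal[OF M.annihilator_ideal])
      (use z a ideal_subset[OF J] in \<open>auto simp: ann_def\<close>)
  then show ?thesis using z by (auto simp: ann_def)
qed

section \<open>Comparison of the cohomology for an ideal with that for a larger one\<close>

lemma divide_ann:
  assumes "ideal J R" "a \<in> carrier R" "w \<in> ann n (colon R J a)"
  shows "\<exists>v\<in>ann n J. a \<odot>\<^bsub>I n\<^esub> v = w"
  using divisible[OF assms(1,2), of w n] assms(3) by (auto simp: ann_def)

text \<open>By \<open>divide_ann\<close>, the dual of the injection of \<open>R/(J : a)\<close> into
  \<open>R/J\<close> given by multiplication by \<open>a\<close>, the bounded cochain can be divided
  by \<open>a\<close>; its coboundary is then divided as well.\<close>

lemma divide_bnd:
  assumes J: "ideal J R" "a \<in> carrier R" and w: "w \<in> bnd n (colon R J a)"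
  shows "\<exists>v\<in>bnd n J. a \<odot>\<^bsub>I n\<^esub> v = w"
proof (cases n)
  case 0
  then show ?thesis using w J by simp
next
  case (Suc k)
  then obtain u where u: "u \<in> ann k (colon R J a)" "w = \<delta> k u" using w by auto
  then obtain v where "v \<in> ann k J" "a \<odot>\<^bsub>I k\<^esub> v = u"
    using divide_ann[OF J] by blast
  then show ?thesis
    using Suc u(2) J(2) by (auto simp: \<delta>_smult[symmetric] ann_carrier)
qed

text \<open>The obstruction to making \<open>a\<close> kill \<open>w\<close> is \<open>a w\<close>,
  which is a cocycle killed by \<open>(J : a)\<close>. By exactness it is a boundary and so has the
  form \<open>a b\<close> with \<open>b\<close> a boundary for \<open>J\<close>; then
  \<open>w - b\<close> is killed by \<open>a\<close> and has the same coboundary as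
  \<open>w\<close>.\<close>

lemma correct_cochain_step:
  assumes J: "ideal J R" "a \<in> carrier R" and ex: "exact_at n (colon R J a)"
    and w: "w \<in> ann n J" and aw: "a \<odot>\<^bsub>I (Suc n)\<^esub> \<delta> n w = \<zero>\<^bsub>I (Suc n)\<^esub>"
  shows "\<exists>v\<in>ann n (Idl (insert a J)). \<delta> n v = \<delta> n w"
proof -
  have Jc: "J \<subseteq> carrier R" using ideal_subset J by blast
  have wc: "w \<in> carrier (I n)" using w by (rule ann_carrier)
  have "a \<odot>\<^bsub>I n\<^esub> w \<in> ann n (colon R J a)"
    using w J(2) by (auto simp: ann_def colon_def M.smult_assoc1[symmetric])
  moreover have "\<delta> n (a \<odot>\<^bsub>I n\<^esub> w) = \<zero>\<^bsub>I (Suc n)\<^esub>"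
    using aw J wc by (simp add: \<delta>_smult)
  ultimately have "a \<odot>\<^bsub>I n\<^esub> w \<in> bnd n (colon R J a)"
    using ex by (auto simp: exact_at_def cyc_def)
  then obtain b where b: "b \<in> bnd n J" "a \<odot>\<^bsub>I n\<^esub> b = a \<odot>\<^bsub>I n\<^esub> w"
    using divide_bnd[OF J] by blast
  have bc: "b \<in> carrier (I n)" using b bnd_ann[OF Jc] ann_carrier by blast
  have "a \<odot>\<^bsub>I n\<^esub> (w \<ominus>\<^bsub>I n\<^esub> b) = \<zero>\<^bsub>I n\<^esub>"
    using b bc wc J(2) by (simp add: M.minus_smult_distr) (simp add: a_minus_def M.r_neg)
  moreover have "w \<ominus>\<^bsub>I n\<^esub> b \<in> ann n J"
    using M.submodule_minus_closed[OF ann_submodule[OF Jc]] w bnd_ann[OF Jc b(1)] by blast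
  ultimately have "w \<ominus>\<^bsub>I n\<^esub> b \<in> ann n (Idl (insert a J))"
    using ann_Idl_insert[OF J] by blast
  moreover have "\<delta> n (w \<ominus>\<^bsub>I n\<^esub> b) = \<delta> n w"
    using bnd_\<delta>[OF Jc b(1)] bc wc by (simp add: \<delta>_minus) (simp add: a_minus_def)
  ultimately show ?thesis by blast
qed

text \<open>Adjoins the elements of \<open>L\<close> one by one. The exactness that a step requires
  is that of a colon of the intermediate ideal, which contains \<open>J\<close>; hence the
  assumption on all ideals above \<open>J\<close>.\<close>

lemma correct_cochain:
  assumes J: "ideal J R" and L: "ideal L R" "J \<subseteq> L"
    and ex: "\<And>K. ideal K R \<Longrightarrow> J \<subseteq> K \<Longrightarrow> exact_at n K"
    and w: "w \<in> ann n J" "\<delta> n w \<in> ann (Suc n) L"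
  shows "\<exists>v\<in>ann n L. \<delta> n v = \<delta> n w"
  using J L
proof (induction rule: ideal_between_induct)
  case base
  then show ?case using w by blast
next
  case (step K a)
  then obtain v where v: "v \<in> ann n K" "\<delta> n v = \<delta> n w" by blast
  have a: "a \<in> carrier R" using step L ideal.Icarr by fast
  have "exact_at n (colon R K a)"
    using ex colon_ideal[OF step(1) a] subset_colon[OF step(1) a] step(2) by blast
  then show ?case
    using correct_cochain_step[OF step(1) a _ v(1)] v(2) w(2) step by (auto simp: ann_def)
qed

text \<open>Induction on the degree: a cocycle killed by \<open>L\<close> bounds a cochain killed by
  \<open>J\<close>, and \<open>correct_cochain\<close>, using the lower degrees for all ideals above
  \<open>J\<close>, makes that cochain killed by \<open>L\<close>.\<close>

lemma exact_at_mono: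
  assumes J: "ideal J R" and ex: "\<And>i. i < n \<Longrightarrow> exact_at i J"
    and L: "ideal L R" "J \<subseteq> L" and i: "i < n"
  shows "exact_at i L"
  using i L
proof (induction i arbitrary: L)
  case 0
  then show ?case using ex[of 0] by (auto simp: exact_at_def cyc_def ann_def)
next
  case (Suc i)
  have "z \<in> bnd (Suc i) L" if z: "z \<in> cyc (Suc i) L" for z
  proof -
    have "z \<in> cyc (Suc i) J" using z ann_antimono[OF Suc.prems(3)] by (auto simp: cyc_def)
    then obtain w where w: "w \<in> ann i J" "z = \<delta> i w"
      using ex[OF Suc.prems(1)] by (auto simp: exact_at_def)
    then obtain v where "v \<in> ann i L" "\<delta> i v = z"
      using correct_cochain[OF J Suc.prems(2,3) _ w(1)] Suc.IH Suc.prems(1) z by (auto simp: cyc_def)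
    then show ?thesis by auto
  qed
  then show ?case by (auto simp: exact_at_def)
qed

text \<open>Injectivity of the map from Ext^n(R/L, -) to Ext^n(R/J, -). It is what later keeps the
  passage to the torsion complex from killing classes.\<close>

lemma bnd_inter_ann:
  assumes J: "ideal J R" and ex: "\<And>i. i < n \<Longrightarrow> exact_at i J"
    and L: "ideal L R" "J \<subseteq> L" and z: "z \<in> bnd n J" "z \<in> ann n L"
  shows "z \<in> bnd n L"
proof (cases n)
  case 0
  then show ?thesis using z by simp
next
  case (Suc k)
  then obtain w where w: "w \<in> ann k J" "z = \<delta> k w" using z by auto
  then obtain v where "v \<in> ann k L" "\<delta> k v = z"
    using correct_cochain[OF J L _ w(1)] exact_at_mono[OF J ex] Suc z(2) by auto
  then show ?thesis using Suc by auto
qed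

text \<open>\<open>r \<mapsto> r \<zeta>\<close> induces an isomorphism of \<open>R/J\<close> with the only nonzero cohomology of \<open>Hom(R/J, I)\<close>; that
  it vanishes on \<open>J\<close> is automatic.\<close>

definition resolves :: "nat \<Rightarrow> 'a set \<Rightarrow> 'c \<Rightarrow> bool" where
  "resolves n J \<zeta> \<longleftrightarrow> \<zeta> \<in> cyc n J \<and>
     (\<forall>z\<in>cyc n J. \<exists>r\<in>carrier R. \<exists>b\<in>bnd n J. z = r \<odot>\<^bsub>I n\<^esub> \<zeta> \<oplus>\<^bsub>I n\<^esub> b) \<and>
     (\<forall>r\<in>carrier R. r \<odot>\<^bsub>I n\<^esub> \<zeta> \<in> bnd n J \<longrightarrow> r \<in> J) \<and>
     (\<forall>i. i \<noteq> n \<longrightarrow> exact_at i J)"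

lemma resolves_exact_at_above:
  assumes res: "resolves n J \<zeta>" and J: "ideal J R" and L: "ideal L R" "J \<subseteq> L" and "i < n"
  shows "exact_at i L"
  using exact_at_mono[OF J _ L \<open>i < n\<close>] res by (simp add: resolves_def)

text \<open>An \<open>a\<close> with \<open>L a\<close> inside \<open>J\<close> turns the generator
  into a cocycle \<open>a \<zeta>\<close> killed by \<open>L\<close>. Exactness makes it a boundary,
  and faithfulness puts \<open>a\<close> into \<open>J\<close>. For \<open>L\<close> the maximal
  ideal this says that \<open>R/J\<close> has no socle.\<close>

lemma resolves_socle:
  assumes res: "resolves n J \<zeta>" and J: "ideal J R" and L: "ideal L R" "J \<subseteq> L"
    and ex: "exact_at n L" and a: "a \<in> carrier R" "L \<subseteq> colon R J a"
  shows "a \<in> J"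
proof -
  have Jc: "J \<subseteq> carrier R" using ideal_subset J by blast
  have \<zeta>: "\<zeta> \<in> cyc n J" using res by (simp add: resolves_def)
  then have \<zeta>c: "\<zeta> \<in> carrier (I n)" by (rule cyc_carrier)
  have a\<zeta>: "a \<odot>\<^bsub>I n\<^esub> \<zeta> \<in> cyc n J"
    using M.submoduleE(4)[OF cyc_submodule[OF Jc] a(1) \<zeta>] .
  have "r \<odot>\<^bsub>I n\<^esub> (a \<odot>\<^bsub>I n\<^esub> \<zeta>) = \<zero>\<^bsub>I n\<^esub>" if "r \<in> L" for r
  proof -
    have r: "r \<in> carrier R" "r \<otimes> a \<in> J" using that a by (auto simp: colon_def)
    then have "r \<odot>\<^bsub>I n\<^esub> (a \<odot>\<^bsub>I n\<^esub> \<zeta>) = (r \<otimes> a) \<odot>\<^bsub>I n\<^esub> \<zeta>"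
      using a \<zeta>c by (simp add: M.smult_assoc1)
    then show ?thesis using r \<zeta> by (simp add: cyc_def ann_def)
  qed
  then have "a \<odot>\<^bsub>I n\<^esub> \<zeta> \<in> cyc n L" using a\<zeta> by (auto simp: cyc_def ann_def)
  then have "a \<odot>\<^bsub>I n\<^esub> \<zeta> \<in> bnd n J"
    using ex bnd_antimono[OF L(2)] by (auto simp: exact_at_def)
  then show ?thesis using res a by (auto simp: resolves_def)
qed

text \<open>As \<open>(J : x) = J\<close>, cochains and boundaries killed by \<open>J\<close> can be
  divided by \<open>x\<close> without leaving \<open>J\<close>. The new generator is the image of
  \<open>\<zeta>\<close> under the connecting homomorphism: write \<open>\<zeta> = x u\<close> and
  take \<open>\<delta> n u\<close>.\<close>

lemma resolves_insert:
  assumes res: "resolves n J \<zeta>" and J: "ideal J R" and x: "x \<in> carrier R"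
    and nzd: "\<And>r. r \<in> carrier R \<Longrightarrow> x \<otimes> r \<in> J \<Longrightarrow> r \<in> J"
  shows "\<exists>\<xi>. resolves (Suc n) (Idl (insert x J)) \<xi>"
proof -
  let ?K = "Idl (insert x J)"
  have Jc: "J \<subseteq> carrier R" using ideal_subset J by blast
  have K: "ideal ?K R" "J \<subseteq> ?K" "x \<in> ?K"
    using Idl_insert_ideal[OF J x] Idl_insert_upper[OF J x] by auto
  have Kc: "?K \<subseteq> carrier R" using ideal_subset K by blast
  have col: "colon R J x = J"
    using subset_colon[OF J x] nzd x by (auto simp: colon_def m_comm)
  have \<zeta>: "\<zeta> \<in> cyc n J"
    and gen: "\<And>z. z \<in> cyc n J \<Longrightarrow> \<exists>r\<in>carrier R. \<exists>b\<in>bnd n J. z = r \<odot>\<^bsub>I n\<^esub> \<zeta> \<oplus>\<^bsub>I n\<^esub> b"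
    and faithful: "\<And>r. r \<in> carrier R \<Longrightarrow> r \<odot>\<^bsub>I n\<^esub> \<zeta> \<in> bnd n J \<Longrightarrow> r \<in> J"
    and ex: "\<And>i. i \<noteq> n \<Longrightarrow> exact_at i J"
    using res by (auto simp: resolves_def)
  have \<zeta>c: "\<zeta> \<in> carrier (I n)" using \<zeta> by (rule cyc_carrier)
  have "\<zeta> \<in> ann n (colon R J x)" using \<zeta> col by (simp add: cyc_def)
  then obtain u where u: "u \<in> ann n J" "x \<odot>\<^bsub>I n\<^esub> u = \<zeta>"
    using divide_ann[OF J x] by blast
  have uc: "u \<in> carrier (I n)" using u by (simp add: ann_carrier)
  have div: "\<exists>c\<in>bnd m J. x \<odot>\<^bsub>I m\<^esub> c = b" if "b \<in> bnd m J" for m b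
    using divide_bnd[OF J x, of b m] that col by simp
  have cyc_K: "p \<in> cyc m J" if "p \<in> cyc m ?K" for m p
    using that ann_antimono[OF K(2)] by (auto simp: cyc_def)
  have times_x: "x \<odot>\<^bsub>I m\<^esub> p \<in> cyc m J" if "p \<in> ann m J" "\<delta> m p \<in> ann (Suc m) ?K" for m p
  proof -
    have "x \<odot>\<^bsub>I m\<^esub> p \<in> ann m J"
      using M.submoduleE(4)[OF ann_submodule[OF Jc] x that(1)] .
    moreover have "\<delta> m (x \<odot>\<^bsub>I m\<^esub> p) = \<zero>\<^bsub>I (Suc m)\<^esub>"
      using that K(3) x by (simp add: \<delta>_smult ann_carrier) (simp add: ann_def)
    ultimately show ?thesis by (simp add: cyc_def)
  qed
  have "\<delta> n u \<in> ann (Suc n) J" using \<delta>_ann[OF Jc u(1)] .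
  moreover have "x \<odot>\<^bsub>I (Suc n)\<^esub> \<delta> n u = \<zero>\<^bsub>I (Suc n)\<^esub>"
    using \<zeta> u uc x by (simp add: \<delta>_smult[symmetric] cyc_def)
  ultimately have "\<delta> n u \<in> ann (Suc n) ?K"
    using ann_Idl_insert[OF J x] by blast
  then have \<xi>: "\<delta> n u \<in> cyc (Suc n) ?K"
    using \<delta>_\<delta> uc by (simp add: cyc_def)
  \<comment> \<open>Generation: for \<open>z = \<delta> n p\<close>, the cocycle \<open>x p\<close>
    equals \<open>r \<zeta> + b = x (r u + c)\<close>. So \<open>p - (r u + c)\<close> is killed by
    \<open>x\<close>, and its coboundary is the difference of \<open>z\<close> and \<open>r\<close>
    times the new generator.\<close>
  have "\<exists>r\<in>carrier R. \<exists>b\<in>bnd (Suc n) ?K. z = r \<odot>\<^bsub>I (Suc n)\<^esub> \<delta> n u \<oplus>\<^bsub>I (Suc n)\<^esub> b"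
    if z: "z \<in> cyc (Suc n) ?K" for z
  proof -
    have "z \<in> bnd (Suc n) J" using cyc_K[OF z] ex[of "Suc n"] by (auto simp: exact_at_def)
    then obtain p where p: "p \<in> ann n J" "z = \<delta> n p" by auto
    have pc: "p \<in> carrier (I n)" using p by (simp add: ann_carrier)
    have "x \<odot>\<^bsub>I n\<^esub> p \<in> cyc n J" using times_x p z by (simp add: cyc_def)
    then obtain r b where rb: "r \<in> carrier R" "b \<in> bnd n J" "x \<odot>\<^bsub>I n\<^esub> p = r \<odot>\<^bsub>I n\<^esub> \<zeta> \<oplus>\<^bsub>I n\<^esub> b"
      using gen by blast
    obtain c where c: "c \<in> bnd n J" "x \<odot>\<^bsub>I n\<^esub> c = b" using div rb by blast
    have cc: "c \<in> carrier (I n)" using bnd_ann[OF Jc c(1)] by (rule ann_carrier)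
    let ?q = "p \<ominus>\<^bsub>I n\<^esub> (r \<odot>\<^bsub>I n\<^esub> u \<oplus>\<^bsub>I n\<^esub> c)"
    have rcA: "r \<odot>\<^bsub>I n\<^esub> u \<oplus>\<^bsub>I n\<^esub> c \<in> ann n J"
      using M.submoduleE(4,5)[OF ann_submodule[OF Jc]] u rb bnd_ann[OF Jc c(1)] by blast
    have "x \<odot>\<^bsub>I n\<^esub> (r \<odot>\<^bsub>I n\<^esub> u) = r \<odot>\<^bsub>I n\<^esub> \<zeta>"
      using x rb uc u(2) by (metis M.smult_assoc1 m_comm)
    then have "x \<odot>\<^bsub>I n\<^esub> (r \<odot>\<^bsub>I n\<^esub> u \<oplus>\<^bsub>I n\<^esub> c) = x \<odot>\<^bsub>I n\<^esub> p"
      using x rb uc cc c(2) by (simp add: M.smult_r_distr)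
    then have "x \<odot>\<^bsub>I n\<^esub> ?q = \<zero>\<^bsub>I n\<^esub>"
      using x rb(1) uc cc pc by (simp add: M.minus_smult_distr) (simp add: a_minus_def M.r_neg)
    moreover have "?q \<in> ann n J"
      using M.submodule_minus_closed[OF ann_submodule[OF Jc] p(1) rcA] .
    ultimately have q: "?q \<in> ann n ?K" using ann_Idl_insert[OF J x] by blast
    have "p = (r \<odot>\<^bsub>I n\<^esub> u \<oplus>\<^bsub>I n\<^esub> c) \<oplus>\<^bsub>I n\<^esub> ?q"
      using M.minus_add_cancel[OF pc, of "r \<odot>\<^bsub>I n\<^esub> u \<oplus>\<^bsub>I n\<^esub> c"] rb uc cc by simp
    then have "\<delta> n p = \<delta> n (r \<odot>\<^bsub>I n\<^esub> u \<oplus>\<^bsub>I n\<^esub> c) \<oplus>\<^bsub>I (Suc n)\<^esub> \<delta> n ?q"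
      using rb uc cc ann_carrier[OF q] by (metis \<delta>_add M.a_closed M.smult_closed)
    also have "\<delta> n (r \<odot>\<^bsub>I n\<^esub> u \<oplus>\<^bsub>I n\<^esub> c) = r \<odot>\<^bsub>I (Suc n)\<^esub> \<delta> n u"
      using rb uc cc bnd_\<delta>[OF Jc c(1)] by (simp add: \<delta>_add \<delta>_smult)
    finally show ?thesis
      using p(2) rb(1) q by auto
  qed
  \<comment> \<open>Faithfulness: the difference of \<open>r u\<close> and the bounding cochain
    \<open>w\<close> is a cocycle \<open>s \<zeta> + b\<close>. Multiplication by \<open>x\<close>
    kills \<open>w\<close> and turns \<open>u\<close> into \<open>\<zeta>\<close>, so
    \<open>r \<zeta>\<close> and \<open>(x s) \<zeta>\<close> differ by a boundary and
    \<open>r - x s\<close> lies in \<open>J\<close>.\<close>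
  moreover have "r \<in> ?K" if r: "r \<in> carrier R" "r \<odot>\<^bsub>I (Suc n)\<^esub> \<delta> n u \<in> bnd (Suc n) ?K" for r
  proof -
    obtain w where w: "w \<in> ann n ?K" "r \<odot>\<^bsub>I (Suc n)\<^esub> \<delta> n u = \<delta> n w" using r by auto
    have wc: "w \<in> carrier (I n)" and wJ: "w \<in> ann n J"
      using w ann_antimono[OF K(2)] by (auto simp: ann_carrier)
    have "\<delta> n (r \<odot>\<^bsub>I n\<^esub> u \<ominus>\<^bsub>I n\<^esub> w) = \<zero>\<^bsub>I (Suc n)\<^esub>"
      using r w uc wc by (simp add: \<delta>_minus \<delta>_smult) (simp add: a_minus_def M.r_neg)
    moreover have "r \<odot>\<^bsub>I n\<^esub> u \<ominus>\<^bsub>I n\<^esub> w \<in> ann n J"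
      using M.submodule_minus_closed[OF ann_submodule[OF Jc] _ wJ]
        M.submoduleE(4)[OF ann_submodule[OF Jc] r(1) u(1)] by blast
    ultimately have "r \<odot>\<^bsub>I n\<^esub> u \<ominus>\<^bsub>I n\<^esub> w \<in> cyc n J" by (simp add: cyc_def)
    then obtain s b where sb: "s \<in> carrier R" "b \<in> bnd n J"
      "r \<odot>\<^bsub>I n\<^esub> u \<ominus>\<^bsub>I n\<^esub> w = s \<odot>\<^bsub>I n\<^esub> \<zeta> \<oplus>\<^bsub>I n\<^esub> b"
      using gen by blast
    have bc: "b \<in> carrier (I n)" using bnd_ann[OF Jc sb(2)] by (rule ann_carrier)
    have "x \<odot>\<^bsub>I n\<^esub> (r \<odot>\<^bsub>I n\<^esub> u \<ominus>\<^bsub>I n\<^esub> w) = r \<odot>\<^bsub>I n\<^esub> \<zeta>"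
    proof -
      have "x \<odot>\<^bsub>I n\<^esub> (r \<odot>\<^bsub>I n\<^esub> u) = r \<odot>\<^bsub>I n\<^esub> \<zeta>"
        using x r uc u(2) by (metis M.smult_assoc1 m_comm)
      moreover have "x \<odot>\<^bsub>I n\<^esub> w = \<zero>\<^bsub>I n\<^esub>" using w K(3) by (simp add: ann_def)
      ultimately show ?thesis
        using x r uc wc \<zeta>c by (simp add: M.minus_smult_distr) (simp add: a_minus_def)
    qed
    then have "r \<odot>\<^bsub>I n\<^esub> \<zeta> = (x \<otimes> s) \<odot>\<^bsub>I n\<^esub> \<zeta> \<oplus>\<^bsub>I n\<^esub> x \<odot>\<^bsub>I n\<^esub> b"
      using sb x \<zeta>c bc by (simp add: M.smult_r_distr M.smult_assoc1)
    then have "r \<odot>\<^bsub>I n\<^esub> \<zeta> \<ominus>\<^bsub>I n\<^esub> (x \<otimes> s) \<odot>\<^bsub>I n\<^esub> \<zeta> = x \<odot>\<^bsub>I n\<^esub> b"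
      using sb x \<zeta>c bc r by (intro M.eq_add_imp_minus_eq) auto
    moreover have "r \<odot>\<^bsub>I n\<^esub> \<zeta> \<ominus>\<^bsub>I n\<^esub> (x \<otimes> s) \<odot>\<^bsub>I n\<^esub> \<zeta> = (r \<ominus> x \<otimes> s) \<odot>\<^bsub>I n\<^esub> \<zeta>"
      using sb x \<zeta>c r by (simp add: a_minus_def M.smult_l_distr M.smult_l_minus)
    moreover have "x \<odot>\<^bsub>I n\<^esub> b \<in> bnd n J"
      using M.submoduleE(4)[OF bnd_submodule[OF Jc] x sb(2)] .
    ultimately have rs: "r \<ominus> x \<otimes> s \<in> J" using faithful[of "r \<ominus> x \<otimes> s"] r x sb by simp
    have "x \<otimes> s \<in> ?K" using K(1,3) sb by (simp add: ideal.I_r_closed)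
    then have "x \<otimes> s \<oplus> (r \<ominus> x \<otimes> s) \<in> ?K"
      using rs K(2) ideal_add_closed[OF K(1)] by blast
    moreover have "x \<otimes> s \<oplus> (r \<ominus> x \<otimes> s) = r"
      using r x sb by algebra
    ultimately show ?thesis by simp
  qed
  \<comment> \<open>In degree \<open>n\<close>, \<open>x z = 0\<close> forces the coefficient of
    \<open>\<zeta>\<close> into \<open>J\<close>, so \<open>z\<close> bounds for \<open>J\<close>
    and, by \<open>bnd_inter_ann\<close>, for the larger ideal. In other positive degrees the
    bounded cochain is corrected by a boundary until \<open>x\<close> kills it.\<close>
  moreover have "exact_at i ?K" if i: "i \<noteq> Suc n" for i
  proof (cases "i = n")
    case True
    have "z \<in> bnd n ?K" if z: "z \<in> cyc n ?K" for z
    proof -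
      obtain r b where rb: "r \<in> carrier R" "b \<in> bnd n J" "z = r \<odot>\<^bsub>I n\<^esub> \<zeta> \<oplus>\<^bsub>I n\<^esub> b"
        using gen[OF cyc_K[OF z]] by blast
      have bc: "b \<in> carrier (I n)" using bnd_ann[OF Jc rb(2)] by (rule ann_carrier)
      have "x \<odot>\<^bsub>I n\<^esub> z = \<zero>\<^bsub>I n\<^esub>" using z K(3) by (simp add: cyc_def ann_def)
      then have "(x \<otimes> r) \<odot>\<^bsub>I n\<^esub> \<zeta> \<oplus>\<^bsub>I n\<^esub> x \<odot>\<^bsub>I n\<^esub> b = \<zero>\<^bsub>I n\<^esub>"
        using rb x \<zeta>c bc by (simp add: M.smult_r_distr M.smult_assoc1)
      then have "(x \<otimes> r) \<odot>\<^bsub>I n\<^esub> \<zeta> = \<ominus>\<^bsub>I n\<^esub> (x \<odot>\<^bsub>I n\<^esub> b)"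
        using rb x \<zeta>c bc by (intro M.minus_equality[symmetric]) auto
      also have "\<dots> \<in> bnd n J"
        using M.submoduleE(3,4)[OF bnd_submodule[OF Jc]] x rb by blast
      finally have "r \<in> J" using faithful nzd x rb by simp
      then have "r \<odot>\<^bsub>I n\<^esub> \<zeta> = \<zero>\<^bsub>I n\<^esub>" using \<zeta> by (simp add: cyc_def ann_def)
      then have "z = b" using rb bc by simp
      then show ?thesis
        using bnd_inter_ann[OF J ex K(1,2) , of n z] rb z by (simp add: cyc_def)
    qed
    then show ?thesis using True by (auto simp: exact_at_def)
  next
    case False
    show ?thesis
    proof (cases i)
      case 0
      then show ?thesis using ex[OF False] cyc_K by (auto simp: exact_at_def)
    next
      case (Suc m)
      have m: "m \<noteq> n" using i Suc by simp
      have "z \<in> bnd i ?K" if z: "z \<in> cyc i ?K" for z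
      proof -
        have "z \<in> bnd i J" using cyc_K[OF z] ex[OF False] by (auto simp: exact_at_def)
        then obtain p where p: "p \<in> ann m J" "z = \<delta> m p" using Suc by auto
        have pc: "p \<in> carrier (I m)" using p by (simp add: ann_carrier)
        have "x \<odot>\<^bsub>I m\<^esub> p \<in> cyc m J" using times_x p z Suc by (simp add: cyc_def)
        then have "x \<odot>\<^bsub>I m\<^esub> p \<in> bnd m J" using ex[OF m] by (auto simp: exact_at_def)
        then obtain c where c: "c \<in> bnd m J" "x \<odot>\<^bsub>I m\<^esub> c = x \<odot>\<^bsub>I m\<^esub> p" using div by blast
        have cc: "c \<in> carrier (I m)" using bnd_ann[OF Jc c(1)] by (rule ann_carrier)
        have "x \<odot>\<^bsub>I m\<^esub> (p \<ominus>\<^bsub>I m\<^esub> c) = \<zero>\<^bsub>I m\<^esub>"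
          using c(2) x cc pc by (simp add: M.minus_smult_distr) (simp add: a_minus_def M.r_neg)
        moreover have "p \<ominus>\<^bsub>I m\<^esub> c \<in> ann m J"
          using M.submodule_minus_closed[OF ann_submodule[OF Jc] p(1) bnd_ann[OF Jc c(1)]] .
        ultimately have "p \<ominus>\<^bsub>I m\<^esub> c \<in> ann m ?K" using ann_Idl_insert[OF J x] by blast
        moreover have "\<delta> m (p \<ominus>\<^bsub>I m\<^esub> c) = z"
          using p pc cc bnd_\<delta>[OF Jc c(1)] by (simp add: \<delta>_minus) (simp add: a_minus_def)
        ultimately show ?thesis using Suc by auto
      qed
      then show ?thesis by (auto simp: exact_at_def)
    qed
  qed
  ultimately have "resolves (Suc n) ?K (\<delta> n u)"
    using \<xi> unfolding resolves_def by blast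
  then show ?thesis by blast
qed

end


section \<open>Injective resolutions and regular sequences\<close>

text \<open>Defines a map on elements given by nonunique expressions such as \<open>r a + j\<close>
  without choosing expressions: by linearity of \<open>G\<close>, being single valued need only be
  checked at zero.\<close>

lemma linear_graph_hom:
  assumes B: "module R B" and N: "module R N"
    and G: "G \<subseteq> carrier B \<times> carrier N"
    and add: "\<And>b n c m. (b, n) \<in> G \<Longrightarrow> (c, m) \<in> G \<Longrightarrow> (b \<oplus>\<^bsub>B\<^esub> c, n \<oplus>\<^bsub>N\<^esub> m) \<in> G"
    and smult: "\<And>r b n. r \<in> carrier R \<Longrightarrow> (b, n) \<in> G \<Longrightarrow> (r \<odot>\<^bsub>B\<^esub> b, r \<odot>\<^bsub>N\<^esub> n) \<in> G"
    and zero: "\<And>n. (\<zero>\<^bsub>B\<^esub>, n) \<in> G \<Longrightarrow> n = \<zero>\<^bsub>N\<^esub>"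
    and total: "\<And>b. b \<in> carrier B \<Longrightarrow> \<exists>n. (b, n) \<in> G"
  shows "\<exists>g\<in>module_hom R B N. \<forall>(b, n)\<in>G. g b = n"
proof -
  interpret B: module R B by fact
  interpret N: module R N by fact
  have unique: "n = m" if bn: "(b, n) \<in> G" and bm: "(b, m) \<in> G" for b n m
  proof -
    have c: "b \<in> carrier B" "n \<in> carrier N" "m \<in> carrier N"
      using bn bm G by auto
    have "((\<ominus>\<^bsub>R\<^esub> \<one>\<^bsub>R\<^esub>) \<odot>\<^bsub>B\<^esub> b, (\<ominus>\<^bsub>R\<^esub> \<one>\<^bsub>R\<^esub>) \<odot>\<^bsub>N\<^esub> m) \<in> G"
      using smult[OF _ bm] by simp
    then have "(\<ominus>\<^bsub>B\<^esub> b, \<ominus>\<^bsub>N\<^esub> m) \<in> G"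
      using c by (simp add: B.smult_l_minus N.smult_l_minus)
    then have "(b \<oplus>\<^bsub>B\<^esub> \<ominus>\<^bsub>B\<^esub> b, n \<oplus>\<^bsub>N\<^esub> \<ominus>\<^bsub>N\<^esub> m) \<in> G"
      using add[OF bn] by blast
    then have "n \<oplus>\<^bsub>N\<^esub> \<ominus>\<^bsub>N\<^esub> m = \<zero>\<^bsub>N\<^esub>"
      using zero c by (simp add: B.M.r_neg)
    then show ?thesis
      using c N.M.minus_equality[of n "\<ominus>\<^bsub>N\<^esub> m"] by simp
  qed
  define g where "g b = (THE n. (b, n) \<in> G)" for b
  have g: "g b = n" if "(b, n) \<in> G" for b n
    unfolding g_def using that unique by blast
  have g_mem: "(b, g b) \<in> G" if "b \<in> carrier B" for b
    using total[OF that] g by blast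
  have "g \<in> module_hom R B N"
  proof (rule module_homI)
    show "g x \<in> carrier N" if "x \<in> carrier B" for x
      using g_mem[OF that] G by blast
    show "g (x \<oplus>\<^bsub>B\<^esub> y) = g x \<oplus>\<^bsub>N\<^esub> g y" if "x \<in> carrier B" "y \<in> carrier B" for x y
      by (rule g[OF add[OF g_mem[OF that(1)] g_mem[OF that(2)]]])
    show "g (r \<odot>\<^bsub>B\<^esub> x) = r \<odot>\<^bsub>N\<^esub> g x" if "r \<in> carrier R" "x \<in> carrier B" for r x
      by (rule g[OF smult[OF that(1) g_mem[OF that(2)]]])
  qed
  then show ?thesis using g by blast
qed

lemma self_module_simps [simp]:
  "carrier (self_module R) = carrier R"
  "\<zero>\<^bsub>self_module R\<^esub> = \<zero>\<^bsub>R\<^esub>"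
  "x \<oplus>\<^bsub>self_module R\<^esub> y = x \<oplus>\<^bsub>R\<^esub> y"
  "r \<odot>\<^bsub>self_module R\<^esub> y = r \<otimes>\<^bsub>R\<^esub> y"
  by (simp_all add: self_module_def)

lemma inclusion_module_hom:
  "N \<subseteq> carrier M \<Longrightarrow> (\<lambda>x. x) \<in> module_hom R (M\<lparr>carrier := N\<rparr>) M"
  by (rule module_homI) auto

lemma inclusion_submodule_hom:
  "N \<subseteq> N' \<Longrightarrow> (\<lambda>x. x) \<in> module_hom R (M\<lparr>carrier := N\<rparr>) (M\<lparr>carrier := N'\<rparr>)"
  by (rule module_homI) auto

lemma (in module) zero_submodule: "submodule {\<zero>\<^bsub>M\<^esub>} R M"
  by (rule submoduleI) auto

lemma (in module) smult_range_submodule: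
  assumes "x \<in> carrier M"
  shows "submodule ((\<lambda>r. r \<odot>\<^bsub>M\<^esub> x) ` carrier R) R M"
proof (rule submoduleI)
  show "\<zero>\<^bsub>M\<^esub> \<in> (\<lambda>r. r \<odot>\<^bsub>M\<^esub> x) ` carrier R"
    using assms by (auto intro!: image_eqI[of _ _ \<zero>])
  fix a assume "a \<in> (\<lambda>r. r \<odot>\<^bsub>M\<^esub> x) ` carrier R"
  then show "\<ominus>\<^bsub>M\<^esub> a \<in> (\<lambda>r. r \<odot>\<^bsub>M\<^esub> x) ` carrier R"
    using assms by (auto simp: smult_l_minus[symmetric])
next
  fix a b assume "a \<in> (\<lambda>r. r \<odot>\<^bsub>M\<^esub> x) ` carrier R" "b \<in> (\<lambda>r. r \<odot>\<^bsub>M\<^esub> x) ` carrier R"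
  then show "a \<oplus>\<^bsub>M\<^esub> b \<in> (\<lambda>r. r \<odot>\<^bsub>M\<^esub> x) ` carrier R"
    using assms by (auto simp: smult_l_distr[symmetric])
next
  fix r a assume "r \<in> carrier R" "a \<in> (\<lambda>r. r \<odot>\<^bsub>M\<^esub> x) ` carrier R"
  then show "r \<odot>\<^bsub>M\<^esub> a \<in> (\<lambda>r. r \<odot>\<^bsub>M\<^esub> x) ` carrier R"
    using assms by (auto simp: smult_assoc1[symmetric])
qed (use assms in auto)

context cring
begin

lemma self_module_module: "module R (self_module R)"
proof (rule moduleI)
  show "abelian_group (self_module R)"
  proof (rule abelian_groupI)
    show "\<exists>y\<in>carrier (self_module R). y \<oplus>\<^bsub>self_module R\<^esub> x = \<zero>\<^bsub>self_module R\<^esub>"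
      if "x \<in> carrier (self_module R)" for x
      using that by (intro bexI[of _ "\<ominus> x"]) (auto simp: l_neg)
  qed (auto simp: a_ac)
qed (use is_cring in \<open>auto simp: l_distr r_distr m_assoc\<close>)

lemma submodule_self_iff_ideal: "submodule N R (self_module R) \<longleftrightarrow> ideal N R"
proof
  interpret S: module R "self_module R" by (rule self_module_module)
  show "ideal N R" if "submodule N R (self_module R)"
  proof (rule ideal_memberI)
    show "N \<subseteq> carrier R" using S.submoduleE(1)[OF that] by simp
    show "\<zero> \<in> N" using S.submodule_zero_mem[OF that] by simp
    show "a \<oplus> b \<in> N" if "a \<in> N" "b \<in> N" for a b
      using S.submoduleE(5)[OF \<open>submodule N R (self_module R)\<close> that] by simp
    show "r \<otimes> a \<in> N" if "r \<in> carrier R" "a \<in> N" for r a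
      using S.submoduleE(4)[OF \<open>submodule N R (self_module R)\<close> that] by simp
  qed
  show "submodule N R (self_module R)" if N: "ideal N R"
  proof (rule S.submoduleI)
    fix a assume a: "a \<in> N"
    then have ac: "a \<in> carrier R" using ideal.Icarr[OF N] by simp
    have "\<ominus>\<^bsub>self_module R\<^esub> a = (\<ominus> \<one>) \<odot>\<^bsub>self_module R\<^esub> a"
      using ac S.smult_l_minus[of \<one> a] by simp
    then show "\<ominus>\<^bsub>self_module R\<^esub> a \<in> N"
      using a ideal.I_l_closed[OF N] by simp
  qed (use ideal.Icarr[OF N] ideal_zero_mem[OF N] ideal_add_closed[OF N] ideal.I_l_closed[OF N] in auto)
qed

lemma span_mult_self: "S \<subseteq> carrier R \<Longrightarrow> span_mult R (self_module R) S = Idl S"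
proof -
  assume S: "S \<subseteq> carrier R"
  have "{r \<otimes> y | r y. r \<in> S \<and> y \<in> carrier R} \<subseteq> N \<longleftrightarrow> S \<subseteq> N" if N: "ideal N R" for N
  proof
    assume sub: "{r \<otimes> y | r y. r \<in> S \<and> y \<in> carrier R} \<subseteq> N"
    show "S \<subseteq> N"
    proof
      fix s assume "s \<in> S"
      then have "s \<otimes> \<one> \<in> N" using sub by blast
      then show "s \<in> N" using S \<open>s \<in> S\<close> by auto
    qed
  qed (use ideal.I_r_closed[OF N] in auto)
  then have "{N. ideal N R \<and> {r \<otimes> y | r y. r \<in> S \<and> y \<in> carrier R} \<subseteq> N} = {N. ideal N R \<and> S \<subseteq> N}"
    by (intro Collect_cong conj_cong refl)
  then show ?thesis
    by (simp add: span_mult_def module_span_def genideal_def submodule_self_iff_ideal)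
qed

lemma Idl_empty: "Idl {} = {\<zero>}"
  using genideal_minimal[OF zeroideal, of "{}"] ideal_zero_mem[OF genideal_ideal[of "{}"]] by auto

lemma Idl_ideal: "ideal J R \<Longrightarrow> Idl J = J"
  using genideal_minimal[of J J] genideal_self[of J] ideal_subset[of J] by auto

lemma Idl_insert_Idl:
  assumes "S \<subseteq> carrier R" "x \<in> carrier R"
  shows "Idl (insert x (Idl S)) = Idl (insert x S)"
proof
  have "insert x S \<subseteq> carrier R" using assms by simp
  note sub = genideal_self[OF this] genideal_ideal[OF this]
  show "Idl (insert x (Idl S)) \<subseteq> Idl (insert x S)"
    using sub genideal_minimal[OF sub(2), of S] by (intro genideal_minimal) auto
  show "Idl (insert x S) \<subseteq> Idl (insert x (Idl S))"
    using assms genideal_self[OF assms(1)] ideal_subset[OF genideal_ideal[OF assms(1)]]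
    by (intro subset_Idl_subset) auto
qed

text \<open>The map is well defined: \<open>r a + j = 0\<close> puts \<open>r a\<close> into
  \<open>J\<close>, so \<open>r\<close> is in the colon and kills \<open>w\<close>. The required
  \<open>v\<close> is the value at 1 of an extension to all of \<open>R\<close>.\<close>

lemma injective_module_divisible:
  fixes Q :: "('a, 'a) module"
  assumes Q: "injective_module R Q" and J: "ideal J R" and a: "a \<in> carrier R"
    and w: "w \<in> carrier Q" "\<And>r. r \<in> colon R J a \<Longrightarrow> r \<odot>\<^bsub>Q\<^esub> w = \<zero>\<^bsub>Q\<^esub>"
  shows "\<exists>v\<in>carrier Q. a \<odot>\<^bsub>Q\<^esub> v = w \<and> (\<forall>r\<in>J. r \<odot>\<^bsub>Q\<^esub> v = \<zero>\<^bsub>Q\<^esub>)"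
proof -
  interpret S: module R "self_module R" by (rule self_module_module)
  interpret Q: module R Q using Q by (simp add: injective_module_def)
  note Jc = ideal.Icarr[OF J]
  let ?L = "Idl (insert a J)"
  let ?A = "(self_module R)\<lparr>carrier := ?L\<rparr>"
  have L: "ideal ?L R" "J \<subseteq> ?L" "a \<in> ?L"
    using Idl_insert_ideal[OF J a] Idl_insert_upper[OF J a] by auto
  have A: "module R ?A"
    using L(1) submodule.submodule_is_module[OF _ self_module_module]
    by (simp add: submodule_self_iff_ideal)
  let ?G = "{(r \<otimes> a \<oplus> j, r \<odot>\<^bsub>Q\<^esub> w) | r j. r \<in> carrier R \<and> j \<in> J}"
  have "\<exists>g\<in>module_hom R ?A Q. \<forall>(b, n)\<in>?G. g b = n"
  proof (rule linear_graph_hom[OF A Q.module_axioms])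
    show "?G \<subseteq> carrier ?A \<times> carrier Q"
    proof
      fix p assume "p \<in> ?G"
      then obtain r j where p: "r \<in> carrier R" "j \<in> J" "p = (r \<otimes> a \<oplus> j, r \<odot>\<^bsub>Q\<^esub> w)" by blast
      then have "r \<otimes> a \<oplus> j \<in> ?L"
        using L by (intro ideal_add_closed[OF L(1)] ideal.I_l_closed[OF L(1)]) auto
      then show "p \<in> carrier ?A \<times> carrier Q" using p w(1) by simp
    qed
  next
    fix b n c m assume "(b, n) \<in> ?G" "(c, m) \<in> ?G"
    then obtain r i s j where *: "r \<in> carrier R" "i \<in> J" "b = r \<otimes> a \<oplus> i" "n = r \<odot>\<^bsub>Q\<^esub> w"
      "s \<in> carrier R" "j \<in> J" "c = s \<otimes> a \<oplus> j" "m = s \<odot>\<^bsub>Q\<^esub> w"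
      by blast
    then have "b \<oplus> c = (r \<oplus> s) \<otimes> a \<oplus> (i \<oplus> j)" "n \<oplus>\<^bsub>Q\<^esub> m = (r \<oplus> s) \<odot>\<^bsub>Q\<^esub> w"
      using a Jc w by (simp_all add: l_distr a_ac Q.smult_l_distr)
    moreover have "r \<oplus> s \<in> carrier R" "i \<oplus> j \<in> J"
      using * ideal_add_closed[OF J] by auto
    ultimately show "(b \<oplus>\<^bsub>?A\<^esub> c, n \<oplus>\<^bsub>Q\<^esub> m) \<in> ?G" by auto
  next
    fix s b n assume s: "s \<in> carrier R" and "(b, n) \<in> ?G"
    then obtain r i where *: "r \<in> carrier R" "i \<in> J" "b = r \<otimes> a \<oplus> i" "n = r \<odot>\<^bsub>Q\<^esub> w"
      by blast
    then have "s \<otimes> b = (s \<otimes> r) \<otimes> a \<oplus> s \<otimes> i" "s \<odot>\<^bsub>Q\<^esub> n = (s \<otimes> r) \<odot>\<^bsub>Q\<^esub> w"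
      using a Jc s w by (simp_all add: r_distr m_assoc Q.smult_assoc1)
    moreover have "s \<otimes> r \<in> carrier R" "s \<otimes> i \<in> J"
      using * s ideal.I_l_closed[OF J] by auto
    ultimately show "(s \<odot>\<^bsub>?A\<^esub> b, s \<odot>\<^bsub>Q\<^esub> n) \<in> ?G" by auto
  next
    fix n assume "(\<zero>\<^bsub>?A\<^esub>, n) \<in> ?G"
    then obtain r i where *: "r \<in> carrier R" "i \<in> J" "r \<otimes> a \<oplus> i = \<zero>" "n = r \<odot>\<^bsub>Q\<^esub> w"
      by auto
    then have "r \<otimes> a \<in> J"
      using ideal_add_cancel[OF J, of "r \<otimes> a" i] a ideal_zero_mem[OF J] by simp
    then show "n = \<zero>\<^bsub>Q\<^esub>" using * w(2) by (simp add: colon_def)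
  next
    fix b assume "b \<in> carrier ?A"
    then have "b \<in> ?L" by simp
    then obtain r j where "r \<in> carrier R" "j \<in> J" "b = r \<otimes> a \<oplus> j"
      by (rule mem_Idl_insertE[OF J a])
    then have "(b, r \<odot>\<^bsub>Q\<^esub> w) \<in> ?G" by blast
    then show "\<exists>n. (b, n) \<in> ?G" ..
  qed
  then obtain g where g_hom: "g \<in> module_hom R ?A Q" and graph: "\<forall>(b, n)\<in>?G. g b = n"
    by blast
  have g: "g (r \<otimes> a \<oplus> j) = r \<odot>\<^bsub>Q\<^esub> w" if "r \<in> carrier R" "j \<in> J" for r j
  proof -
    have "(r \<otimes> a \<oplus> j, r \<odot>\<^bsub>Q\<^esub> w) \<in> ?G" using that by blast
    from bspec[OF graph this] show ?thesis by simp
  qed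
  have "(\<lambda>x. x) \<in> module_hom R ?A (self_module R)"
    using ideal_subset[OF L(1)] by (intro inclusion_module_hom) simp
  moreover have "inj_on (\<lambda>x. x) (carrier ?A)" by simp
  ultimately have "\<exists>h\<in>module_hom R (self_module R) Q. \<forall>x\<in>carrier ?A. h x = g x"
    using Q A self_module_module g_hom unfolding injective_module_def by blast
  then obtain h where h: "h \<in> module_hom R (self_module R) Q" "\<And>x. x \<in> ?L \<Longrightarrow> h x = g x"
    by auto
  have smult_h: "r \<odot>\<^bsub>Q\<^esub> h \<one> = g r" if "r \<in> ?L" for r
    using module_homD(3)[OF h(1), of r \<one>] h(2)[OF that] that ideal.Icarr[OF L(1)] by simp
  have "a \<odot>\<^bsub>Q\<^esub> h \<one> = w"
    using smult_h[OF L(3)] g[of \<one> \<zero>] a w ideal_zero_mem[OF J] by simp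
  moreover have "r \<odot>\<^bsub>Q\<^esub> h \<one> = \<zero>\<^bsub>Q\<^esub>" if "r \<in> J" for r
    using smult_h[of r] g[of \<zero> r] that L(2) a w Jc by auto
  moreover have "h \<one> \<in> carrier Q"
    using module_homD(1)[OF h(1), of \<one>] by simp
  ultimately show ?thesis by blast
qed

end

section \<open>Injective resolutions as instances of the locale, and the induction along regular
  sequences\<close>

context noetherian_cring
begin

lemma injective_resolution_complex:
  fixes I :: "nat \<Rightarrow> ('a, 'a) module"
  assumes "injective_resolution R M I \<delta> \<epsilon>"
  shows "injective_complex R I \<delta>"
proof (intro injective_complex.intro injective_complex_axioms.intro noetherian_cring_axioms)
  have inj: "injective_module R (I n)" for n
    using assms by (simp add: injective_resolution_def)
  show "module R (I n)" for n
    using inj by (simp add: injective_module_def)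
  show "\<delta> n \<in> module_hom R (I n) (I (Suc n))" for n
    using assms by (simp add: injective_resolution_def)
  show "\<delta> (Suc n) (\<delta> n x) = \<zero>\<^bsub>I (Suc (Suc n))\<^esub>" if "x \<in> carrier (I n)" for n x
  proof -
    have "\<delta> n ` carrier (I n) = {x \<in> carrier (I (Suc n)). \<delta> (Suc n) x = \<zero>\<^bsub>I (Suc (Suc n))\<^esub>}"
      using assms by (simp add: injective_resolution_def)
    then show ?thesis using that by auto
  qed
  show "\<exists>v\<in>carrier (I n). a \<odot>\<^bsub>I n\<^esub> v = w \<and> (\<forall>r\<in>J. r \<odot>\<^bsub>I n\<^esub> v = \<zero>\<^bsub>I n\<^esub>)"
    if "ideal J R" "a \<in> carrier R" "w \<in> carrier (I n)" "\<And>r. r \<in> colon R J a \<Longrightarrow> r \<odot>\<^bsub>I n\<^esub> w = \<zero>\<^bsub>I n\<^esub>"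
    for J a w n
    using injective_module_divisible[OF inj that] .
qed

text \<open>The start of the induction, with the empty regular sequence: the elements killed by the
  zero ideal are all elements, and \<open>R\<close> is the kernel in degree 0.\<close>

lemma injective_resolution_resolves:
  fixes I :: "nat \<Rightarrow> ('a, 'a) module"
  assumes "injective_resolution R (self_module R) I \<delta> \<epsilon>"
  shows "injective_complex.resolves R I \<delta> 0 {\<zero>} (\<epsilon> \<one>)"
proof -
  interpret injective_complex R I \<delta>
    by (rule injective_resolution_complex[OF assms])
  have \<epsilon>: "\<epsilon> \<in> module_hom R (self_module R) (I 0)" "inj_on \<epsilon> (carrier R)"
    and im: "\<epsilon> ` carrier R = {x \<in> carrier (I 0). \<delta> 0 x = \<zero>\<^bsub>I (Suc 0)\<^esub>}"
    and ex: "\<And>n. \<delta> n ` carrier (I n) = {x \<in> carrier (I (Suc n)). \<delta> (Suc n) x = \<zero>\<^bsub>I (Suc (Suc n))\<^esub>}"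
    using assms by (auto simp: injective_resolution_def)
  have ann0: "ann n {\<zero>} = carrier (I n)" for n
    by (auto simp: ann_def)
  have \<epsilon>r: "\<epsilon> r = r \<odot>\<^bsub>I 0\<^esub> \<epsilon> \<one>" if "r \<in> carrier R" for r
    using module_homD(3)[OF \<epsilon>(1), of r \<one>] that by simp
  have \<epsilon>0: "\<epsilon> \<zero> = \<zero>\<^bsub>I 0\<^esub>"
    using module_hom_zero[OF self_module_module I_module \<epsilon>(1)] by simp
  have cyc0: "cyc 0 {\<zero>} = \<epsilon> ` carrier R"
    using im by (simp add: cyc_def ann0)
  show ?thesis
    unfolding resolves_def
  proof (intro conjI ballI impI allI)
    show "\<epsilon> \<one> \<in> cyc 0 {\<zero>}" unfolding cyc0 by simp
    show "\<exists>r\<in>carrier R. \<exists>b\<in>bnd 0 {\<zero>}. z = r \<odot>\<^bsub>I 0\<^esub> \<epsilon> \<one> \<oplus>\<^bsub>I 0\<^esub> b" if "z \<in> cyc 0 {\<zero>}" for z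
    proof -
      obtain r where "r \<in> carrier R" "z = \<epsilon> r" using \<open>z \<in> cyc 0 {\<zero>}\<close> cyc0 by auto
      then have "z = r \<odot>\<^bsub>I 0\<^esub> \<epsilon> \<one> \<oplus>\<^bsub>I 0\<^esub> \<zero>\<^bsub>I 0\<^esub>"
        using \<epsilon>r[of r] M.r_zero[OF cyc_carrier[OF \<open>z \<in> cyc 0 {\<zero>}\<close>]] by argo
      then show ?thesis using \<open>r \<in> carrier R\<close> by auto
    qed
    show "r \<in> {\<zero>}" if "r \<in> carrier R" "r \<odot>\<^bsub>I 0\<^esub> \<epsilon> \<one> \<in> bnd 0 {\<zero>}" for r
    proof -
      have "r \<odot>\<^bsub>I 0\<^esub> \<epsilon> \<one> = \<zero>\<^bsub>I 0\<^esub>" using that(2) by simp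
      then have "\<epsilon> r = \<epsilon> \<zero>" using \<epsilon>r[OF that(1)] \<epsilon>0 by argo
      then show ?thesis using \<epsilon>(2) that(1) by (simp add: inj_on_def)
    qed
    show "exact_at i {\<zero>}" if "i \<noteq> 0" for i
    proof -
      obtain k where "i = Suc k" using \<open>i \<noteq> 0\<close> by (cases i) auto
      moreover have "cyc (Suc k) {\<zero>} = bnd (Suc k) {\<zero>}"
        unfolding cyc_def bnd.simps ann0 ex ..
      ultimately show ?thesis unfolding exact_at_def by blast
    qed
  qed
qed

end

context injective_complex
begin

lemma regular_sequence_resolves:
  assumes base: "resolves 0 {\<zero>} \<zeta>" and xs: "set xs \<subseteq> carrier R"
    and reg: "\<And>i y. i < length xs \<Longrightarrow> y \<in> carrier R \<Longrightarrow> xs ! i \<otimes> y \<in> Idl (set (take i xs)) \<Longrightarrow>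
      y \<in> Idl (set (take i xs))"
    and "n \<le> length xs"
  shows "\<exists>\<xi>. resolves n (Idl (set (take n xs))) \<xi>"
  using assms(4)
proof (induction n)
  case 0
  then show ?case using base by (auto simp: Idl_empty)
next
  case (Suc n)
  then have n: "n < length xs" by simp
  have sub: "set (take n xs) \<subseteq> carrier R" using xs set_take_subset by fast
  have x: "xs ! n \<in> carrier R" using xs n by auto
  have tk: "set (take (Suc n) xs) = insert (xs ! n) (set (take n xs))"
    using n by (simp add: take_Suc_conv_app_nth)
  obtain \<xi> where "resolves n (Idl (set (take n xs))) \<xi>" using Suc by auto
  then show ?case
    using resolves_insert[OF _ genideal_ideal[OF sub] x reg[OF n]]
    unfolding tk by (simp add: Idl_insert_Idl[OF sub x])
qed

text \<open>The generators \<open>ys\<close> themselves need not be shown to form a regular sequence: step by step they are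
  replaced by nonzerodivisors \<open>y + b\<close> that generate the same ideal.\<close>

lemma parameter_ideal_resolves:
  assumes base: "resolves 0 {\<zero>} \<zeta>" and m: "ideal \<mm> R"
    and ys: "set ys \<subseteq> \<mm>"
    and only: "\<And>P. primeideal P R \<Longrightarrow> Idl (set ys) \<subseteq> P \<Longrightarrow> P = \<mm>"
    and ex: "\<And>i. i < length ys \<Longrightarrow> exact_at i \<mm>"
  shows "\<exists>\<xi>. resolves (length ys) (Idl (set ys)) \<xi>"
proof -
  note mc = ideal_subset[OF m]
  have ysc: "set ys \<subseteq> carrier R" using ys mc by blast
  \<comment> \<open>Invariant after \<open>j\<close> replacements: \<open>J\<close> is resolved in
    degree \<open>j\<close>, and together with the generators not yet treated it still generates the
    original ideal.\<close>
  have "\<exists>J \<xi>. ideal J R \<and> J \<subseteq> \<mm> \<and> resolves j J \<xi> \<and> Idl (J \<union> set (drop j ys)) = Idl (set ys)"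
    if "j \<le> length ys" for j
    using that
  proof (induction j)
    case 0
    have "Idl ({\<zero>} \<union> set ys) = Idl (set ys)"
      using Idl_insert_Idl[OF ysc zero_closed] Idl_ideal genideal_ideal[OF ysc]
      by (simp add: insert_absorb ideal_zero_mem)
    then show ?case
      using base zeroideal ideal_zero_mem[OF m] by (intro exI[of _ "{\<zero>}"]) auto
  next
    case (Suc j)
    then obtain J \<xi> where J: "ideal J R" "J \<subseteq> \<mm>" and res: "resolves j J \<xi>"
      and gen: "Idl (J \<union> set (drop j ys)) = Idl (set ys)"
      by auto
    have j: "j < length ys" using Suc.prems by simp
    let ?y = "ys ! j" and ?D = "set (drop (Suc j) ys)"
    have dr: "set (drop j ys) = insert ?y ?D"
      using j by (metis Cons_nth_drop_Suc list.simps(15))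
    have y: "?y \<in> \<mm>" "?y \<in> carrier R" using ys ysc j by auto
    have D: "?D \<subseteq> carrier R" "?D \<subseteq> \<mm>" using ysc ys set_drop_subset by fast+
    let ?K = "Idl ?D"
    have K: "ideal ?K R" "?D \<subseteq> ?K" using genideal_ideal[OF D(1)] genideal_self[OF D(1)] by auto
    have Km: "?K \<subseteq> \<mm>" by (rule genideal_minimal[OF m D(2)])
    have Jc: "J \<subseteq> carrier R" using ideal_subset[OF J(1)] .
    \<comment> \<open>A prime \<open>(J : a)\<close> containing \<open>?y\<close> and the later
      generators contains the whole parameter ideal, so it is \<open>\<mm>\<close>. Then
      \<open>a\<close> gives a socle element of \<open>R/J\<close>, which the vanishing for
      \<open>\<mm>\<close> in degree \<open>j\<close> excludes.\<close>
    have "\<exists>b\<in>?K. \<forall>r\<in>carrier R. (?y \<oplus> b) \<otimes> r \<in> J \<longrightarrow> r \<in> J"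
    proof (rule exists_add_nonzerodivisor[OF J(1) K(1) y(2)])
      fix a assume a: "a \<in> carrier R - J" and P: "primeideal (colon R J a) R"
      show "\<not> insert ?y ?K \<subseteq> colon R J a"
      proof
        assume sub: "insert ?y ?K \<subseteq> colon R J a"
        have "J \<union> set (drop j ys) \<subseteq> colon R J a"
          unfolding dr using sub K(2) subset_colon[OF J(1), of a] a by blast
        then have "Idl (set ys) \<subseteq> colon R J a"
          using genideal_minimal[OF colon_ideal[OF J(1)]] a gen by (metis DiffD1)
        then have "colon R J a = \<mm>" by (rule only[OF P])
        then have "\<mm> \<subseteq> colon R J a" by simp
        then have "a \<in> J"
          using resolves_socle[OF res J(1) m J(2) ex[OF j]] a by blast
        then show False using a by simp
      qed
    qed
    then obtain b where b: "b \<in> ?K" "\<And>r. r \<in> carrier R \<Longrightarrow> (?y \<oplus> b) \<otimes> r \<in> J \<Longrightarrow> r \<in> J"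
      by blast
    have bc: "b \<in> carrier R" using b(1) ideal.Icarr[OF K(1)] by blast
    let ?z = "?y \<oplus> b"
    let ?J = "Idl (insert ?z J)"
    have z: "?z \<in> carrier R" "?z \<in> \<mm>"
      using y bc b(1) Km ideal_add_closed[OF m] by auto
    note J' = Idl_insert_ideal[OF J(1) z(1)] Idl_insert_upper[OF J(1) z(1)]
    obtain \<xi>' where res': "resolves (Suc j) ?J \<xi>'"
      using resolves_insert[OF res J(1) z(1) b(2)] by blast
    have J'm: "?J \<subseteq> \<mm>" using genideal_minimal[OF m] J(2) z(2) by simp
    have c1: "?J \<union> ?D \<subseteq> carrier R" using ideal_subset[OF J'(1)] D by blast
    have c2: "J \<union> set (drop j ys) \<subseteq> carrier R" using Jc D y dr by auto
    note L1 = genideal_ideal[OF c1] genideal_self[OF c1]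
    note L2 = genideal_ideal[OF c2] genideal_self[OF c2]
    \<comment> \<open>\<open>?z\<close> and \<open>?y\<close> differ by \<open>b\<close>, an element
      of the ideal \<open>?K\<close> generated by the later elements, so either may replace the
      other.\<close>
    have "Idl (?J \<union> ?D) = Idl (J \<union> set (drop j ys))"
    proof
      have "?K \<subseteq> Idl (J \<union> set (drop j ys))"
        using L2(2) dr by (intro genideal_minimal[OF L2(1)]) auto
      then have "?z \<in> Idl (J \<union> set (drop j ys))"
        using L2(2) dr b(1) by (intro ideal_add_closed[OF L2(1)]) auto
      then have "?J \<subseteq> Idl (J \<union> set (drop j ys))"
        using L2(2) by (intro genideal_minimal[OF L2(1)]) auto
      then show "Idl (?J \<union> ?D) \<subseteq> Idl (J \<union> set (drop j ys))"
        using L2(2) dr by (intro genideal_minimal[OF L2(1)]) auto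
      have "?K \<subseteq> Idl (?J \<union> ?D)"
        using L1(2) by (intro genideal_minimal[OF L1(1)]) auto
      then have "?y \<in> Idl (?J \<union> ?D)"
        using L1(2) J'(3) b(1) by (intro ideal_add_cancel[OF L1(1) y(2), of b]) auto
      then show "Idl (J \<union> set (drop j ys)) \<subseteq> Idl (?J \<union> ?D)"
        using L1(2) J'(2) dr by (intro genideal_minimal[OF L1(1)]) auto
    qed
    then show ?case using J'(1) J'm res' gen by metis
  qed
  from this[of "length ys"] obtain J \<xi> where "ideal J R" "resolves (length ys) J \<xi>"
    "Idl J = Idl (set ys)"
    by auto
  then show ?thesis using Idl_ideal by auto
qed

end


section \<open>Top local cohomology and closures\<close>

text \<open>The last assumption is \<open>is_cohomology\<close> of the torsion complex with its
  quotient map fixed, so that classes in \<open>H\<close> can be named as values of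
  \<open>\<pi>\<close>.\<close>

locale top_local_cohomology = injective_complex R I \<delta>
  for R (structure) and I :: "nat \<Rightarrow> ('a, 'a) module" and \<delta> +
  fixes \<mm> :: "'a set" and d :: nat and H :: "('a, 'a) module" and \<pi> :: "'a \<Rightarrow> 'a"
  assumes \<mm>_ideal: "ideal \<mm> R"
    and \<pi>_quotient: "quotient_map R
      ((torsion_module R \<mm> (I d))\<lparr>carrier :=
        {x \<in> carrier (torsion_module R \<mm> (I d)). \<delta> d x = \<zero>\<^bsub>torsion_module R \<mm> (I (Suc d))\<^esub>}\<rparr>)
      (case d of 0 \<Rightarrow> {\<zero>\<^bsub>torsion_module R \<mm> (I 0)\<^esub>} | Suc k \<Rightarrow> \<delta> k ` carrier (torsion_module R \<mm> (I k)))
      H \<pi>"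
begin

text \<open>Exhibits the torsion complex as the union of the complexes killed by powers of
  \<open>\<mm>\<close>, hence \<open>H\<close> as the direct limit of the Ext modules for these
  powers.\<close>

lemma carrier_torsion: "carrier (torsion_module R \<mm> (I n)) = (\<Union>k. ann n (ideal_pow R \<mm> k))"
  by (auto simp: torsion_module_def ann_def)

definition torsion_cycles :: "'a set" where
  "torsion_cycles = (\<Union>k. cyc d (ideal_pow R \<mm> k))"

definition torsion_boundaries :: "'a set" where
  "torsion_boundaries = (\<Union>k. bnd d (ideal_pow R \<mm> k))"

lemma
  shows H_module: "module R H"
    and \<pi>_hom: "\<pi> \<in> module_hom R ((I d)\<lparr>carrier := torsion_cycles\<rparr>) H"
    and \<pi>_image: "\<pi> ` torsion_cycles = carrier H"
    and \<pi>_kernel: "{x \<in> torsion_cycles. \<pi> x = \<zero>\<^bsub>H\<^esub>} = torsion_boundaries"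
proof -
  let ?Z = "{x \<in> carrier (torsion_module R \<mm> (I d)). \<delta> d x = \<zero>\<^bsub>torsion_module R \<mm> (I (Suc d))\<^esub>}"
  have Z: "?Z = torsion_cycles"
    unfolding carrier_torsion torsion_cycles_def by (auto simp: cyc_def torsion_module_def)
  have "(case d of 0 \<Rightarrow> {\<zero>\<^bsub>torsion_module R \<mm> (I 0)\<^esub>}
      | Suc k \<Rightarrow> \<delta> k ` carrier (torsion_module R \<mm> (I k))) = torsion_boundaries"
    unfolding carrier_torsion torsion_boundaries_def
    by (cases d) (auto simp: torsion_module_def)
  moreover have "(torsion_module R \<mm> (I d))\<lparr>carrier := ?Z\<rparr> = (I d)\<lparr>carrier := torsion_cycles\<rparr>"
    unfolding Z by (simp add: torsion_module_def)
  ultimately have "quotient_map R ((I d)\<lparr>carrier := torsion_cycles\<rparr>) torsion_boundaries H \<pi>"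
    using \<pi>_quotient by argo
  then show "module R H" "\<pi> \<in> module_hom R ((I d)\<lparr>carrier := torsion_cycles\<rparr>) H"
    "\<pi> ` torsion_cycles = carrier H" "{x \<in> torsion_cycles. \<pi> x = \<zero>\<^bsub>H\<^esub>} = torsion_boundaries"
    by (auto simp: quotient_map_def)
qed

sublocale H: module R H by (rule H_module)

lemma \<pi>_linear:
  shows "x \<in> torsion_cycles \<Longrightarrow> \<pi> x \<in> carrier H"
    and "x \<in> torsion_cycles \<Longrightarrow> y \<in> torsion_cycles \<Longrightarrow> \<pi> (x \<oplus>\<^bsub>I d\<^esub> y) = \<pi> x \<oplus>\<^bsub>H\<^esub> \<pi> y"
    and "r \<in> carrier R \<Longrightarrow> x \<in> torsion_cycles \<Longrightarrow> \<pi> (r \<odot>\<^bsub>I d\<^esub> x) = r \<odot>\<^bsub>H\<^esub> \<pi> x"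
  using module_homD[OF \<pi>_hom] by auto

lemma cyc_subset_torsion: "ideal_pow R \<mm> n \<subseteq> J \<Longrightarrow> cyc d J \<subseteq> torsion_cycles"
  using ann_antimono[of "ideal_pow R \<mm> n" J d] by (auto simp: torsion_cycles_def cyc_def)

lemma bnd_subset_torsion: "ideal_pow R \<mm> n \<subseteq> J \<Longrightarrow> bnd d J \<subseteq> torsion_boundaries"
  using bnd_antimono[of "ideal_pow R \<mm> n" J d] by (auto simp: torsion_boundaries_def)

lemma image_cyc_submodule:
  assumes J: "ideal J R" "ideal_pow R \<mm> n \<subseteq> J"
  shows "submodule (\<pi> ` cyc d J) R H"
proof -
  have Jc: "J \<subseteq> carrier R" using ideal_subset J by blast
  note A = M.submoduleE[OF cyc_submodule[OF Jc, of d]] and Z = subsetD[OF cyc_subset_torsion[OF J(2)]]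
  show ?thesis
  proof (rule H.submoduleI)
    show "\<pi> ` cyc d J \<subseteq> carrier H" using Z \<pi>_linear(1) by blast
    have z: "\<zero>\<^bsub>I d\<^esub> \<in> cyc d J" by (rule M.submodule_zero_mem[OF cyc_submodule[OF Jc]])
    then have "\<pi> (\<zero> \<odot>\<^bsub>I d\<^esub> \<zero>\<^bsub>I d\<^esub>) = \<zero> \<odot>\<^bsub>H\<^esub> \<pi> \<zero>\<^bsub>I d\<^esub>"
      using \<pi>_linear(3) Z by blast
    then have "\<pi> \<zero>\<^bsub>I d\<^esub> = \<zero>\<^bsub>H\<^esub>" using \<pi>_linear(1)[OF Z[OF z]] by simp
    then show "\<zero>\<^bsub>H\<^esub> \<in> \<pi> ` cyc d J" using z by (metis image_eqI)
    show smult: "r \<odot>\<^bsub>H\<^esub> a \<in> \<pi> ` cyc d J" if "r \<in> carrier R" "a \<in> \<pi> ` cyc d J" for r a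
    proof -
      obtain x where x: "x \<in> cyc d J" "a = \<pi> x" using \<open>a \<in> \<pi> ` cyc d J\<close> by blast
      then have "r \<odot>\<^bsub>H\<^esub> a = \<pi> (r \<odot>\<^bsub>I d\<^esub> x)" using \<pi>_linear(3) Z \<open>r \<in> carrier R\<close> by simp
      then show ?thesis using A(4) x \<open>r \<in> carrier R\<close> by blast
    qed
    show "\<ominus>\<^bsub>H\<^esub> a \<in> \<pi> ` cyc d J" if a: "a \<in> \<pi> ` cyc d J" for a
    proof -
      have "a \<in> carrier H" using a Z \<pi>_linear(1) by blast
      then have "\<ominus>\<^bsub>H\<^esub> a = (\<ominus> \<one>) \<odot>\<^bsub>H\<^esub> a" by (simp add: H.smult_l_minus)
      then show ?thesis using smult[OF _ a, of "\<ominus> \<one>"] by simp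
    qed
    show "a \<oplus>\<^bsub>H\<^esub> b \<in> \<pi> ` cyc d J" if a: "a \<in> \<pi> ` cyc d J" and b: "b \<in> \<pi> ` cyc d J" for a b
    proof -
      obtain x where x: "x \<in> cyc d J" "a = \<pi> x" using a by blast
      obtain y where y: "y \<in> cyc d J" "b = \<pi> y" using b by blast
      have "a \<oplus>\<^bsub>H\<^esub> b = \<pi> (x \<oplus>\<^bsub>I d\<^esub> y)" using \<pi>_linear(2) Z x y by simp
      then show ?thesis using A(5) x y by blast
    qed
  qed
qed

text \<open>A model of \<open>R/J\<close> inside the local cohomology module. The smaller ideals \<open>K\<close> are used to see that a
  cocycle killed by \<open>J\<close> that bounds in the torsion complex bounds a cochain killed by \<open>J\<close>.\<close>

lemma quotient_map_image_cyc:
  assumes J: "ideal J R" "ideal_pow R \<mm> n \<subseteq> J" and res: "resolves d J \<zeta>"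
    and small: "\<And>k. \<exists>K. ideal K R \<and> K \<subseteq> J \<and> K \<subseteq> ideal_pow R \<mm> k \<and> (\<forall>i<d. exact_at i K)"
  shows "quotient_map R (self_module R) J (H\<lparr>carrier := \<pi> ` cyc d J\<rparr>) (\<lambda>r. \<pi> (r \<odot>\<^bsub>I d\<^esub> \<zeta>))"
proof -
  have Jc: "J \<subseteq> carrier R" using ideal_subset J by blast
  note A = M.submoduleE[OF cyc_submodule[OF Jc, of d]] and Z = subsetD[OF cyc_subset_torsion[OF J(2)]]
  have \<zeta>: "\<zeta> \<in> cyc d J" and gen: "\<And>z. z \<in> cyc d J \<Longrightarrow> \<exists>r\<in>carrier R. \<exists>b\<in>bnd d J. z = r \<odot>\<^bsub>I d\<^esub> \<zeta> \<oplus>\<^bsub>I d\<^esub> b"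
    and faithful: "\<And>r. r \<in> carrier R \<Longrightarrow> r \<odot>\<^bsub>I d\<^esub> \<zeta> \<in> bnd d J \<Longrightarrow> r \<in> J"
    using res by (auto simp: resolves_def)
  have \<zeta>c: "\<zeta> \<in> carrier (I d)" using \<zeta> by (rule cyc_carrier)
  have r\<zeta>: "r \<odot>\<^bsub>I d\<^esub> \<zeta> \<in> cyc d J" if "r \<in> carrier R" for r
    using A(4)[OF that \<zeta>] .
  have "\<pi> (r \<odot>\<^bsub>I d\<^esub> \<zeta>) = \<zero>\<^bsub>H\<^esub> \<longleftrightarrow> r \<in> J" if r: "r \<in> carrier R" for r
  proof
    assume "\<pi> (r \<odot>\<^bsub>I d\<^esub> \<zeta>) = \<zero>\<^bsub>H\<^esub>"
    then have "r \<odot>\<^bsub>I d\<^esub> \<zeta> \<in> torsion_boundaries"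
      using \<pi>_kernel Z[OF r\<zeta>[OF r]] by blast
    then obtain k where k: "r \<odot>\<^bsub>I d\<^esub> \<zeta> \<in> bnd d (ideal_pow R \<mm> k)"
      by (auto simp: torsion_boundaries_def)
    obtain K where K: "ideal K R" "K \<subseteq> J" "K \<subseteq> ideal_pow R \<mm> k" "\<And>i. i < d \<Longrightarrow> exact_at i K"
      using small[of k] by blast
    have "r \<odot>\<^bsub>I d\<^esub> \<zeta> \<in> bnd d K" using k bnd_antimono[OF K(3)] by blast
    then have "r \<odot>\<^bsub>I d\<^esub> \<zeta> \<in> bnd d J"
      using bnd_inter_ann[OF K(1,4) J(1) K(2)] r\<zeta>[OF r] by (simp add: cyc_def)
    then show "r \<in> J" by (rule faithful[OF r])
  next
    assume "r \<in> J"
    then have "r \<odot>\<^bsub>I d\<^esub> \<zeta> = \<zero>\<^bsub>I d\<^esub>" using \<zeta> by (simp add: cyc_def ann_def)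
    also have "\<dots> \<in> torsion_boundaries"
      using M.submodule_zero_mem[OF bnd_submodule[OF Jc]] bnd_subset_torsion[OF J(2)] by blast
    finally show "\<pi> (r \<odot>\<^bsub>I d\<^esub> \<zeta>) = \<zero>\<^bsub>H\<^esub>" using \<pi>_kernel by blast
  qed
  then have "{r \<in> carrier R. \<pi> (r \<odot>\<^bsub>I d\<^esub> \<zeta>) = \<zero>\<^bsub>H\<^esub>} = J"
    using Jc by blast
  moreover have "(\<lambda>r. \<pi> (r \<odot>\<^bsub>I d\<^esub> \<zeta>)) ` carrier R = \<pi> ` cyc d J"
  proof
    show "(\<lambda>r. \<pi> (r \<odot>\<^bsub>I d\<^esub> \<zeta>)) ` carrier R \<subseteq> \<pi> ` cyc d J" using r\<zeta> by blast
    show "\<pi> ` cyc d J \<subseteq> (\<lambda>r. \<pi> (r \<odot>\<^bsub>I d\<^esub> \<zeta>)) ` carrier R"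
    proof (rule image_subsetI)
      fix z assume "z \<in> cyc d J"
      then obtain r b where rb: "r \<in> carrier R" "b \<in> bnd d J" "z = r \<odot>\<^bsub>I d\<^esub> \<zeta> \<oplus>\<^bsub>I d\<^esub> b"
        using gen by blast
      have "b \<in> torsion_boundaries" using rb bnd_subset_torsion[OF J(2)] by blast
      then have "b \<in> torsion_cycles" "\<pi> b = \<zero>\<^bsub>H\<^esub>" using \<pi>_kernel by auto
      then have "\<pi> z = \<pi> (r \<odot>\<^bsub>I d\<^esub> \<zeta>)"
        using \<pi>_linear(1,2) Z[OF r\<zeta>[OF rb(1)]] rb(3) by simp
      then show "\<pi> z \<in> (\<lambda>r. \<pi> (r \<odot>\<^bsub>I d\<^esub> \<zeta>)) ` carrier R" using rb(1) by blast
    qed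
  qed
  moreover have "(\<lambda>r. \<pi> (r \<odot>\<^bsub>I d\<^esub> \<zeta>)) \<in> module_hom R (self_module R) (H\<lparr>carrier := \<pi> ` cyc d J\<rparr>)"
  proof (rule module_homI)
    show "\<pi> (r \<odot>\<^bsub>I d\<^esub> \<zeta>) \<in> carrier (H\<lparr>carrier := \<pi> ` cyc d J\<rparr>)" if "r \<in> carrier (self_module R)" for r
      using that r\<zeta> by simp
    show "\<pi> ((r \<oplus>\<^bsub>self_module R\<^esub> s) \<odot>\<^bsub>I d\<^esub> \<zeta>) =
        \<pi> (r \<odot>\<^bsub>I d\<^esub> \<zeta>) \<oplus>\<^bsub>H\<lparr>carrier := \<pi> ` cyc d J\<rparr>\<^esub> \<pi> (s \<odot>\<^bsub>I d\<^esub> \<zeta>)"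
      if "r \<in> carrier (self_module R)" "s \<in> carrier (self_module R)" for r s
      using that \<zeta>c r\<zeta> Z \<pi>_linear(2) by (simp add: M.smult_l_distr)
    show "\<pi> ((r \<odot>\<^bsub>self_module R\<^esub> s) \<odot>\<^bsub>I d\<^esub> \<zeta>) = r \<odot>\<^bsub>H\<lparr>carrier := \<pi> ` cyc d J\<rparr>\<^esub> \<pi> (s \<odot>\<^bsub>I d\<^esub> \<zeta>)"
      if "r \<in> carrier R" "s \<in> carrier (self_module R)" for r s
      using that \<zeta>c r\<zeta> Z \<pi>_linear(3) by (simp add: M.smult_assoc1)
  qed
  moreover have "module R (H\<lparr>carrier := \<pi> ` cyc d J\<rparr>)"
    using submodule.submodule_is_module[OF image_cyc_submodule[OF J] H_module] .
  ultimately show ?thesis by (simp add: quotient_map_def)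
qed

text \<open>Each class has a representative killed by some power of \<open>\<mm>\<close>; the sum of
  the exponents serves for finitely many classes at once.\<close>

lemma finite_subset_image_cyc:
  assumes "finite X" "X \<subseteq> carrier H"
  shows "\<exists>n. \<forall>J. J \<subseteq> ideal_pow R \<mm> n \<longrightarrow> X \<subseteq> \<pi> ` cyc d J"
  using assms
proof (induction X)
  case empty
  then show ?case by simp
next
  case (insert x X)
  then obtain n where n: "\<And>J. J \<subseteq> ideal_pow R \<mm> n \<Longrightarrow> X \<subseteq> \<pi> ` cyc d J" by auto
  have "x \<in> \<pi> ` torsion_cycles" using insert.prems \<pi>_image by blast
  then obtain z k where z: "z \<in> cyc d (ideal_pow R \<mm> k)" "x = \<pi> z"
    by (auto simp: torsion_cycles_def)
  have "insert x X \<subseteq> \<pi> ` cyc d J" if J: "J \<subseteq> ideal_pow R \<mm> (n + k)" for J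
  proof -
    have "J \<subseteq> ideal_pow R \<mm> n" "J \<subseteq> ideal_pow R \<mm> k"
      using J ideal_pow_antimono[OF \<mm>_ideal, of n "n + k"] ideal_pow_antimono[OF \<mm>_ideal, of k "n + k"]
      by auto
    moreover from this have "z \<in> cyc d J"
      using z(1) ann_antimono[of J "ideal_pow R \<mm> k" d] by (auto simp: cyc_def)
    ultimately show ?thesis using n z(2) by blast
  qed
  then show ?case by blast
qed

end

text \<open>Lifts generators along the isomorphism \<open>N \<rightarrow> Q\<close>.\<close>

lemma (in cring) fg_quotient_by_zero:
  fixes H Q :: "('a, 'c) module"
  assumes H: "module R H" and N: "submodule N R H"
    and \<psi>: "quotient_map R (H\<lparr>carrier := N\<rparr>) {\<zero>\<^bsub>H\<^esub>} Q \<psi>" and fg: "fg_module R Q"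
  shows "\<exists>X. finite X \<and> X \<subseteq> N \<and> (\<forall>N'. submodule N' R H \<and> X \<subseteq> N' \<longrightarrow> N \<subseteq> N')"
proof -
  interpret H: module R H by fact
  have Nm: "module R (H\<lparr>carrier := N\<rparr>)" using submodule.submodule_is_module[OF N H] .
  have Q: "module R Q" and hom: "\<psi> \<in> module_hom R (H\<lparr>carrier := N\<rparr>) Q"
    and im: "\<psi> ` N = carrier Q" and ker: "{x \<in> N. \<psi> x = \<zero>\<^bsub>Q\<^esub>} = {\<zero>\<^bsub>H\<^esub>}"
    using \<psi> by (auto simp: quotient_map_def)
  interpret Q: module R Q by fact
  note NE = H.submoduleE[OF N]
  have lin: "\<And>x. x \<in> N \<Longrightarrow> \<psi> x \<in> carrier Q"
    "\<And>x y. x \<in> N \<Longrightarrow> y \<in> N \<Longrightarrow> \<psi> (x \<oplus>\<^bsub>H\<^esub> y) = \<psi> x \<oplus>\<^bsub>Q\<^esub> \<psi> y"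
    "\<And>r x. r \<in> carrier R \<Longrightarrow> x \<in> N \<Longrightarrow> \<psi> (r \<odot>\<^bsub>H\<^esub> x) = r \<odot>\<^bsub>Q\<^esub> \<psi> x"
    using module_homD[OF hom] by auto
  have lin_minus: "\<psi> (\<ominus>\<^bsub>H\<^esub> x) = \<ominus>\<^bsub>Q\<^esub> \<psi> x" if "x \<in> N" for x
  proof -
    have "x \<in> carrier H" using NE(1) that by blast
    then have "\<ominus>\<^bsub>H\<^esub> x = (\<ominus> \<one>) \<odot>\<^bsub>H\<^esub> x" by (simp add: H.smult_l_minus)
    then show ?thesis using lin(3)[of "\<ominus> \<one>" x] lin(1)[OF that] that by (simp add: Q.smult_l_minus)
  qed
  obtain S where S: "finite S" "S \<subseteq> carrier Q" "module_span R Q S = carrier Q"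
    using fg by (auto simp: fg_module_def)
  then obtain X where X: "X \<subseteq> N" "finite X" "S = \<psi> ` X"
    using im finite_subset_image by metis
  have "N \<subseteq> N'" if N': "submodule N' R H" "X \<subseteq> N'" for N'
  proof
    fix x assume x: "x \<in> N"
    note N'E = H.submoduleE[OF N'(1)]
    \<comment> \<open>This submodule contains the generators \<open>S\<close>, so it is all of
      \<open>Q\<close>; injectivity of \<open>\<psi>\<close> then carries the conclusion back to
      \<open>N\<close>.\<close>
    have "submodule (\<psi> ` (N \<inter> N')) R Q"
    proof (rule Q.submoduleI)
      show "\<psi> ` (N \<inter> N') \<subseteq> carrier Q" using lin by blast
      have "\<zero>\<^bsub>H\<^esub> \<in> N \<inter> N'" "\<psi> \<zero>\<^bsub>H\<^esub> = \<zero>\<^bsub>Q\<^esub>"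
        using H.submodule_zero_mem N N' ker by auto
      then show "\<zero>\<^bsub>Q\<^esub> \<in> \<psi> ` (N \<inter> N')" by (metis image_eqI)
      show "\<ominus>\<^bsub>Q\<^esub> a \<in> \<psi> ` (N \<inter> N')" if a: "a \<in> \<psi> ` (N \<inter> N')" for a
      proof -
        obtain u where u: "u \<in> N" "u \<in> N'" "a = \<psi> u" using a by blast
        then have "\<ominus>\<^bsub>Q\<^esub> a = \<psi> (\<ominus>\<^bsub>H\<^esub> u)" by (simp add: lin_minus)
        then show ?thesis using NE(3) N'E(3) u by blast
      qed
      show "a \<oplus>\<^bsub>Q\<^esub> b \<in> \<psi> ` (N \<inter> N')" if a: "a \<in> \<psi> ` (N \<inter> N')" and b: "b \<in> \<psi> ` (N \<inter> N')" for a b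
      proof -
        obtain u where u: "u \<in> N" "u \<in> N'" "a = \<psi> u" using a by blast
        obtain v where v: "v \<in> N" "v \<in> N'" "b = \<psi> v" using b by blast
        have "a \<oplus>\<^bsub>Q\<^esub> b = \<psi> (u \<oplus>\<^bsub>H\<^esub> v)" using u v by (simp add: lin)
        then show ?thesis using NE(5) N'E(5) u v by blast
      qed
      show "r \<odot>\<^bsub>Q\<^esub> a \<in> \<psi> ` (N \<inter> N')" if r: "r \<in> carrier R" and a: "a \<in> \<psi> ` (N \<inter> N')" for r a
      proof -
        obtain u where u: "u \<in> N" "u \<in> N'" "a = \<psi> u" using a by blast
        have "r \<odot>\<^bsub>Q\<^esub> a = \<psi> (r \<odot>\<^bsub>H\<^esub> u)" using u r by (simp add: lin)
        then show ?thesis using NE(4) N'E(4) u r by blast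
      qed
    qed
    moreover have "S \<subseteq> \<psi> ` (N \<inter> N')" using X N'(2) by blast
    ultimately have "carrier Q \<subseteq> \<psi> ` (N \<inter> N')"
      using S(3) by (auto simp: module_span_def)
    then obtain y where y: "y \<in> N" "y \<in> N'" "\<psi> x = \<psi> y" using lin(1)[OF x] by auto
    have c: "x \<in> carrier H" "y \<in> carrier H" using x y NE(1) by auto
    have "\<psi> (x \<ominus>\<^bsub>H\<^esub> y) = \<zero>\<^bsub>Q\<^esub>"
      using lin(1,2) lin_minus NE(3) x y by (simp add: a_minus_def Q.M.r_neg)
    then have "x \<ominus>\<^bsub>H\<^esub> y = \<zero>\<^bsub>H\<^esub>"
      using ker H.submodule_minus_closed[OF N x y(1)] by blast
    then have "x = y" using H.minus_add_cancel[OF c] c by simp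
    then show "x \<in> N'" using y by simp
  qed
  then show ?thesis using X by blast
qed

section \<open>Closures of zero, and rationality as closedness of zero\<close>

lemma closure_zero_mono:
  fixes cl :: "'a closure_op"
  assumes fct: "functorial R cl" and M: "module R M" and N: "submodule N R M" "submodule N' R M" "N \<subseteq> N'"
  shows "cl (M\<lparr>carrier := N\<rparr>) {\<zero>\<^bsub>M\<^esub>} \<subseteq> cl (M\<lparr>carrier := N'\<rparr>) {\<zero>\<^bsub>M\<^esub>}"
proof -
  interpret M: module R M by fact
  have Nm: "module R (M\<lparr>carrier := N\<rparr>)" "module R (M\<lparr>carrier := N'\<rparr>)"
    using submodule.submodule_is_module[OF _ M] N by auto
  have "submodule {\<zero>\<^bsub>M\<^esub>} R (M\<lparr>carrier := N\<rparr>)"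
    using module.zero_submodule[OF Nm(1)] by simp
  then have "(\<lambda>x. x) ` cl (M\<lparr>carrier := N\<rparr>) {\<zero>\<^bsub>M\<^esub>} \<subseteq> cl (M\<lparr>carrier := N'\<rparr>) ((\<lambda>x. x) ` {\<zero>\<^bsub>M\<^esub>})"
    using fct Nm inclusion_submodule_hom[OF N(3)] unfolding functorial_def by blast
  then show ?thesis by simp
qed

text \<open>Residuality with \<open>N = L\<close> makes \<open>cl M L\<close> the preimage of the
  closure of zero in \<open>Q\<close>; since \<open>p\<close> is onto with kernel \<open>L\<close>,
  the preimage is \<open>L\<close> exactly when that closure is zero.\<close>

lemma residual_closed_iff:
  fixes cl :: "'a closure_op"
  assumes cl: "closure_operation R cl" "residual R cl"
    and M: "module R M" and L: "submodule L R M" and q: "quotient_map R M L Q p"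
  shows "cl M L = L \<longleftrightarrow> cl Q {\<zero>\<^bsub>Q\<^esub>} = {\<zero>\<^bsub>Q\<^esub>}"
proof -
  have Q: "module R Q" and hom: "p \<in> module_hom R M Q" and im: "p ` carrier M = carrier Q"
    and ker: "{x \<in> carrier M. p x = \<zero>\<^bsub>Q\<^esub>} = L"
    using q by (auto simp: quotient_map_def)
  have "\<zero>\<^bsub>M\<^esub> \<in> L" using module.submodule_zero_mem[OF M L] .
  then have "p ` L = {\<zero>\<^bsub>Q\<^esub>}" using ker by auto
  then have clM: "cl M L = {x \<in> carrier M. p x \<in> cl Q {\<zero>\<^bsub>Q\<^esub>}}"
    using cl(2)[unfolded residual_def, rule_format, of M L L Q p] M L q by simp
  have sub: "submodule (cl Q {\<zero>\<^bsub>Q\<^esub>}) R Q"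
    using cl(1) Q module.zero_submodule[OF Q] unfolding closure_operation_def by blast
  show ?thesis
  proof
    assume closed: "cl M L = L"
    have "y = \<zero>\<^bsub>Q\<^esub>" if y: "y \<in> cl Q {\<zero>\<^bsub>Q\<^esub>}" for y
    proof -
      have "y \<in> carrier Q" using y module.submoduleE(1)[OF Q sub] by blast
      then obtain x where "x \<in> carrier M" "y = p x" using im by blast
      then show ?thesis using y closed clM ker by blast
    qed
    then show "cl Q {\<zero>\<^bsub>Q\<^esub>} = {\<zero>\<^bsub>Q\<^esub>}"
      using module.submodule_zero_mem[OF Q sub] by blast
  next
    assume "cl Q {\<zero>\<^bsub>Q\<^esub>} = {\<zero>\<^bsub>Q\<^esub>}"
    then show "cl M L = L" using clM ker by simp
  qed
qed

context cring
begin

text \<open>The residue field of the local ring embeds in \<open>E\<close>, and \<open>R x\<close> maps onto it.\<close>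

lemma injective_hull_cogenerator:
  fixes H E k :: "('a, 'a) module"
  assumes proper: "\<And>J. ideal J R \<Longrightarrow> J \<noteq> carrier R \<Longrightarrow> J \<subseteq> \<mm>" and one: "\<one> \<notin> \<mm>"
    and k: "quotient_map R (self_module R) \<mm> k \<rho>" and hull: "injective_hull R k E"
    and H: "module R H" and x: "x \<in> carrier H" "x \<noteq> \<zero>\<^bsub>H\<^esub>"
  shows "\<exists>f\<in>module_hom R H E. f x \<noteq> \<zero>\<^bsub>E\<^esub>"
proof -
  interpret H: module R H by fact
  have km: "module R k" and E: "injective_module R E" using hull by (auto simp: injective_hull_def)
  interpret E: module R E using E by (simp add: injective_module_def)
  interpret k: module R k by fact
  obtain \<iota> where \<iota>: "\<iota> \<in> module_hom R k E" "inj_on \<iota> (carrier k)"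
    using hull by (auto simp: injective_hull_def)
  have \<rho>: "\<rho> \<in> module_hom R (self_module R) k" and ker: "{r \<in> carrier R. \<rho> r = \<zero>\<^bsub>k\<^esub>} = \<mm>"
    using k by (auto simp: quotient_map_def)
  note l1 = module_homD[OF \<rho>, simplified] and l2 = module_homD[OF \<iota>(1)]
  have \<iota>0: "\<iota> \<zero>\<^bsub>k\<^esub> = \<zero>\<^bsub>E\<^esub>" by (rule module_hom_zero[OF km E.module_axioms \<iota>(1)])
  let ?A = "H\<lparr>carrier := (\<lambda>r. r \<odot>\<^bsub>H\<^esub> x) ` carrier R\<rparr>"
  have sub: "submodule ((\<lambda>r. r \<odot>\<^bsub>H\<^esub> x) ` carrier R) R H" using H.smult_range_submodule[OF x(1)] .
  have A: "module R ?A" using submodule.submodule_is_module[OF sub H] .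
  let ?G = "{(r \<odot>\<^bsub>H\<^esub> x, \<iota> (\<rho> r)) | r. r \<in> carrier R}"
  have "\<exists>g\<in>module_hom R ?A E. \<forall>(b, n)\<in>?G. g b = n"
  proof (rule linear_graph_hom[OF A E.module_axioms])
    show "?G \<subseteq> carrier ?A \<times> carrier E" using l1 l2 by auto
  next
    fix b n c m assume "(b, n) \<in> ?G" "(c, m) \<in> ?G"
    then obtain r s where *: "r \<in> carrier R" "b = r \<odot>\<^bsub>H\<^esub> x" "n = \<iota> (\<rho> r)"
      "s \<in> carrier R" "c = s \<odot>\<^bsub>H\<^esub> x" "m = \<iota> (\<rho> s)" by blast
    then have "b \<oplus>\<^bsub>H\<^esub> c = (r \<oplus> s) \<odot>\<^bsub>H\<^esub> x" "n \<oplus>\<^bsub>E\<^esub> m = \<iota> (\<rho> (r \<oplus> s))"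
      using l1 l2 x(1) by (simp_all add: H.smult_l_distr)
    then show "(b \<oplus>\<^bsub>?A\<^esub> c, n \<oplus>\<^bsub>E\<^esub> m) \<in> ?G" using * by auto
  next
    fix s b n assume s: "s \<in> carrier R" and "(b, n) \<in> ?G"
    then obtain r where *: "r \<in> carrier R" "b = r \<odot>\<^bsub>H\<^esub> x" "n = \<iota> (\<rho> r)" by blast
    then have "s \<odot>\<^bsub>H\<^esub> b = (s \<otimes> r) \<odot>\<^bsub>H\<^esub> x" "s \<odot>\<^bsub>E\<^esub> n = \<iota> (\<rho> (s \<otimes> r))"
      using l1 l2 x(1) s by (simp_all add: H.smult_assoc1)
    then show "(s \<odot>\<^bsub>?A\<^esub> b, s \<odot>\<^bsub>E\<^esub> n) \<in> ?G" using * s by auto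
  next
    fix n assume "(\<zero>\<^bsub>?A\<^esub>, n) \<in> ?G"
    then obtain r where r: "r \<in> carrier R" "r \<odot>\<^bsub>H\<^esub> x = \<zero>\<^bsub>H\<^esub>" "n = \<iota> (\<rho> r)" by auto
    \<comment> \<open>The annihilator of \<open>x\<close> is a proper ideal, hence inside
      \<open>\<mm>\<close>; so \<open>r x = 0\<close> gives \<open>\<rho> r = 0\<close> and the
      graph is single valued at zero.\<close>
    let ?J = "{r \<in> carrier R. r \<odot>\<^bsub>H\<^esub> x = \<zero>\<^bsub>H\<^esub>}"
    have "\<one> \<notin> ?J" using x by simp
    then have "?J \<noteq> carrier R" using one_closed by blast
    then have "?J \<subseteq> \<mm>" using proper H.annihilator_ideal[OF x(1)] by blast
    then have "\<rho> r = \<zero>\<^bsub>k\<^esub>" using r ker by blast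
    then show "n = \<zero>\<^bsub>E\<^esub>" using r(3) \<iota>0 by simp
  next
    fix b assume "b \<in> carrier ?A"
    then show "\<exists>n. (b, n) \<in> ?G" by auto
  qed
  then obtain g where g_hom: "g \<in> module_hom R ?A E" and graph: "\<forall>(b, n)\<in>?G. g b = n"
    by blast
  have "(\<lambda>x. x) \<in> module_hom R ?A H"
    using H.submoduleE(1)[OF sub] by (rule inclusion_module_hom)
  moreover have "inj_on (\<lambda>x. x) (carrier ?A)" by simp
  ultimately have "\<exists>h\<in>module_hom R H E. \<forall>a\<in>carrier ?A. h a = g a"
    using E A H g_hom unfolding injective_module_def by blast
  then obtain h where h: "h \<in> module_hom R H E" "\<And>a. a \<in> carrier ?A \<Longrightarrow> h a = g a" by blast
  have "x = \<one> \<odot>\<^bsub>H\<^esub> x" using x by simp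
  then have "x \<in> carrier ?A" "(x, \<iota> (\<rho> \<one>)) \<in> ?G" by auto
  then have "h x = \<iota> (\<rho> \<one>)" using h(2) bspec[OF graph, of "(x, \<iota> (\<rho> \<one>))"] by simp
  moreover have "\<rho> \<one> \<noteq> \<zero>\<^bsub>k\<^esub>" using ker one by auto
  then have "\<iota> (\<rho> \<one>) \<noteq> \<iota> \<zero>\<^bsub>k\<^esub>"
    using \<iota>(2) l1(1)[OF one_closed] by (auto dest: inj_onD)
  ultimately show ?thesis using h(1) \<iota>0 by (intro bexI[of _ h]) auto
qed

text \<open>As \<open>\<theta>\<close> is onto, rationality says that every homomorphism from
  \<open>H\<close> to \<open>E\<close> kills the closure of zero; homomorphisms to \<open>E\<close>
  detect each nonzero element.\<close>

lemma cl_rational_iff: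
  fixes H E k \<omega> :: "('a, 'a) module"
  assumes proper: "\<And>J. ideal J R \<Longrightarrow> J \<noteq> carrier R \<Longrightarrow> J \<subseteq> \<mm>" and one: "\<one> \<notin> \<mm>"
    and k: "quotient_map R (self_module R) \<mm> k \<rho>" and hull: "injective_hull R k E"
    and H: "module R H" and cl: "closure_operation R cl"
    and \<theta>: "\<theta> \<in> module_iso R \<omega> (hom_module R H E)"
  shows "cl_rational R cl H E \<omega> \<theta> \<longleftrightarrow> cl H {\<zero>\<^bsub>H\<^esub>} = {\<zero>\<^bsub>H\<^esub>}"
proof -
  interpret H: module R H by fact
  have E: "module R E" using hull by (auto simp: injective_hull_def injective_module_def)
  have bij: "\<theta> ` carrier \<omega> = carrier (hom_module R H E)"
    using \<theta> by (auto simp: module_iso_def bij_betw_def)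
  have sub: "submodule (cl H {\<zero>\<^bsub>H\<^esub>}) R H"
    using cl H H.zero_submodule unfolding closure_operation_def by blast
  have rational: "cl_rational R cl H E \<omega> \<theta> \<longleftrightarrow>
      (\<forall>f\<in>carrier (hom_module R H E). \<forall>x\<in>cl H {\<zero>\<^bsub>H\<^esub>}. f x = \<zero>\<^bsub>E\<^esub>)"
    unfolding cl_rational_def tau_omega_def hom_annihilator_def bij[symmetric] by blast
  show ?thesis
  proof
    assume rat: "cl_rational R cl H E \<omega> \<theta>"
    have "x = \<zero>\<^bsub>H\<^esub>" if x: "x \<in> cl H {\<zero>\<^bsub>H\<^esub>}" for x
    proof (rule ccontr)
      assume "x \<noteq> \<zero>\<^bsub>H\<^esub>"
      moreover have xc: "x \<in> carrier H" using x H.submoduleE(1)[OF sub] by blast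
      ultimately obtain f where f: "f \<in> module_hom R H E" "f x \<noteq> \<zero>\<^bsub>E\<^esub>"
        using injective_hull_cogenerator[OF proper one k hull H] by blast
      \<comment> \<open>The elements of \<open>hom_module\<close> are extensional functions, hence
        the restriction.\<close>
      have "restrict f (carrier H) \<in> module_hom R H E"
        by (rule module_homI) (use module_homD[OF f(1)] in auto)
      then have "restrict f (carrier H) \<in> carrier (hom_module R H E)"
        by (simp add: hom_module_def)
      then have "restrict f (carrier H) x = \<zero>\<^bsub>E\<^esub>" using rat x rational by blast
      then show False using f(2) xc by simp
    qed
    then show "cl H {\<zero>\<^bsub>H\<^esub>} = {\<zero>\<^bsub>H\<^esub>}" using H.submodule_zero_mem[OF sub] by blast
  next
    assume "cl H {\<zero>\<^bsub>H\<^esub>} = {\<zero>\<^bsub>H\<^esub>}"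
    then show "cl_rational R cl H E \<omega> \<theta>"
      unfolding rational using module_hom_zero[OF H E] by (simp add: hom_module_def)
  qed
qed

end


section \<open>Systems of parameters in local rings\<close>

text \<open>In \<open>enat\<close>, a nonempty set with finite supremum is finite and attains it.
  The empty sequence supplies nonemptiness; \<open>Sup {} = 0\<close> would otherwise allow depth 0
  without a witness.\<close>

lemma depth_attained:
  assumes "depth R \<mm> M = enat d" and "regular_sequence R M []"
  obtains xs where "set xs \<subseteq> \<mm>" "regular_sequence R M xs" "length xs = d"
proof -
  let ?A = "(\<lambda>xs. enat (length xs)) ` {xs. set xs \<subseteq> \<mm> \<and> regular_sequence R M xs}"
  have sup: "Sup ?A = enat d" using assms(1) by (simp add: depth_def)
  have ne: "?A \<noteq> {}" using assms(2) by (auto intro!: exI[of _ "[]"])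
  have fin: "finite ?A" using sup ne by (auto simp: Sup_enat_def split: if_splits)
  have "Max ?A = Sup ?A" by (rule cSup_eq_Max[OF fin ne, symmetric])
  then have "enat d \<in> ?A" using Max_in[OF fin ne] sup by metis
  then show ?thesis using that by auto
qed

context noetherian_cring
begin

lemma local_ring_proper_subset:
  assumes "{I. maximalideal I R} = {\<mm>}" "ideal J R" "J \<noteq> carrier R"
  shows "J \<subseteq> \<mm>"
proof -
  obtain M where "maximalideal M R" "J \<subseteq> M"
    using exists_maximal_ideal_above[OF assms(2,3)] by blast
  then show ?thesis using assms(1) by auto
qed

lemma prime_above_radical:
  assumes "ring_radical R J = \<mm>" and proper: "\<And>J. ideal J R \<Longrightarrow> J \<noteq> carrier R \<Longrightarrow> J \<subseteq> \<mm>"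
    and P: "primeideal P R" "J \<subseteq> P"
  shows "P = \<mm>"
proof
  show "P \<subseteq> \<mm>"
    using proper P primeideal.I_notcarr[OF P(1)] by (auto simp: primeideal_def)
  show "\<mm> \<subseteq> P"
    using assms(1) P(2) prime_pow_mem[OF P(1)] by (auto simp: ring_radical_def)
qed

lemma regular_sequence_self_nth:
  assumes "regular_sequence R (self_module R) xs" "i < length xs" "y \<in> carrier R"
    "xs ! i \<otimes> y \<in> Idl (set (take i xs))"
  shows "y \<in> Idl (set (take i xs))"
proof -
  have "set (take i xs) \<subseteq> carrier R"
    using assms(1) set_take_subset[of i xs] by (auto simp: regular_sequence_def)
  then show ?thesis
    using assms by (auto simp: regular_sequence_def span_mult_self)
qed

text \<open>A prime over the sequence other than \<open>\<mm>\<close> would end a chain with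
  \<open>length xs\<close> strict inclusions, and appending \<open>\<mm>\<close> would exceed the
  dimension.\<close>

lemma maximal_regular_sequence_parameters:
  assumes reg: "regular_sequence R (self_module R) xs" and xs: "set xs \<subseteq> \<mm>"
    and dim: "krull_dim R = enat (length xs)" and \<mm>: "primeideal \<mm> R"
    and proper: "\<And>J. ideal J R \<Longrightarrow> J \<noteq> carrier R \<Longrightarrow> J \<subseteq> \<mm>"
  shows "system_of_parameters R \<mm> xs"
proof -
  let ?n = "length xs"
  have xsc: "set xs \<subseteq> carrier R" using reg by (simp add: regular_sequence_def)
  have \<mm>i: "ideal \<mm> R" using \<mm> by (simp add: primeideal_def)
  have "P = \<mm>" if P: "primeideal P R" "Idl (set xs) \<subseteq> P" for P
  proof (rule ccontr)
    assume ne: "P \<noteq> \<mm>"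
    have "P \<subseteq> \<mm>" using proper P primeideal.I_notcarr[OF P(1)] by (auto simp: primeideal_def)
    then have lt: "P \<subset> \<mm>" using ne by blast
    have "set (take ?n xs) \<subseteq> P" using P(2) genideal_self[OF xsc] by auto
    then obtain Q where Q: "\<forall>i\<le>?n. primeideal (Q i) R" "\<forall>i<?n. Q i \<subset> Q (Suc i)" "Q ?n = P"
      using exists_prime_chain[OF xsc regular_sequence_self_nth[OF reg] order_refl P(1)] by blast
    let ?Q = "Q(Suc ?n := \<mm>)"
    have "\<forall>i\<le>Suc ?n. primeideal (?Q i) R" using Q(1) \<mm> by (simp add: le_Suc_eq)
    moreover have "\<forall>i<Suc ?n. ?Q i \<subset> ?Q (Suc i)" using Q(2,3) lt by (simp add: less_Suc_eq)
    ultimately have "enat (Suc ?n) \<le> krull_dim R"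
      unfolding krull_dim_def by (intro SUP_upper) blast
    then show False using dim by simp
  qed
  then have "ring_radical R (Idl (set xs)) = \<mm>"
    using radical_eq_if_only_prime[OF genideal_ideal[OF xsc] \<mm> genideal_minimal[OF \<mm>i xs]] by blast
  then show ?thesis using dim xs by (simp add: system_of_parameters_def)
qed

text \<open>Supplies parameter ideals inside arbitrarily high powers of \<open>\<mm>\<close>. The
  exponent is \<open>Suc n\<close> because exponent 0 would turn every element into 1.\<close>

lemma system_of_parameters_powers:
  fixes n :: nat
  assumes ys: "system_of_parameters R \<mm> ys" and \<mm>: "primeideal \<mm> R"
    and proper: "\<And>J. ideal J R \<Longrightarrow> J \<noteq> carrier R \<Longrightarrow> J \<subseteq> \<mm>"
  defines "zs \<equiv> map (\<lambda>y. y [^] Suc n) ys"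
  shows "system_of_parameters R \<mm> zs" and "Idl (set zs) \<subseteq> Idl (set ys)"
    and "Idl (set zs) \<subseteq> ideal_pow R \<mm> n"
proof -
  have \<mm>i: "ideal \<mm> R" using \<mm> by (simp add: primeideal_def)
  have ysm: "set ys \<subseteq> \<mm>" and rad: "ring_radical R (Idl (set ys)) = \<mm>"
    using ys by (auto simp: system_of_parameters_def)
  then have ysc: "set ys \<subseteq> carrier R" using ideal_subset[OF \<mm>i] by blast
  note Y = genideal_ideal[OF ysc] genideal_self[OF ysc]
  have mem: "y [^] Suc n \<in> J" if "ideal J R" "y \<in> J" for y J
    using that ideal.Icarr[of J R y] ideal.I_l_closed[of J R y "y [^] n"] by simp
  have zsm: "set zs \<subseteq> \<mm>" using ysm mem[OF \<mm>i] by (auto simp: zs_def simp del: nat_pow_Suc)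
  then have zsc: "set zs \<subseteq> carrier R" using ideal_subset[OF \<mm>i] by blast
  note Z = genideal_ideal[OF zsc] genideal_self[OF zsc]
  show "Idl (set zs) \<subseteq> Idl (set ys)"
    using Y(2) mem[OF Y(1)] by (intro genideal_minimal[OF Y(1)]) (auto simp: zs_def simp del: nat_pow_Suc)
  have "Idl (set zs) \<subseteq> ideal_pow R \<mm> (Suc n)"
    using ysm ysc nat_pow_mem_ideal_pow[of _ \<mm> "Suc n"]
    by (intro genideal_minimal[OF ideal_pow_ideal[OF \<mm>i]]) (auto simp: zs_def simp del: nat_pow_Suc ideal_pow.simps)
  then show "Idl (set zs) \<subseteq> ideal_pow R \<mm> n"
    using ideal_pow_antimono[OF \<mm>i, of n "Suc n"] by (auto simp del: ideal_pow.simps)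
  have "P = \<mm>" if P: "primeideal P R" "Idl (set zs) \<subseteq> P" for P
  proof -
    have "y \<in> P" if "y \<in> set ys" for y
      using prime_pow_mem[OF P(1), of y "Suc n"] that ysc Z(2) P(2) by (auto simp: zs_def simp del: nat_pow_Suc)
    then have "Idl (set ys) \<subseteq> P"
      using P(1) by (intro genideal_minimal) (auto simp: primeideal_def)
    then show ?thesis using prime_above_radical[OF rad proper P(1)] by blast
  qed
  then have "ring_radical R (Idl (set zs)) = \<mm>"
    using radical_eq_if_only_prime[OF Z(1) \<mm> genideal_minimal[OF \<mm>i zsm]] by blast
  then show "system_of_parameters R \<mm> zs"
    using ys zsm by (simp add: system_of_parameters_def zs_def)
qed

end

theorem theorem4p11:
  fixes R :: "'a ring" and \<mm> :: "'a set" and d :: nat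
    and k E H \<omega> :: "('a, 'a) module"
    and \<rho> :: "'a \<Rightarrow> 'a" and \<theta> :: "'a \<Rightarrow> 'a \<Rightarrow> 'a"
    and cl :: "('a, 'a) module \<Rightarrow> 'a set \<Rightarrow> 'a set"
  assumes universe: "infinite (UNIV :: 'a set)"
    and local_ring: "noetherian_local_ring R \<mm>"
    and complete: "adically_complete R \<mm>"
    and CM: "cohen_macaulay R \<mm>"
    and dim: "krull_dim R = enat d"
    and residue_field: "quotient_map R (self_module R) \<mm> k \<rho>"
    and hull: "injective_hull R k E"
    and top_cohomology: "is_local_cohomology R \<mm> d (self_module R) H"
    and canonical: "canonical_module R \<mm> \<omega>"
    and identification: "\<theta> \<in> module_iso R \<omega> (hom_module R H E)"
    and cl: "closure_operation R cl" "residual R cl" "functorial R cl"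
  shows "(cl_rational R cl H E \<omega> \<theta> \<longrightarrow>
           (\<forall>xs. system_of_parameters R \<mm> xs \<longrightarrow> cl_closed_ideal R cl (Idl\<^bsub>R\<^esub> (set xs)))) \<and>
         (injective_finiteness R cl H \<longrightarrow>
           (\<forall>xs. system_of_parameters R \<mm> xs \<longrightarrow> cl_closed_ideal R cl (Idl\<^bsub>R\<^esub> (set xs))) \<longrightarrow>
           cl_rational R cl H E \<omega> \<theta>)"
proof -
  interpret noetherian_cring R
    using local_ring by (simp add: noetherian_local_ring_def noetherian_cring_def)
  have max: "{I. maximalideal I R} = {\<mm>}"
    using local_ring by (simp add: noetherian_local_ring_def)
  then have maximal: "maximalideal \<mm> R" by blast
  have prime: "primeideal \<mm> R" using maximalideal_prime[OF maximal] .
  then have \<mm>: "ideal \<mm> R" by (simp add: primeideal_def)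
  note proper = local_ring_proper_subset[OF max]
  have one: "\<one>\<^bsub>R\<^esub> \<notin> \<mm>"
    using ideal.one_imp_carrier[OF \<mm>] primeideal.I_notcarr[OF prime] by auto
  obtain I \<delta> \<epsilon> where res: "injective_resolution R (self_module R) I \<delta> \<epsilon>"
    and "is_cohomology R (\<lambda>i. torsion_module R \<mm> (I i)) \<delta> d H"
    using top_cohomology unfolding is_local_cohomology_def by iprover
  then obtain \<pi> where \<pi>: "quotient_map R
      ((torsion_module R \<mm> (I d))\<lparr>carrier :=
        {x \<in> carrier (torsion_module R \<mm> (I d)). \<delta> d x = \<zero>\<^bsub>torsion_module R \<mm> (I (Suc d))\<^esub>}\<rparr>)
      (case d of 0 \<Rightarrow> {\<zero>\<^bsub>torsion_module R \<mm> (I 0)\<^esub>} | Suc k \<Rightarrow> \<delta> k ` carrier (torsion_module R \<mm> (I k)))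
      H \<pi>"
    unfolding is_cohomology_def by (elim exE) (rule that)
  interpret injective_complex R I \<delta> by (rule injective_resolution_complex[OF res])
  interpret top_local_cohomology R I \<delta> \<mm> d H \<pi>
    by (intro top_local_cohomology.intro top_local_cohomology_axioms.intro injective_complex_axioms \<mm> \<pi>)
  have base: "resolves 0 {\<zero>\<^bsub>R\<^esub>} (\<epsilon> \<one>\<^bsub>R\<^esub>)" by (rule injective_resolution_resolves[OF res])

  \<comment> \<open>The empty sequence is regular because \<open>R\<close> is not the zero
    ring.\<close>
  have "\<one>\<^bsub>R\<^esub> \<noteq> \<zero>\<^bsub>R\<^esub>" using one ideal_zero_mem[OF \<mm>] by auto
  then have "{\<zero>\<^bsub>R\<^esub>} \<noteq> carrier R" by auto
  then have "regular_sequence R (self_module R) []"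
    by (simp add: regular_sequence_def span_mult_self Idl_empty)
  moreover have "depth R \<mm> (self_module R) = enat d" using CM dim by (simp add: cohen_macaulay_def)
  ultimately obtain xs where xs: "set xs \<subseteq> \<mm>" "regular_sequence R (self_module R) xs" "length xs = d"
    using depth_attained by blast
  have xsc: "set xs \<subseteq> carrier R" using xs(2) by (simp add: regular_sequence_def)
  have sop: "system_of_parameters R \<mm> xs"
    using maximal_regular_sequence_parameters[OF xs(2,1) _ prime proper] dim xs(3) by simp
  obtain \<xi> where "resolves d (Idl\<^bsub>R\<^esub> (set xs)) \<xi>"
    using regular_sequence_resolves[OF base xsc regular_sequence_self_nth[OF xs(2)], of d] xs(3) by auto
  \<comment> \<open>This vanishing transfers the Cohen-Macaulay property from the one sequence
    \<open>xs\<close> to all systems of parameters.\<close>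
  then have depth: "exact_at i \<mm>" if "i < d" for i
    using resolves_exact_at_above[OF _ genideal_ideal[OF xsc] \<mm> genideal_minimal[OF \<mm> xs(1)] that] by blast

  have resolved: "\<exists>\<xi>. resolves d (Idl\<^bsub>R\<^esub> (set ys)) \<xi>" if ys: "system_of_parameters R \<mm> ys" for ys
  proof -
    have *: "length ys = d" "set ys \<subseteq> \<mm>" "ring_radical R (Idl\<^bsub>R\<^esub> (set ys)) = \<mm>"
      using ys dim by (auto simp: system_of_parameters_def)
    show ?thesis
      using parameter_ideal_resolves[OF base \<mm> *(2) prime_above_radical[OF *(3) proper]] depth *(1)
      by blast
  qed

  have model: "\<exists>n p. ideal (Idl\<^bsub>R\<^esub> (set ys)) R \<and> ideal_pow R \<mm> n \<subseteq> Idl\<^bsub>R\<^esub> (set ys) \<and>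
      quotient_map R (self_module R) (Idl\<^bsub>R\<^esub> (set ys)) (H\<lparr>carrier := \<pi> ` cyc d (Idl\<^bsub>R\<^esub> (set ys))\<rparr>) p"
    if ys: "system_of_parameters R \<mm> ys" for ys
  proof -
    let ?J = "Idl\<^bsub>R\<^esub> (set ys)"
    have *: "set ys \<subseteq> \<mm>" "ring_radical R ?J = \<mm>"
      using ys by (auto simp: system_of_parameters_def)
    have J: "ideal ?J R" using *(1) ideal_subset[OF \<mm>] by (intro genideal_ideal) blast
    obtain n where n: "ideal_pow R \<mm> n \<subseteq> ?J"
      using ideal_pow_subset_of_radical[OF \<mm> J] *(2) by blast
    obtain \<zeta> where \<zeta>: "resolves d ?J \<zeta>" using resolved[OF ys] by blast
    \<comment> \<open>The powers with exponent \<open>Suc k\<close> again form a system of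
      parameters, so the ideal they generate is resolved in degree \<open>d\<close>; in particular
      it has no cohomology below \<open>d\<close>.\<close>
    have "\<exists>K. ideal K R \<and> K \<subseteq> ?J \<and> K \<subseteq> ideal_pow R \<mm> k \<and> (\<forall>i<d. exact_at i K)" for k
    proof -
      let ?zs = "map (\<lambda>y. y [^]\<^bsub>R\<^esub> Suc k) ys"
      note zs = system_of_parameters_powers[OF ys prime proper, of k]
      obtain \<zeta>' where \<zeta>': "resolves d (Idl\<^bsub>R\<^esub> (set ?zs)) \<zeta>'" using resolved[OF zs(1)] by blast
      have "set ?zs \<subseteq> carrier R"
        using zs(1) ideal_subset[OF \<mm>] by (auto simp: system_of_parameters_def)
      then have "ideal (Idl\<^bsub>R\<^esub> (set ?zs)) R" by (rule genideal_ideal)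
      moreover have "\<forall>i<d. exact_at i (Idl\<^bsub>R\<^esub> (set ?zs))" using \<zeta>' by (simp add: resolves_def)
      ultimately show ?thesis using zs(2,3) by blast
    qed
    then show ?thesis using quotient_map_image_cyc[OF J n \<zeta>] J n by blast
  qed
  have closed_iff: "cl_closed_ideal R cl (Idl\<^bsub>R\<^esub> (set ys)) \<longleftrightarrow>
      cl (H\<lparr>carrier := \<pi> ` cyc d (Idl\<^bsub>R\<^esub> (set ys))\<rparr>) {\<zero>\<^bsub>H\<^esub>} = {\<zero>\<^bsub>H\<^esub>}"
    and sub: "submodule (\<pi> ` cyc d (Idl\<^bsub>R\<^esub> (set ys))) R H"
    if ys: "system_of_parameters R \<mm> ys" for ys
  proof -
    obtain n p where J: "ideal (Idl\<^bsub>R\<^esub> (set ys)) R" "ideal_pow R \<mm> n \<subseteq> Idl\<^bsub>R\<^esub> (set ys)"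
      and q: "quotient_map R (self_module R) (Idl\<^bsub>R\<^esub> (set ys)) (H\<lparr>carrier := \<pi> ` cyc d (Idl\<^bsub>R\<^esub> (set ys))\<rparr>) p"
      using model[OF ys] by blast
    show "submodule (\<pi> ` cyc d (Idl\<^bsub>R\<^esub> (set ys))) R H" by (rule image_cyc_submodule[OF J])
    show "cl_closed_ideal R cl (Idl\<^bsub>R\<^esub> (set ys)) \<longleftrightarrow>
      cl (H\<lparr>carrier := \<pi> ` cyc d (Idl\<^bsub>R\<^esub> (set ys))\<rparr>) {\<zero>\<^bsub>H\<^esub>} = {\<zero>\<^bsub>H\<^esub>}"
      using residual_closed_iff[OF cl(1,2) self_module_module _ q] J(1)
      by (simp add: cl_closed_ideal_def submodule_self_iff_ideal)
  qed
  have zero_mem: "\<zero>\<^bsub>H\<^esub> \<in> cl (H\<lparr>carrier := N\<rparr>) {\<zero>\<^bsub>H\<^esub>}" if "submodule N R H" for N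
  proof -
    have N: "module R (H\<lparr>carrier := N\<rparr>)" using submodule.submodule_is_module[OF that H_module] .
    then show ?thesis
      using cl(1) module.zero_submodule[OF N] unfolding closure_operation_def by auto
  qed
  have rational: "cl_rational R cl H E \<omega> \<theta> \<longleftrightarrow> cl H {\<zero>\<^bsub>H\<^esub>} = {\<zero>\<^bsub>H\<^esub>}"
    by (rule cl_rational_iff[OF proper one residue_field hull H_module cl(1) identification])
  show ?thesis
  proof (intro conjI impI allI)
    fix ys assume rat: "cl_rational R cl H E \<omega> \<theta>" and ys: "system_of_parameters R \<mm> ys"
    \<comment> \<open>\<open>H\<close> is written as its own submodule so that
      \<open>closure_zero_mono\<close> covers the inclusion into all of \<open>H\<close>.\<close>
    have "cl (H\<lparr>carrier := \<pi> ` cyc d (Idl\<^bsub>R\<^esub> (set ys))\<rparr>) {\<zero>\<^bsub>H\<^esub>} \<subseteq> cl (H\<lparr>carrier := carrier H\<rparr>) {\<zero>\<^bsub>H\<^esub>}"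
      by (rule closure_zero_mono[OF cl(3) H_module sub[OF ys] H.carrier_is_submodule H.submoduleE(1)[OF sub[OF ys]]])
    also have "\<dots> = {\<zero>\<^bsub>H\<^esub>}" using rat rational by simp
    finally show "cl_closed_ideal R cl (Idl\<^bsub>R\<^esub> (set ys))"
      using closed_iff[OF ys] zero_mem[OF sub[OF ys]] by blast
  next
    assume fin: "injective_finiteness R cl H"
      and closed: "\<forall>ys. system_of_parameters R \<mm> ys \<longrightarrow> cl_closed_ideal R cl (Idl\<^bsub>R\<^esub> (set ys))"
    have "h = \<zero>\<^bsub>H\<^esub>" if "h \<in> cl H {\<zero>\<^bsub>H\<^esub>}" for h
    proof -
      have "h \<in> finitistic R cl H {\<zero>\<^bsub>H\<^esub>}"
        using that fin by (simp add: injective_finiteness_def)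
      then obtain N and Q :: "('a, 'a) module" and \<psi> where h: "h \<in> cl (H\<lparr>carrier := N\<rparr>) {\<zero>\<^bsub>H\<^esub>}"
        and N: "submodule N R H"
        and fg: "quotient_map R (H\<lparr>carrier := N\<rparr>) {\<zero>\<^bsub>H\<^esub>} Q \<psi>" "fg_module R Q"
        unfolding finitistic_def by blast
      obtain X where X: "finite X" "X \<subseteq> N" "\<forall>N'. submodule N' R H \<and> X \<subseteq> N' \<longrightarrow> N \<subseteq> N'"
        using fg_quotient_by_zero[OF H_module N fg] by (elim exE conjE) (rule that)
      obtain n where n: "\<And>J. J \<subseteq> ideal_pow R \<mm> n \<Longrightarrow> X \<subseteq> \<pi> ` cyc d J"
        using finite_subset_image_cyc[OF X(1)] X(2) H.submoduleE(1)[OF N] by (metis order_trans)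
      \<comment> \<open>The parameter ideal of these powers lies inside the \<open>n\<close>-th
        power of \<open>\<mm>\<close>, so its copy of the residue ring contains the generators
        \<open>X\<close>, and therefore \<open>N\<close>.\<close>
      let ?zs = "map (\<lambda>x. x [^]\<^bsub>R\<^esub> Suc n) xs"
      note zs = system_of_parameters_powers[OF sop prime proper, of n]
      have "N \<subseteq> \<pi> ` cyc d (Idl\<^bsub>R\<^esub> (set ?zs))"
        using X(3) sub[OF zs(1)] n[OF zs(3)] by simp
      then have "cl (H\<lparr>carrier := N\<rparr>) {\<zero>\<^bsub>H\<^esub>} \<subseteq>
          cl (H\<lparr>carrier := \<pi> ` cyc d (Idl\<^bsub>R\<^esub> (set ?zs))\<rparr>) {\<zero>\<^bsub>H\<^esub>}"
        by (intro closure_zero_mono[OF cl(3) H_module] N sub zs(1))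
      also have "\<dots> = {\<zero>\<^bsub>H\<^esub>}" using closed closed_iff[OF zs(1)] zs(1) by blast
      finally show ?thesis using h by blast
    qed
    then show "cl_rational R cl H E \<omega> \<theta>"
      using rational zero_mem[OF H.carrier_is_submodule] by auto
  qed
qed

end
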